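(* Let each of $M_1,M_2,\ldots,M_n$ be a (finite) projective plane or affine plane, viewed as a rank-$3$ matroid, on pairwise disjoint ground sets, and let $q_i$ be the order of $M_i$. If $q_1>q_2>\cdots>q_n$, then the iterated free product $M_1\mathbin{\Box} M_2\mathbin{\Box}\cdots\mathbin{\Box} M_n$ is extremal.
   Context: A projective (respectively affine) plane of order $q$ ($q\ge 2$) is viewed as the simple rank-$3$ matroid whose elements are its points and whose rank-$2$ flats are its lines; it has $q^2+q+1$ (respectively $q^2$) elements and each line has $q+1$ (respectively $q$) elements. The planes need not be Desarguesian. For matroids $M,N$ on disjoint ground sets, the free product $M\mathbin{\Box}N$ is the matroid on $E(M)\cup E(N)$ whose independent sets are the sets $I\cup J$ where $I$ is independent in $M$, $J\subseteq E(N)$, and $|I\cup J|\le r(M)+r_N(J)$. This operation is associative. For a matroid $M$ on $[n]$, $\mathcal{P}(M)\subset\mathbb{R}^n$ is the convex hull of the characteristic vectors of the bases of $M$. For $X\subseteq\mathbb{R}^n$ with indicator function $\bar{\mathbb{I}}(X)$, the symmetrized indicator function is $\mathbb{I}(X)(x_1,\ldots,x_n)=\frac{1}{n!}\sum_{\sigma\in S_n}\bar{\mathbb{I}}(X)(x_{\sigma(1)},\ldots,x_{\sigma(n)})$. $\mathbb{I}(\mathcal{P}(M))$ depends only on the isomorphism class of $M$, so it is defined for matroids on any $n$-element ground set and for unlabeled matroids (isomorphism classes). A cyclic flat of $M$ is a flat that is a (possibly empty) union of circuits; $M$ is nested if its cyclic flats form a chain under inclusion. Fix a linear order $N_1,\ldots,N_{\binom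 nr}$ of the unlabeled rank-$r$ nested matroids on $n$ elements. By a theorem of Derksen and Fink, for each rank-$r$ matroid $M$ on $n$ elements there is a unique integer vector $\boldsymbol{v}_M=(a_1,\ldots,a_{\binom nr})$ with $\mathbb{I}(\mathcal{P}(M))=\sum_i a_i\,\mathbb{I}(\mathcal{P}(N_i))$. The polytope $\Omega_{r,n}$ is the convex hull of all vectors $\boldsymbol{v}_M$, $M$ ranging over rank-$r$ matroids on $n$ elements. $M$ is extremal if $\boldsymbol{v}_M$ is a vertex of $\Omega_{r,n}$. *)

theory Defs
  imports "HOL-Analysis.Analysis" "HOL-Library.Function_Algebras"
    "HOL-Library.Disjoint_Sets" "HOL-Combinatorics.Permutations"
begin

text \<open>
  The dimensions of the Euclidean spaces below depend on the matroids. The space of real vectors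
  indexed by a finite set of natural numbers is therefore taken to be the subspace of functions
  \<^typ>\<open>nat \<Rightarrow> real\<close> that vanish outside that set, with the pointwise vector space structure.
\<close>

instantiation "fun" :: (type, scaleR) scaleR
begin

definition scaleR_fun_def: "c *\<^sub>R f = (\<lambda>x. c *\<^sub>R f x)"

instance ..

end

instance "fun" :: (type, real_vector) real_vector
  by standard (auto simp: scaleR_fun_def fun_eq_iff scaleR_add_right scaleR_add_left)


section \<open>Matroids\<close>

record 'a matroid =
  ground :: "'a set"
  indep :: "'a set \<Rightarrow> bool"

definition matroid :: "'a matroid \<Rightarrow> bool" where
  "matroid M \<longleftrightarrow>
     finite (ground M) \<and>
     (\<forall>I. indep M I \<longrightarrow> I \<subseteq> ground M) \<and>
     indep M {} \<and>
     (\<forall>I J. indep M J \<and> I \<subseteq> J \<longrightarrow> indep M I) \<and>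
     (\<forall>I J. indep M I \<and> indep M J \<and> card I < card J \<longrightarrow> (\<exists>x\<in>J - I. indep M (insert x I)))"

definition rank_in :: "'a matroid \<Rightarrow> 'a set \<Rightarrow> nat" where
  "rank_in M X = Max {card I | I. I \<subseteq> X \<and> indep M I}"

definition matroid_rank :: "'a matroid \<Rightarrow> nat" where
  "matroid_rank M = rank_in M (ground M)"

definition basis :: "'a matroid \<Rightarrow> 'a set \<Rightarrow> bool" where
  "basis M B \<longleftrightarrow> indep M B \<and> (\<forall>I. indep M I \<and> B \<subseteq> I \<longrightarrow> I = B)"

definition circuit :: "'a matroid \<Rightarrow> 'a set \<Rightarrow> bool" where
  "circuit M C \<longleftrightarrow> C \<subseteq> ground M \<and> \<not> indep M C \<and> (\<forall>D. D \<subset> C \<longrightarrow> indep M D)"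

definition flat :: "'a matroid \<Rightarrow> 'a set \<Rightarrow> bool" where
  "flat M F \<longleftrightarrow> F \<subseteq> ground M \<and> (\<forall>x\<in>ground M - F. rank_in M F < rank_in M (insert x F))"

definition cyclic_flat :: "'a matroid \<Rightarrow> 'a set \<Rightarrow> bool" where
  "cyclic_flat M F \<longleftrightarrow> flat M F \<and> (\<exists>\<C> \<subseteq> {C. circuit M C}. F = \<Union>\<C>)"

definition nested :: "'a matroid \<Rightarrow> bool" where
  "nested M \<longleftrightarrow> chain\<^sub>\<subseteq> {F. cyclic_flat M F}"

text \<open>No loops (circuits of size 1) and no parallel elements (circuits of size 2).\<close>

definition simple_matroid :: "'a matroid \<Rightarrow> bool" where
  "simple_matroid M \<longleftrightarrow> (\<forall>C. circuit M C \<longrightarrow> 3 \<le> card C)"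

definition isomorphic :: "'a matroid \<Rightarrow> 'b matroid \<Rightarrow> bool" where
  "isomorphic M N \<longleftrightarrow>
     (\<exists>f. bij_betw f (ground M) (ground N) \<and>
          (\<forall>I \<subseteq> ground M. indep M I \<longleftrightarrow> indep N (f ` I)))"

text \<open>Meaningful for matroids on disjoint ground sets only.\<close>

definition free_product :: "'a matroid \<Rightarrow> 'a matroid \<Rightarrow> 'a matroid"  (infixl \<open>\<box>\<close> 65) where
  "M \<box> N =
     \<lparr>ground = ground M \<union> ground N,
      indep = (\<lambda>S. \<exists>I J. S = I \<union> J \<and> indep M I \<and> J \<subseteq> ground N \<and>
                         card (I \<union> J) \<le> matroid_rank M + rank_in N J)\<rparr>"

text \<open>The product \<open>M 1 \<box> M 2 \<box> \<dots> \<box> M n\<close>, for \<open>n \<ge> 1\<close>, bracketed to the left.\<close>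

definition iterated_free_product :: "(nat \<Rightarrow> 'a matroid) \<Rightarrow> nat \<Rightarrow> 'a matroid" where
  "iterated_free_product M n = foldl (\<box>) (M 1) (map M [2..<Suc n])"


section \<open>Finite projective and affine planes\<close>

text \<open>Points \<open>P\<close>, lines \<open>L\<close> (as sets of points), order \<open>q\<close>.\<close>

definition projective_plane :: "nat \<Rightarrow> 'a set \<Rightarrow> 'a set set \<Rightarrow> bool" where
  "projective_plane q P L \<longleftrightarrow>
     2 \<le> q \<and> finite P \<and> L \<subseteq> Pow P \<and>
     (\<forall>x\<in>P. \<forall>y\<in>P. x \<noteq> y \<longrightarrow> (\<exists>!l. l \<in> L \<and> x \<in> l \<and> y \<in> l)) \<and>
     (\<forall>l\<in>L. \<forall>m\<in>L. l \<noteq> m \<longrightarrow> (\<exists>!x. x \<in> l \<and> x \<in> m)) \<and>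
     (\<exists>Q \<subseteq> P. card Q = 4 \<and> (\<forall>l\<in>L. card (Q \<inter> l) \<le> 2)) \<and>
     (\<forall>l\<in>L. card l = q + 1)"

definition affine_plane :: "nat \<Rightarrow> 'a set \<Rightarrow> 'a set set \<Rightarrow> bool" where
  "affine_plane q P L \<longleftrightarrow>
     2 \<le> q \<and> finite P \<and> L \<subseteq> Pow P \<and>
     (\<forall>x\<in>P. \<forall>y\<in>P. x \<noteq> y \<longrightarrow> (\<exists>!l. l \<in> L \<and> x \<in> l \<and> y \<in> l)) \<and>
     (\<forall>l\<in>L. \<forall>x\<in>P - l. \<exists>!m. m \<in> L \<and> x \<in> m \<and> l \<inter> m = {}) \<and>
     (\<exists>T \<subseteq> P. card T = 3 \<and> (\<forall>l\<in>L. card (T \<inter> l) \<le> 2)) \<and>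
     (\<forall>l\<in>L. card l = q)"

definition projective_plane_matroid :: "nat \<Rightarrow> 'a matroid \<Rightarrow> bool" where
  "projective_plane_matroid q M \<longleftrightarrow>
     matroid M \<and> simple_matroid M \<and> matroid_rank M = 3 \<and>
     projective_plane q (ground M) {F. flat M F \<and> rank_in M F = 2}"

definition affine_plane_matroid :: "nat \<Rightarrow> 'a matroid \<Rightarrow> bool" where
  "affine_plane_matroid q M \<longleftrightarrow>
     matroid M \<and> simple_matroid M \<and> matroid_rank M = 3 \<and>
     affine_plane q (ground M) {F. flat M F \<and> rank_in M F = 2}"


section \<open>Base polytopes and symmetrized indicator functions\<close>

definition base_polytope :: "nat matroid \<Rightarrow> (nat \<Rightarrow> real) set" where
  "base_polytope M = convex hull {indicat_real B | B. basis M B}"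

text \<open>
  Permutations of \<open>{1..n}\<close> fix all other indices. So for a set \<open>X\<close> of functions vanishing outside
  \<open>{1..n}\<close>, the function below is zero at every \<open>x\<close> that does not vanish outside \<open>{1..n}\<close>, and an
  identity between such functions is an identity of functions on the \<open>n\<close>-dimensional space.
\<close>

definition sym_indicator :: "nat \<Rightarrow> (nat \<Rightarrow> real) set \<Rightarrow> (nat \<Rightarrow> real) \<Rightarrow> real" where
  "sym_indicator n X x = (1 / fact n) * (\<Sum>\<sigma> | \<sigma> permutes {1..n}. indicat_real X (x \<circ> \<sigma>))"

text \<open>For an arbitrary finite ground set, the matroid is first copied to \<open>{1..n}\<close>.\<close>

definition standard_copy :: "'a matroid \<Rightarrow> nat matroid" where
  "standard_copy M =
     (SOME N. matroid N \<and> ground N = {1..card (ground M)} \<and> isomorphic M N)"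

definition sym_matroid_indicator :: "'a matroid \<Rightarrow> (nat \<Rightarrow> real) \<Rightarrow> real" where
  "sym_matroid_indicator M =
     sym_indicator (card (ground M)) (base_polytope (standard_copy M))"


section \<open>Extremal matroids\<close>

definition matroids_on :: "nat \<Rightarrow> nat \<Rightarrow> nat matroid set" where
  "matroids_on r n = {M. matroid M \<and> ground M = {1..n} \<and> matroid_rank M = r}"

text \<open>
  \<open>N 1, \<dots>, N (n choose r)\<close> lists the unlabeled nested matroids of rank \<open>r\<close> on \<open>n\<close> elements: it
  contains exactly one representative of each isomorphism class.
\<close>

definition nested_enumeration :: "nat \<Rightarrow> nat \<Rightarrow> (nat \<Rightarrow> nat matroid) \<Rightarrow> bool" where
  "nested_enumeration r n N \<longleftrightarrow>
     (\<forall>i \<in> {1..n choose r}. N i \<in> matroids_on r n \<and> nested (N i)) \<and>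
     (\<forall>M \<in> matroids_on r n. nested M \<longrightarrow> (\<exists>!i. i \<in> {1..n choose r} \<and> isomorphic M (N i)))"

definition nested_vector :: "(nat \<Rightarrow> nat matroid) \<Rightarrow> 'a matroid \<Rightarrow> nat \<Rightarrow> real" where
  "nested_vector N M =
     (let k = card (ground M) choose matroid_rank M in
      THE a. (\<forall>i. a i \<in> \<int>) \<and> (\<forall>i. i \<notin> {1..k} \<longrightarrow> a i = 0) \<and>
             sym_matroid_indicator M = (\<lambda>x. \<Sum>i = 1..k. a i * sym_matroid_indicator (N i) x))"

definition Omega :: "(nat \<Rightarrow> nat matroid) \<Rightarrow> nat \<Rightarrow> nat \<Rightarrow> (nat \<Rightarrow> real) set" where
  "Omega N r n = convex hull (nested_vector N ` matroids_on r n)"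

text \<open>The list \<open>N\<close> of nested matroids labels the coordinates of the ambient space.\<close>

definition extremal :: "(nat \<Rightarrow> nat matroid) \<Rightarrow> 'a matroid \<Rightarrow> bool" where
  "extremal N M \<longleftrightarrow>
     nested_vector N M extreme_point_of Omega N (matroid_rank M) (card (ground M))"

end

theory Submission
  imports Defs
begin

text \<open>
  Up to the factor \<open>n!\<close>, the symmetrized indicator function of a matroid on \<open>{1..n}\<close> counts, for a
  point \<open>x\<close>, the arrangements \<open>x \<circ> \<sigma>\<close> of its coordinates that lie in the base polytope
  (\<open>sym_count\<close>). By Edmonds' theorem (\<open>base_polytope_eq_rank_polytope\<close>) this polytope is given by
  the inequalities \<open>x(A) \<le> r A\<close>, so the count depends only on the rank function.

  \<^bold>\<open>Coordinates.\<close> The coordinate vectors are well defined because the counting functions of the nested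
  matroids form a basis, over the integers, of what all matroids span. They span, since the indicator
  of a base polytope is an alternating sum, over chains of sets, of indicators of the polytopes in
  which only the rank conditions of the chain are imposed, and those belong to nested matroids
  (\<open>rank_polytope_in_nested_span\<close>). They are independent, since a linear relation between counting
  functions forces the same relation between numbers of flags of flats with prescribed sizes
  (\<open>flag_relation\<close>): these numbers can be read off from values of the indicator function close to a
  suitable point, and they are triangular on nested matroids (\<open>path_matroids_independent\<close>). So a
  coordinate vector is a vertex once the counting function is not a proper convex combination of
  others (\<open>extremal_if_indicator_extreme\<close>).

  \<^bold>\<open>Rigidity.\<close> Let \<open>f = \<Sum>j. w j * f j\<close> be a convex combination of counting functions, where \<open>f\<close>
  belongs to the product of the planes (\<open>rigid\<close>). Whenever a quantity that depends linearly on the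
  counting function is at most as large for every \<open>f j\<close> as for \<open>f\<close>, it is the same for all of them.
  This is used three times.

  First, consider the point that is constant on each plane, with total weight three there. The
  orders decrease, so the planes shrink and the weights grow from one plane to the next; hence every
  arrangement of this point in the polytope of the product fills the planes in their order, with no
  slack. The vanishing of \<open>f\<close> close to this point is inherited by the \<open>f j\<close>, and it follows that each
  \<open>f j\<close> comes from a matroid with a chain of sets of the same sizes and ranks (\<open>chain_forced\<close>,
  \<open>weight_count\<close>).

  Second, count the flags of flats that pass through this chain and contain, between any two of its
  members, a point and a line of the size of the lines of the plane. Two such lines through a point
  share no other point, so a plane has the largest possible number of such pairs. Hence the minors
  of the other matroids between consecutive members of the chain also have that number, and their
  lines form linear spaces with the same parameters (\<open>block_flags_bound\<close>).

  Third, the conditions for the chain and for these lines alone define a polytope, and it contains the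
  base polytope of the other matroid; for the product it is the base polytope. The number of
  arrangements of any \<open>x\<close> in that polytope does not depend on how the lines intersect, because at most
  one line condition per plane can fail (\<open>line_polytope_count\<close>). So \<open>f j \<le> f\<close> everywhere, and therefore
  \<open>f j = f\<close>.
\<close>

section \<open>Rank functions of matroids\<close>

definition rank_function :: "'a set \<Rightarrow> ('a set \<Rightarrow> nat) \<Rightarrow> bool" where
  "rank_function E r \<longleftrightarrow> finite E \<and> (\<forall>A\<subseteq>E. r A \<le> card A) \<and>
     (\<forall>A B. A \<subseteq> B \<and> B \<subseteq> E \<longrightarrow> r A \<le> r B) \<and>
     (\<forall>A B. A \<subseteq> E \<and> B \<subseteq> E \<longrightarrow> r (A \<union> B) + r (A \<inter> B) \<le> r A + r B)"

lemma rank_functionD: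
  assumes "rank_function E r"
  shows "finite E" "A \<subseteq> E \<Longrightarrow> r A \<le> card A" "A \<subseteq> B \<Longrightarrow> B \<subseteq> E \<Longrightarrow> r A \<le> r B"
    "A \<subseteq> E \<Longrightarrow> B \<subseteq> E \<Longrightarrow> r (A \<union> B) + r (A \<inter> B) \<le> r A + r B" "r {} = 0"
proof -
  show "r {} = 0"
    using assms unfolding rank_function_def by (metis card.empty empty_subsetI le_zero_eq)
qed (use assms in \<open>simp_all add: rank_function_def\<close>)

lemma rank_function_subset: "rank_function E r \<Longrightarrow> E' \<subseteq> E \<Longrightarrow> rank_function E' r"
  unfolding rank_function_def by (meson finite_subset order_trans)

lemma matroidD:
  assumes "matroid M"
  shows "finite (ground M)" "indep M I \<Longrightarrow> I \<subseteq> ground M" "indep M {}"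
    "indep M J \<Longrightarrow> I \<subseteq> J \<Longrightarrow> indep M I" "indep M I \<Longrightarrow> finite I"
    "indep M I \<Longrightarrow> indep M J \<Longrightarrow> card I < card J \<Longrightarrow> \<exists>x\<in>J - I. indep M (insert x I)"
proof -
  show "indep M I \<Longrightarrow> finite I"
    using assms unfolding matroid_def by (meson finite_subset)
  show "indep M J \<Longrightarrow> I \<subseteq> J \<Longrightarrow> indep M I"
    using assms unfolding matroid_def by meson
qed (use assms in \<open>simp_all add: matroid_def\<close>)

lemma finite_indep_cards: "matroid M \<Longrightarrow> finite {card I | I. I \<subseteq> A \<and> indep M I}"
proof -
  assume M: "matroid M"
  have "{card I | I. I \<subseteq> A \<and> indep M I} \<subseteq> card ` Pow (ground M)"
    using matroidD(2)[OF M] by blast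
  then show ?thesis
    using matroidD(1)[OF M] by (meson finite_Pow_iff finite_imageI finite_subset)
qed

lemma indep_card_le_rank: "matroid M \<Longrightarrow> indep M I \<Longrightarrow> I \<subseteq> A \<Longrightarrow> card I \<le> rank_in M A"
  unfolding rank_in_def by (rule Max_ge[OF finite_indep_cards]) auto

lemma rank_attained:
  assumes "matroid M"
  shows "\<exists>I. I \<subseteq> A \<and> indep M I \<and> card I = rank_in M A"
proof -
  have "{card I | I. I \<subseteq> A \<and> indep M I} \<noteq> {}"
    using matroidD(3)[OF assms] by blast
  from Max_in[OF finite_indep_cards[OF assms] this] show ?thesis
    unfolding rank_in_def by auto
qed

lemma rank_leI: "matroid M \<Longrightarrow> (\<And>I. I \<subseteq> A \<Longrightarrow> indep M I \<Longrightarrow> card I \<le> k) \<Longrightarrow> rank_in M A \<le> k"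
  using rank_attained by metis

lemma indep_extend:
  assumes M: "matroid M" and "indep M I" "I \<subseteq> A"
  shows "\<exists>J. I \<subseteq> J \<and> J \<subseteq> A \<and> indep M J \<and> card J = rank_in M A"
  using assms(2,3)
proof (induction "rank_in M A - card I" arbitrary: I rule: less_induct)
  case less
  show ?case
  proof (cases "card I < rank_in M A")
    case True
    obtain J where J: "J \<subseteq> A" "indep M J" "card J = rank_in M A"
      using rank_attained[OF M] by metis
    then obtain x where x: "x \<in> J - I" "indep M (insert x I)"
      using matroidD(6)[OF M less.prems(1)] True by metis
    have "card (insert x I) = Suc (card I)"
      using x matroidD(5)[OF M less.prems(1)] by simp
    with True have "rank_in M A - card (insert x I) < rank_in M A - card I" by simp
    from less.hyps[OF this x(2)] less.prems x J show ?thesis by blast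
  next
    case False
    with indep_card_le_rank[OF M less.prems] less.prems show ?thesis by force
  qed
qed

lemma rank_function_rank_in:
  assumes M: "matroid M"
  shows "rank_function (ground M) (rank_in M)"
  unfolding rank_function_def
proof (intro conjI allI impI)
  show "finite (ground M)" using matroidD(1)[OF M] .
next
  fix A assume "A \<subseteq> ground M"
  then have "finite A" using matroidD(1)[OF M] finite_subset by blast
  then show "rank_in M A \<le> card A" by (intro rank_leI[OF M]) (rule card_mono)
next
  fix A B assume "A \<subseteq> B \<and> B \<subseteq> ground M"
  then show "rank_in M A \<le> rank_in M B"
    by (intro rank_leI[OF M] indep_card_le_rank[OF M]) auto
next
  fix A B assume AB: "A \<subseteq> ground M \<and> B \<subseteq> ground M"
  obtain I where I: "I \<subseteq> A \<inter> B" "indep M I" "card I = rank_in M (A \<inter> B)"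
    using rank_attained[OF M] by metis
  then obtain J where J: "I \<subseteq> J" "J \<subseteq> A \<union> B" "indep M J" "card J = rank_in M (A \<union> B)"
    using indep_extend[OF M, of I "A \<union> B"] by blast
  have fin: "finite J" using matroidD(5)[OF M J(3)] .
  have "card J + card I \<le> card J + card (J \<inter> A \<inter> B)"
    using I J fin by (intro add_left_mono card_mono) auto
  also have "\<dots> = card ((J \<inter> A) \<union> (J \<inter> B)) + card ((J \<inter> A) \<inter> (J \<inter> B))"
    using J(2) by (intro arg_cong2[where f="(+)"] arg_cong[where f=card]) auto
  also have "\<dots> = card (J \<inter> A) + card (J \<inter> B)"
    using fin by (intro card_Un_Int[symmetric]) auto
  also have "\<dots> \<le> rank_in M A + rank_in M B"
    by (intro add_mono indep_card_le_rank[OF M] matroidD(4)[OF M J(3)]) auto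
  finally show "rank_in M (A \<union> B) + rank_in M (A \<inter> B) \<le> rank_in M A + rank_in M B"
    using I J by simp
qed

lemma indep_iff_rank:
  assumes M: "matroid M"
  shows "indep M I \<longleftrightarrow> I \<subseteq> ground M \<and> rank_in M I = card I"
proof
  assume "indep M I"
  then show "I \<subseteq> ground M \<and> rank_in M I = card I"
    using indep_card_le_rank[OF M, of I I] matroidD(2)[OF M]
      rank_functionD(2)[OF rank_function_rank_in[OF M], of I] by force
next
  assume I: "I \<subseteq> ground M \<and> rank_in M I = card I"
  then obtain J where "J \<subseteq> I" "indep M J" "card J = card I"
    using rank_attained[OF M, of I] by auto
  moreover have "finite I" using I matroidD(1)[OF M] finite_subset by blast
  ultimately show "indep M I" using card_subset_eq by blast
qed

lemma basis_iff:
  assumes M: "matroid M"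
  shows "basis M B \<longleftrightarrow> indep M B \<and> card B = matroid_rank M"
proof
  assume B: "basis M B"
  then have ind: "indep M B" unfolding basis_def by blast
  then obtain J where "B \<subseteq> J" "indep M J" "card J = rank_in M (ground M)"
    using indep_extend[OF M ind matroidD(2)[OF M ind]] by blast
  then show "indep M B \<and> card B = matroid_rank M"
    using B unfolding basis_def matroid_rank_def by metis
next
  assume B: "indep M B \<and> card B = matroid_rank M"
  show "basis M B" unfolding basis_def
  proof (intro conjI allI impI)
    fix I assume I: "indep M I \<and> B \<subseteq> I"
    then have "card I \<le> card B"
      using B indep_card_le_rank[OF M, of I "ground M"] matroidD(2)[OF M]
      unfolding matroid_rank_def by force
    then show "I = B" using I card_seteq[OF matroidD(5)[OF M, of I], of B] by auto
  qed (use B in simp)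
qed


section \<open>Base polytopes by rank inequalities\<close>

definition rank_polytope :: "'a set \<Rightarrow> ('a set \<Rightarrow> nat) \<Rightarrow> ('a \<Rightarrow> real) set" where
  "rank_polytope E r = {x. (\<forall>e. e \<notin> E \<longrightarrow> x e = 0) \<and> (\<forall>e\<in>E. 0 \<le> x e) \<and>
     (\<forall>A\<subseteq>E. sum x A \<le> real (r A)) \<and> sum x E = real (r E)}"

lemma rank_polytopeD:
  assumes "x \<in> rank_polytope E r"
  shows "e \<notin> E \<Longrightarrow> x e = 0" "0 \<le> x e" "A \<subseteq> E \<Longrightarrow> sum x A \<le> real (r A)" "sum x E = real (r E)"
  using assms unfolding rank_polytope_def by (cases "e \<in> E"; auto)+

lemma rank_polytope_le_1:
  assumes "rank_function E r" "x \<in> rank_polytope E r"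
  shows "x e \<le> 1"
proof (cases "e \<in> E")
  case True
  then have "sum x {e} \<le> real (r {e})" "r {e} \<le> card {e}"
    using rank_polytopeD(3)[OF assms(2)] rank_functionD(2)[OF assms(1)] by blast+
  then show ?thesis by simp
qed (use rank_polytopeD(1)[OF assms(2)] in simp)

lemma convex_rank_polytope: "convex (rank_polytope E r)"
  unfolding convex_def
proof (intro ballI allI impI)
  fix x y :: "'a \<Rightarrow> real" and u v :: real
  assume xy: "x \<in> rank_polytope E r" "y \<in> rank_polytope E r" and uv: "0 \<le> u" "0 \<le> v" "u + v = 1"
  have s: "sum (u *\<^sub>R x + v *\<^sub>R y) A = u * sum x A + v * sum y A" for A
    by (simp add: scaleR_fun_def sum.distrib sum_distrib_left)
  have c: "u * a + v * b \<le> c" if "a \<le> c" "b \<le> c" for a b c :: real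
    using that uv convex_bound_le by blast
  show "u *\<^sub>R x + v *\<^sub>R y \<in> rank_polytope E r"
    unfolding rank_polytope_def mem_Collect_eq s
    using rank_polytopeD[OF xy(1)] rank_polytopeD[OF xy(2)] uv c
    by (auto simp: scaleR_fun_def simp flip: distrib_right)
qed

lemma sum_transfer:
  fixes x :: "'a \<Rightarrow> real"
  assumes "finite A" "a \<noteq> b"
  shows "sum (x(a := x a + t, b := x b - t)) A =
    sum x A + (if a \<in> A then t else 0) - (if b \<in> A then t else 0)"
proof -
  have "x(a := x a + t, b := x b - t) =
      (\<lambda>e. x e + (if e = a then t else 0) - (if e = b then t else 0))"
    using assms(2) by auto
  then show ?thesis using assms(1) by (simp add: sum.distrib sum_subtractf)
qed

text \<open>
  Tight sets uncross: the defects \<open>r A - x(A)\<close> are nonnegative and submodular.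
\<close>

lemma tight_Un_Int:
  assumes "rank_function E r" "x \<in> rank_polytope E r" "A \<subseteq> E" "B \<subseteq> E"
    and "sum x A = real (r A)" "sum x B = real (r B)"
  shows "sum x (A \<union> B) = real (r (A \<union> B))" "sum x (A \<inter> B) = real (r (A \<inter> B))"
proof -
  have fin: "finite A" "finite B"
    using assms rank_functionD(1)[OF assms(1)] finite_subset by blast+
  have "real (r (A \<union> B)) + real (r (A \<inter> B)) \<le> real (r A) + real (r B)"
    using rank_functionD(4)[OF assms(1,3,4)] by linarith
  also have "\<dots> = sum x (A \<union> B) + sum x (A \<inter> B)"
    using sum.union_inter[OF fin, of x] assms by simp
  finally have le: "real (r (A \<union> B)) + real (r (A \<inter> B)) \<le> sum x (A \<union> B) + sum x (A \<inter> B)" .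
  have "sum x (A \<union> B) \<le> real (r (A \<union> B))" "sum x (A \<inter> B) \<le> real (r (A \<inter> B))"
    by (rule rank_polytopeD(3)[OF assms(2)]; use assms in blast)+
  with le show "sum x (A \<union> B) = real (r (A \<union> B))" "sum x (A \<inter> B) = real (r (A \<inter> B))"
    by linarith+
qed

text \<open>
  The measure for the induction in Edmonds' theorem: the number of rank inequalities that are not
  tight plus the number of coordinates other than 0 and 1.
\<close>

definition slackness :: "'a set \<Rightarrow> ('a set \<Rightarrow> nat) \<Rightarrow> ('a \<Rightarrow> real) \<Rightarrow> nat" where
  "slackness E r x = card {A. A \<subseteq> E \<and> sum x A \<noteq> real (r A)} + card {e\<in>E. x e \<noteq> 0 \<and> x e \<noteq> 1}"

text \<open>
  If every tight set contains both of \<open>a\<close>, \<open>b\<close> or neither, mass can be moved from \<open>b\<close> to \<open>a\<close> until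
  a set separating them becomes tight or \<open>x b\<close> becomes zero; no tight set and no integral
  coordinate is lost on the way.
\<close>

lemma transfer_until_tight:
  fixes x :: "'a \<Rightarrow> real"
  assumes rf: "rank_function E r" and x: "x \<in> rank_polytope E r"
    and ab: "a \<in> E" "b \<in> E" "a \<noteq> b" "x a \<noteq> 0" "x a \<noteq> 1" "x b \<noteq> 0" "x b \<noteq> 1"
    and sep: "\<And>A. A \<subseteq> E \<Longrightarrow> sum x A = real (r A) \<Longrightarrow> a \<in> A \<longleftrightarrow> b \<in> A"
  shows "\<exists>t>0. x(a := x a + t, b := x b - t) \<in> rank_polytope E r \<and>
    slackness E r (x(a := x a + t, b := x b - t)) < slackness E r x"
proof -
  have finE: "finite E" using rank_functionD(1)[OF rf] .
  define S where "S = {A. A \<subseteq> E \<and> a \<in> A \<and> b \<notin> A}"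
  define t where "t = Min (insert (x b) ((\<lambda>A. real (r A) - sum x A) ` S))"
  have finS: "finite S" using finE unfolding S_def by simp
  have pos: "0 < real (r A) - sum x A" if "A \<in> S" for A
    using that sep[of A] rank_polytopeD(3)[OF x, of A] unfolding S_def by force
  have t0: "t > 0"
    unfolding t_def using finS pos ab rank_polytopeD(2)[OF x, of b] by auto
  have tle: "t \<le> real (r A) - sum x A" if "A \<in> S" for A
    unfolding t_def using finS that by auto
  have tb: "t \<le> x b" unfolding t_def using finS by auto
  have "t \<in> insert (x b) ((\<lambda>A. real (r A) - sum x A) ` S)"
    unfolding t_def using finS by (intro Min_in) auto
  then have hit: "t = x b \<or> (\<exists>A\<in>S. t = real (r A) - sum x A)" by auto
  define x' where "x' = x(a := x a + t, b := x b - t)"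
  have s: "sum x' A = sum x A + (if a \<in> A then t else 0) - (if b \<in> A then t else 0)"
    if "A \<subseteq> E" for A
    unfolding x'_def by (rule sum_transfer[OF finite_subset[OF that finE] ab(3)])
  have mem: "x' \<in> rank_polytope E r"
    unfolding rank_polytope_def mem_Collect_eq
  proof (intro conjI allI impI ballI)
    fix e assume "e \<notin> E" then show "x' e = 0"
      using rank_polytopeD(1)[OF x] ab unfolding x'_def by auto
  next
    fix e assume "e \<in> E" then show "0 \<le> x' e"
      using rank_polytopeD(2)[OF x] ab tb t0 unfolding x'_def by (auto intro: add_nonneg_nonneg)
  next
    fix A assume A: "A \<subseteq> E"
    show "sum x' A \<le> real (r A)"
      using rank_polytopeD(3)[OF x A] tle[of A] A t0 unfolding s[OF A] S_def by auto
  next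
    show "sum x' E = real (r E)"
      using rank_polytopeD(4)[OF x] ab unfolding s[OF order_refl] by simp
  qed
  have sub1: "{A. A \<subseteq> E \<and> sum x' A \<noteq> real (r A)} \<subseteq> {A. A \<subseteq> E \<and> sum x A \<noteq> real (r A)}"
    using s sep by auto
  have sub2: "{e\<in>E. x' e \<noteq> 0 \<and> x' e \<noteq> 1} \<subseteq> {e\<in>E. x e \<noteq> 0 \<and> x e \<noteq> 1}"
    using ab unfolding x'_def by auto
  have f1: "finite {A. A \<subseteq> E \<and> sum x A \<noteq> real (r A)}" and f2: "finite {e\<in>E. x e \<noteq> 0 \<and> x e \<noteq> 1}"
    using finE by auto
  have strict: "{A. A \<subseteq> E \<and> sum x' A \<noteq> real (r A)} \<subset> {A. A \<subseteq> E \<and> sum x A \<noteq> real (r A)} \<or>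
      {e\<in>E. x' e \<noteq> 0 \<and> x' e \<noteq> 1} \<subset> {e\<in>E. x e \<noteq> 0 \<and> x e \<noteq> 1}"
    using hit
  proof
    assume "t = x b"
    then have "x' b = 0" unfolding x'_def by simp
    then show ?thesis using sub2 ab by blast
  next
    assume "\<exists>A\<in>S. t = real (r A) - sum x A"
    then obtain A where A: "A \<in> S" "t = real (r A) - sum x A" by blast
    then have "sum x' A = real (r A)" "sum x A \<noteq> real (r A)" "A \<subseteq> E"
      using s[of A] t0 unfolding S_def by auto
    then show ?thesis using sub1 by blast
  qed
  have "slackness E r x' < slackness E r x"
    unfolding slackness_def
    using strict psubset_card_mono[OF f1] psubset_card_mono[OF f2] card_mono[OF f1 sub1] card_mono[OF f2 sub2]
    by (meson add_le_less_mono add_less_le_mono)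
  then show ?thesis using t0 mem unfolding x'_def by blast
qed

text \<open>
  Edmonds' description of the base polytope. A point with a fractional coordinate has two of them in
  a minimal tight set that meets the fractional coordinates, because \<open>x(T) = r T\<close> is an integer; by
  uncrossing no tight set separates these two, so the point lies on a segment between two points
  that are less slack.
\<close>

theorem base_polytope_eq_rank_polytope:
  assumes M: "matroid M"
  shows "base_polytope M = rank_polytope (ground M) (rank_in M)"
proof
  let ?E = "ground M" and ?r = "rank_in M"
  have rf: "rank_function ?E ?r" using rank_function_rank_in[OF M] .
  have finE: "finite ?E" using matroidD(1)[OF M] .
  have "{indicat_real B | B. basis M B} \<subseteq> rank_polytope ?E ?r"
  proof clarify
    fix B assume "basis M B"
    then have B: "indep M B" "card B = rank_in M ?E"
      using basis_iff[OF M] unfolding matroid_rank_def by blast+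
    have BE: "B \<subseteq> ?E" using matroidD(2)[OF M B(1)] .
    have s: "sum (indicat_real B) A = card (A \<inter> B)" if "A \<subseteq> ?E" for A
      using finite_subset[OF that finE] by (simp add: indicator_def sum.If_cases)
    have "card (A \<inter> B) \<le> rank_in M A" for A
      by (rule indep_card_le_rank[OF M matroidD(4)[OF M B(1)]]) auto
    then show "indicat_real B \<in> rank_polytope ?E ?r"
      unfolding rank_polytope_def using s B BE by (auto simp: indicator_def Int_absorb1)
  qed
  then show "base_polytope M \<subseteq> rank_polytope ?E ?r"
    unfolding base_polytope_def by (intro hull_minimal convex_rank_polytope)
  show "rank_polytope ?E ?r \<subseteq> base_polytope M"
  proof
    fix x assume "x \<in> rank_polytope ?E ?r"
    then show "x \<in> base_polytope M"
    proof (induction "slackness ?E ?r x" arbitrary: x rule: less_induct)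
      case less
      note x = less.prems
      show ?case
      proof (cases "\<exists>e\<in>?E. x e \<noteq> 0 \<and> x e \<noteq> 1")
        case False
        define B where "B = {e\<in>?E. x e = 1}"
        have xB: "x = indicat_real B"
          using False rank_polytopeD(1)[OF x] unfolding B_def by (auto simp: fun_eq_iff indicator_def)
        have BE: "B \<subseteq> ?E" unfolding B_def by blast
        then have finB: "finite B" using finE finite_subset by blast
        have "real (card B) \<le> rank_in M B"
          using rank_polytopeD(3)[OF x BE] finB unfolding xB by (simp add: indicator_def)
        then have "indep M B"
          using indep_iff_rank[OF M, of B] BE rank_functionD(2)[OF rf BE] by simp
        moreover have "card B = matroid_rank M"
          using rank_polytopeD(4)[OF x] finE BE unfolding xB matroid_rank_def
          by (simp add: indicator_def sum.If_cases Int_absorb1)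
        ultimately show ?thesis
          unfolding base_polytope_def xB using basis_iff[OF M] by (intro hull_inc) blast
      next
        case True
        define fr where "fr e \<longleftrightarrow> x e \<noteq> 0 \<and> x e \<noteq> 1" for e
        define Q where "Q T \<longleftrightarrow> T \<subseteq> ?E \<and> sum x T = real (?r T) \<and> (\<exists>e\<in>T. fr e)" for T
        have "Q ?E" unfolding Q_def using rank_polytopeD(4)[OF x] True fr_def by auto
        then obtain T where T: "Q T" and Tmin: "\<And>T'. Q T' \<Longrightarrow> card T \<le> card T'"
          using ex_has_least_nat[of Q _ card] by blast
        have TE: "T \<subseteq> ?E" and finT: "finite T"
          using T finE finite_subset unfolding Q_def by blast+
        obtain a where a: "a \<in> T" "fr a" using T unfolding Q_def by blast
        have "\<exists>b\<in>T - {a}. fr b"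
        proof (rule ccontr)
          assume "\<not> ?thesis"
          then have "\<forall>e\<in>T - {a}. x e \<in> \<int>" unfolding fr_def by force
          then have "sum x (T - {a}) \<in> \<int>" by (intro Ints_sum) auto
          moreover have "sum x T = x a + sum x (T - {a})" using finT a by (simp add: sum.remove)
          moreover have "sum x T \<in> \<int>" using T unfolding Q_def by simp
          ultimately have "x a \<in> \<int>" by (metis Ints_diff add_diff_cancel_right')
          moreover have "0 \<le> x a" "x a \<le> 1"
            using rank_polytopeD(2)[OF x] rank_polytope_le_1[OF rf x] by blast+
          ultimately show False using a(2) unfolding fr_def by (auto elim!: Ints_cases)
        qed
        then obtain b where b: "b \<in> T" "fr b" "a \<noteq> b" by blast
        have sub: "T \<subseteq> A" if A: "A \<subseteq> ?E" "sum x A = real (?r A)" "e \<in> A" "e \<in> T" "fr e" for A e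
        proof -
          have "sum x (A \<inter> T) = real (?r (A \<inter> T))"
            using tight_Un_Int(2)[OF rf x A(1) TE A(2)] T unfolding Q_def by blast
          then have "Q (A \<inter> T)" unfolding Q_def using A by auto
          from Tmin[OF this] have "A \<inter> T = T"
            using card_seteq[OF finT, of "A \<inter> T"] by auto
          then show ?thesis by blast
        qed
        have sep: "a \<in> A \<longleftrightarrow> b \<in> A" if "A \<subseteq> ?E" "sum x A = real (?r A)" for A
          using sub[OF that] a b by blast
        have fr: "a \<in> ?E" "b \<in> ?E" "x a \<noteq> 0" "x a \<noteq> 1" "x b \<noteq> 0" "x b \<noteq> 1"
          using a b TE unfolding fr_def by auto
        obtain t where t: "t > 0" "x(a := x a + t, b := x b - t) \<in> rank_polytope ?E ?r"
            "slackness ?E ?r (x(a := x a + t, b := x b - t)) < slackness ?E ?r x"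
          using transfer_until_tight[OF rf x fr(1,2) b(3) fr(3-6) sep] by blast
        obtain s where s: "s > 0" "x(b := x b + s, a := x a - s) \<in> rank_polytope ?E ?r"
            "slackness ?E ?r (x(b := x b + s, a := x a - s)) < slackness ?E ?r x"
          using transfer_until_tight[OF rf x fr(2,1) b(3)[symmetric] fr(5,6,3,4)] sep by blast
        let ?y = "x(a := x a + t, b := x b - t)" and ?z = "x(b := x b + s, a := x a - s)"
        have "?y \<in> base_polytope M" "?z \<in> base_polytope M"
          using less.hyps t s by blast+
        moreover have "convex (base_polytope M)" unfolding base_polytope_def by simp
        moreover define u v where "u = s / (s + t)" and "v = t / (s + t)"
        ultimately have "u *\<^sub>R ?y + v *\<^sub>R ?z \<in> base_polytope M"
          using s(1) t(1) by (intro convexD) (auto simp: add_divide_distrib[symmetric])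
        moreover have "u *\<^sub>R ?y + v *\<^sub>R ?z = x"
        proof
          fix e
          have uv: "u + v = 1" "u * t = v * s"
            using s(1) t(1) unfolding u_def v_def by (auto simp: add_divide_distrib[symmetric])
          have "u * x e + v * x e = x e" using uv(1) by (metis distrib_right mult_1)
          then show "(u *\<^sub>R ?y + v *\<^sub>R ?z) e = x e"
            using b(3) uv(2) by (auto simp: scaleR_fun_def right_diff_distrib distrib_left)
        qed
        ultimately show ?thesis by simp
      qed
    qed
  qed
qed

section \<open>Matroids defined by a chain of rank conditions\<close>

definition chain_matroid :: "'a set \<Rightarrow> 'a set set \<Rightarrow> ('a set \<Rightarrow> nat) \<Rightarrow> 'a matroid" where
  "chain_matroid E C \<rho> = \<lparr>ground = E, indep = (\<lambda>I. I \<subseteq> E \<and> (\<forall>X\<in>C. card (I \<inter> X) \<le> \<rho> X))\<rparr>"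

lemma ground_chain_matroid [simp]: "ground (chain_matroid E C \<rho>) = E"
  by (simp add: chain_matroid_def)

lemma indep_chain_matroid:
  "indep (chain_matroid E C \<rho>) I \<longleftrightarrow> I \<subseteq> E \<and> (\<forall>X\<in>C. card (I \<inter> X) \<le> \<rho> X)"
  by (simp add: chain_matroid_def)

definition rank_chain :: "'a set \<Rightarrow> 'a set set \<Rightarrow> ('a set \<Rightarrow> nat) \<Rightarrow> bool" where
  "rank_chain E C \<rho> \<longleftrightarrow> finite E \<and> C \<subseteq> Pow E \<and> chain\<^sub>\<subseteq> C \<and> {} \<in> C \<and> \<rho> {} = 0"

text \<open>
  An independent set \<open>I\<close> can be augmented by exactly those elements that lie outside the last member
  of the chain in which \<open>I\<close> uses up the whole bound.
\<close>

lemma last_tight_member: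
  assumes C: "rank_chain E C \<rho>" and I: "indep (chain_matroid E C \<rho>) I"
  obtains X where "X \<in> C" "card (I \<inter> X) = \<rho> X"
    "\<And>x. x \<in> E - X \<Longrightarrow> indep (chain_matroid E C \<rho>) (insert x I)"
proof -
  let ?T = "{X\<in>C. card (I \<inter> X) = \<rho> X}"
  have "finite ?T" using C unfolding rank_chain_def by (auto intro: finite_subset)
  moreover have "{} \<in> ?T" using C unfolding rank_chain_def by simp
  ultimately obtain X where X: "X \<in> ?T" "\<And>Y. Y \<in> ?T \<Longrightarrow> X \<subseteq> Y \<Longrightarrow> X = Y"
    using finite_has_maximal[of ?T] by blast
  have "indep (chain_matroid E C \<rho>) (insert x I)" if x: "x \<in> E - X" for x
    unfolding indep_chain_matroid
  proof (intro conjI ballI)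
    show "insert x I \<subseteq> E" using x I unfolding indep_chain_matroid by blast
    fix Y assume Y: "Y \<in> C"
    have le: "card (I \<inter> Y) \<le> \<rho> Y" using I Y unfolding indep_chain_matroid by blast
    show "card (insert x I \<inter> Y) \<le> \<rho> Y"
    proof (cases "x \<in> Y")
      case True
      have "X \<subseteq> Y \<or> Y \<subseteq> X" using C X(1) Y unfolding rank_chain_def chain_subset_def by blast
      then have "Y \<notin> ?T" using X(2)[of Y] True x by blast
      then have "card (I \<inter> Y) < \<rho> Y" using le Y by auto
      moreover have "card (insert x I \<inter> Y) \<le> Suc (card (I \<inter> Y))"
        using True by (cases "finite (I \<inter> Y)") (auto simp: card_insert_if Int_insert_left)
      ultimately show ?thesis by linarith
    next
      case False
      then have "insert x I \<inter> Y = I \<inter> Y" by blast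
      then show ?thesis using le by simp
    qed
  qed
  then show thesis using X that by blast
qed

lemma matroid_chain_matroid:
  assumes C: "rank_chain E C \<rho>"
  shows "matroid (chain_matroid E C \<rho>)"
  unfolding matroid_def
proof (intro conjI allI impI)
  show "finite (ground (chain_matroid E C \<rho>))" using C unfolding rank_chain_def by simp
  show "indep (chain_matroid E C \<rho>) {}" unfolding indep_chain_matroid by simp
  show "indep (chain_matroid E C \<rho>) I \<Longrightarrow> I \<subseteq> ground (chain_matroid E C \<rho>)" for I
    unfolding indep_chain_matroid by simp
next
  fix I J assume J: "indep (chain_matroid E C \<rho>) J \<and> I \<subseteq> J"
  have "finite J" using C J unfolding rank_chain_def indep_chain_matroid
    by (meson finite_subset)
  then have "card (I \<inter> X) \<le> card (J \<inter> X)" for X using J by (intro card_mono) auto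
  then show "indep (chain_matroid E C \<rho>) I"
    using J unfolding indep_chain_matroid by (meson order_trans)
next
  fix I J
  assume IJ: "indep (chain_matroid E C \<rho>) I \<and> indep (chain_matroid E C \<rho>) J \<and> card I < card J"
  then obtain X where X: "X \<in> C" "card (I \<inter> X) = \<rho> X"
    "\<And>x. x \<in> E - X \<Longrightarrow> indep (chain_matroid E C \<rho>) (insert x I)"
    using last_tight_member[OF C] by blast
  have fin: "finite I" "finite J" using C IJ unfolding rank_chain_def indep_chain_matroid
    by (meson finite_subset)+
  have "card (J \<inter> X) \<le> card (I \<inter> X)" using IJ X unfolding indep_chain_matroid by auto
  moreover have "card I = card (I \<inter> X) + card (I - X)" "card J = card (J \<inter> X) + card (J - X)"
    using fin by (metis card_Int_Diff)+
  ultimately have "\<not> J - X \<subseteq> I - X"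
    using IJ fin card_mono[of "I - X" "J - X"] by auto
  then obtain x where "x \<in> J - X" "x \<notin> I" by blast
  then show "\<exists>x\<in>J - I. indep (chain_matroid E C \<rho>) (insert x I)"
    using X(3)[of x] IJ unfolding indep_chain_matroid by blast
qed

lemma rank_chain_matroid_le:
  assumes C: "rank_chain E C \<rho>" and A: "A \<subseteq> E" and X: "X \<in> C"
  shows "rank_in (chain_matroid E C \<rho>) A \<le> \<rho> X + card (A - X)"
proof (rule rank_leI[OF matroid_chain_matroid[OF C]])
  fix I assume I: "I \<subseteq> A" "indep (chain_matroid E C \<rho>) I"
  have finA: "finite A" using C A unfolding rank_chain_def by (meson finite_subset)
  have "card I = card (I \<inter> X) + card (I - X)" using I finA by (metis card_Int_Diff finite_subset)
  moreover have "card (I \<inter> X) \<le> \<rho> X" using I X unfolding indep_chain_matroid by blast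
  moreover have "card (I - X) \<le> card (A - X)" using I finA by (intro card_mono) auto
  ultimately show "card I \<le> \<rho> X + card (A - X)" by linarith
qed

lemma rank_chain_matroid_attained:
  assumes C: "rank_chain E C \<rho>" and A: "A \<subseteq> E"
  shows "\<exists>X\<in>C. rank_in (chain_matroid E C \<rho>) A = \<rho> X + card (A - X)"
proof -
  let ?M = "chain_matroid E C \<rho>"
  have M: "matroid ?M" using matroid_chain_matroid[OF C] .
  obtain I where I: "I \<subseteq> A" "indep ?M I" "card I = rank_in ?M A"
    using rank_attained[OF M] by metis
  obtain X where X: "X \<in> C" "card (I \<inter> X) = \<rho> X" "\<And>x. x \<in> E - X \<Longrightarrow> indep ?M (insert x I)"
    using last_tight_member[OF C I(2)] by blast
  have finI: "finite I" using matroidD(5)[OF M I(2)] .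
  have "x \<in> I" if x: "x \<in> A - X" for x
  proof (rule ccontr)
    assume "x \<notin> I"
    then have "card (insert x I) = Suc (rank_in ?M A)" using finI I(3) by simp
    moreover have "card (insert x I) \<le> rank_in ?M A"
      using x I A X(3) by (intro indep_card_le_rank[OF M]) auto
    ultimately show False by simp
  qed
  then have "I - X = A - X" using I(1) by blast
  then have "card I = \<rho> X + card (A - X)" using X(2) finI by (metis card_Int_Diff)
  then show ?thesis using X(1) I(3) by auto
qed

text \<open>
  The rank of \<open>A\<close> is \<open>\<rho> X + card (A - X)\<close> for some \<open>X\<close> in the chain. So the condition for \<open>A\<close> follows
  from the one for \<open>X\<close> together with \<open>x \<le> 1\<close> on \<open>A - X\<close>.
\<close>

lemma rank_polytope_chain_matroid:
  assumes C: "rank_chain E C \<rho>"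
  shows "rank_polytope E (rank_in (chain_matroid E C \<rho>)) =
    {x. (\<forall>e. e \<notin> E \<longrightarrow> x e = 0) \<and> (\<forall>e\<in>E. 0 \<le> x e \<and> x e \<le> 1) \<and>
        (\<forall>X\<in>C. sum x X \<le> real (\<rho> X)) \<and> sum x E = real (rank_in (chain_matroid E C \<rho>) E)}"
    (is "?P = ?Q")
proof
  let ?r = "rank_in (chain_matroid E C \<rho>)"
  have rf: "rank_function E ?r"
    using rank_function_rank_in[OF matroid_chain_matroid[OF C]] by simp
  have CE: "X \<in> C \<Longrightarrow> X \<subseteq> E" for X using C unfolding rank_chain_def by blast
  show "?P \<subseteq> ?Q"
  proof
    fix x assume x: "x \<in> ?P"
    have "sum x X \<le> real (\<rho> X)" if X: "X \<in> C" for X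
      using rank_polytopeD(3)[OF x CE[OF X]] rank_chain_matroid_le[OF C CE[OF X] X] by simp
    then show "x \<in> ?Q"
      using rank_polytopeD[OF x] rank_polytope_le_1[OF rf x] by simp
  qed
  show "?Q \<subseteq> ?P"
  proof
    fix x assume x: "x \<in> ?Q"
    have "sum x A \<le> real (?r A)" if A: "A \<subseteq> E" for A
    proof -
      obtain X where X: "X \<in> C" "?r A = \<rho> X + card (A - X)"
        using rank_chain_matroid_attained[OF C A] by blast
      have fin: "finite A" "finite X"
        using A CE[OF X(1)] rank_functionD(1)[OF rf] by (auto intro: finite_subset)
      have "sum x A = sum x (A \<inter> X) + sum x (A - X)"
        using fin by (metis sum.Int_Diff)
      also have "sum x (A \<inter> X) \<le> sum x X"
        using x CE[OF X(1)] fin by (intro sum_mono2) auto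
      also have "sum x (A - X) \<le> (\<Sum>e\<in>A - X. 1)"
        using x A by (intro sum_mono) auto
      finally show ?thesis using x X by auto
    qed
    then show "x \<in> ?P" using x unfolding rank_polytope_def by auto
  qed
qed

text \<open>
  A circuit violates one of the bounds, so it lies in some member \<open>X\<close> of the chain and spans it.
  Hence every cyclic flat is a union of members of the chain.
\<close>

lemma nested_chain_matroid:
  assumes C: "rank_chain E C \<rho>"
  shows "nested (chain_matroid E C \<rho>)"
proof -
  let ?M = "chain_matroid E C \<rho>"
  have M: "matroid ?M" using matroid_chain_matroid[OF C] .
  have rf: "rank_function E (rank_in ?M)" using rank_function_rank_in[OF M] by simp
  have CE: "X \<in> C \<Longrightarrow> X \<subseteq> E" for X using C unfolding rank_chain_def by blast
  have key: "\<exists>X\<in>C. x \<in> X \<and> X \<subseteq> F" if F: "cyclic_flat ?M F" and "x \<in> F" for F x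
  proof -
    obtain D where D: "circuit ?M D" "x \<in> D" "D \<subseteq> F"
      using F \<open>x \<in> F\<close> unfolding cyclic_flat_def by blast
    have DE: "D \<subseteq> E" and ndep: "\<not> indep ?M D" and min: "\<And>D'. D' \<subset> D \<Longrightarrow> indep ?M D'"
      using D(1) unfolding circuit_def by auto
    obtain X where X: "X \<in> C" "card (D \<inter> X) > \<rho> X"
      using ndep DE unfolding indep_chain_matroid by force
    have "\<not> indep ?M (D \<inter> X)" using X unfolding indep_chain_matroid by (metis Int_assoc Int_absorb leD)
    then have DX: "D \<subseteq> X" using min[of "D \<inter> X"] by blast
    have finD: "finite D" using DE rank_functionD(1)[OF rf] finite_subset by blast
    have "card (D - {x}) \<le> rank_in ?M D"
      using min[of "D - {x}"] D(2) by (intro indep_card_le_rank[OF M]) auto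
    then have "\<rho> X \<le> rank_in ?M D" using X(2) DX D(2) finD by (simp add: Int_absorb2)
    moreover have FE: "F \<subseteq> E" using F unfolding cyclic_flat_def flat_def by simp
    ultimately have "\<rho> X \<le> rank_in ?M (F \<inter> X)"
      using rank_functionD(3)[OF rf, of D "F \<inter> X"] D(3) DX by force
    moreover have "rank_in ?M X \<le> \<rho> X"
      using rank_chain_matroid_le[OF C CE[OF X(1)] X(1)] by simp
    ultimately have FX: "rank_in ?M (F \<union> X) \<le> rank_in ?M F"
      using rank_functionD(4)[OF rf FE CE[OF X(1)]] by linarith
    have "X \<subseteq> F"
    proof
      fix y assume y: "y \<in> X"
      show "y \<in> F"
      proof (rule ccontr)
        assume "y \<notin> F"
        then have "rank_in ?M F < rank_in ?M (insert y F)"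
          using F y CE[OF X(1)] unfolding cyclic_flat_def flat_def by auto
        also have "\<dots> \<le> rank_in ?M (F \<union> X)"
          using y FE CE[OF X(1)] by (intro rank_functionD(3)[OF rf]) auto
        finally show False using FX by simp
      qed
    qed
    then show ?thesis using X(1) DX D(2) by blast
  qed
  show ?thesis
    unfolding nested_def chain_subset_def
  proof (intro ballI)
    fix F F' assume "F \<in> {F. cyclic_flat ?M F}" "F' \<in> {F. cyclic_flat ?M F}"
    then have F: "cyclic_flat ?M F" "cyclic_flat ?M F'" by simp_all
    show "F \<subseteq> F' \<or> F' \<subseteq> F"
    proof (rule disjCI)
      assume "\<not> F' \<subseteq> F"
      then obtain y where "y \<in> F'" "y \<notin> F" by blast
      then obtain Y where Y: "Y \<in> C" "y \<in> Y" "Y \<subseteq> F'" using key[OF F(2)] by blast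
      show "F \<subseteq> F'"
      proof
        fix x assume "x \<in> F"
        then obtain X where X: "X \<in> C" "x \<in> X" "X \<subseteq> F" using key[OF F(1)] by blast
        have "X \<subseteq> Y \<or> Y \<subseteq> X" using C X Y unfolding rank_chain_def chain_subset_def by blast
        then show "x \<in> F'" using X Y \<open>y \<notin> F\<close> by blast
      qed
    qed
  qed
qed


section \<open>Isomorphic copies\<close>

lemma isomorphic_sym:
  assumes "isomorphic M N"
  shows "isomorphic N M"
proof -
  obtain f where f: "bij_betw f (ground M) (ground N)"
    "\<And>I. I \<subseteq> ground M \<Longrightarrow> indep M I \<longleftrightarrow> indep N (f ` I)"
    using assms unfolding isomorphic_def by blast
  let ?g = "inv_into (ground M) f"
  have g: "bij_betw ?g (ground N) (ground M)" using bij_betw_inv_into[OF f(1)] .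
  have "indep N J \<longleftrightarrow> indep M (?g ` J)" if J: "J \<subseteq> ground N" for J
  proof -
    have "f ` ?g ` J = J" using J f(1) by (simp add: bij_betw_def image_inv_into_cancel)
    moreover have "?g ` J \<subseteq> ground M" using image_mono[OF J, of ?g] bij_betw_imp_surj_on[OF g] by simp
    ultimately show ?thesis using f(2)[of "?g ` J"] by simp
  qed
  then show ?thesis using g unfolding isomorphic_def by blast
qed

lemma isomorphic_trans:
  assumes "isomorphic M N" "isomorphic N K"
  shows "isomorphic M K"
proof -
  obtain f where f: "bij_betw f (ground M) (ground N)"
    "\<And>I. I \<subseteq> ground M \<Longrightarrow> indep M I \<longleftrightarrow> indep N (f ` I)"
    using assms(1) unfolding isomorphic_def by blast
  obtain g where g: "bij_betw g (ground N) (ground K)"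
    "\<And>I. I \<subseteq> ground N \<Longrightarrow> indep N I \<longleftrightarrow> indep K (g ` I)"
    using assms(2) unfolding isomorphic_def by blast
  have "indep M I \<longleftrightarrow> indep K ((g \<circ> f) ` I)" if "I \<subseteq> ground M" for I
    using f(2)[OF that] g(2)[of "f ` I"] that bij_betw_imp_surj_on[OF f(1)]
    by (metis image_comp image_mono)
  then show ?thesis using bij_betw_trans[OF f(1) g(1)] unfolding isomorphic_def by blast
qed

lemma rank_image_isomorphism:
  assumes f: "bij_betw f (ground M) (ground N)"
    and iso: "\<And>I. I \<subseteq> ground M \<Longrightarrow> indep M I \<longleftrightarrow> indep N (f ` I)" and A: "A \<subseteq> ground M"
  shows "rank_in N (f ` A) = rank_in M A"
proof -
  have inj: "inj_on f A" using f A by (meson bij_betw_def inj_on_subset)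
  have "{card J | J. J \<subseteq> f ` A \<and> indep N J} = {card I | I. I \<subseteq> A \<and> indep M I}" (is "?L = ?R")
  proof
    show "?R \<subseteq> ?L"
    proof clarify
      fix I assume I: "I \<subseteq> A" "indep M I"
      then have "card (f ` I) = card I" using inj by (meson card_image inj_on_subset)
      moreover have "f ` I \<subseteq> f ` A" "indep N (f ` I)" using I iso[of I] A by blast+
      ultimately show "\<exists>J. card I = card J \<and> J \<subseteq> f ` A \<and> indep N J" by metis
    qed
    show "?L \<subseteq> ?R"
    proof clarify
      fix J assume J: "J \<subseteq> f ` A" "indep N J"
      then obtain I where I: "I \<subseteq> A" "J = f ` I" by (meson subset_imageE)
      then have "card J = card I" using inj by (meson card_image inj_on_subset)
      moreover have "indep M I" using I J iso[of I] A by blast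
      ultimately show "\<exists>I. card J = card I \<and> I \<subseteq> A \<and> indep M I" using I by metis
    qed
  qed
  then show ?thesis unfolding rank_in_def by simp
qed

lemma isomorphic_card_rank:
  assumes "isomorphic M N"
  shows "card (ground M) = card (ground N)" "matroid_rank M = matroid_rank N"
proof -
  obtain f where f: "bij_betw f (ground M) (ground N)"
    "\<And>I. I \<subseteq> ground M \<Longrightarrow> indep M I \<longleftrightarrow> indep N (f ` I)"
    using assms unfolding isomorphic_def by blast
  show "card (ground M) = card (ground N)" using bij_betw_same_card[OF f(1)] .
  show "matroid_rank M = matroid_rank N"
    using rank_image_isomorphism[OF f order_refl] bij_betw_imp_surj_on[OF f(1)]
    unfolding matroid_rank_def by simp
qed

lemma standard_copy_exists:
  assumes M: "matroid M"
  shows "\<exists>N::nat matroid. matroid N \<and> ground N = {1..card (ground M)} \<and> isomorphic M N"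
proof -
  obtain h where h: "bij_betw h {1..card (ground M)} (ground M)"
    using ex_bij_betw_nat_finite_1[OF matroidD(1)[OF M]] by blast
  let ?E = "{1..card (ground M)}"
  define N where "N = \<lparr>ground = ?E, indep = (\<lambda>J. J \<subseteq> ?E \<and> indep M (h ` J))\<rparr>"
  have ind: "indep N J \<longleftrightarrow> J \<subseteq> ?E \<and> indep M (h ` J)" for J unfolding N_def by simp
  have gr: "ground N = ?E" unfolding N_def by simp
  have inj: "inj_on h ?E" using h bij_betw_def by blast
  have cd: "card (h ` J) = card J" if "J \<subseteq> ?E" for J
    using inj that by (meson card_image inj_on_subset)
  have "matroid N"
    unfolding matroid_def gr
  proof (intro conjI allI impI)
    show "indep N {}" using matroidD(3)[OF M] ind by simp
    show "indep N I \<Longrightarrow> I \<subseteq> ?E" for I using ind by simp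
    show "indep N I" if "indep N J \<and> I \<subseteq> J" for I J
      using that matroidD(4)[OF M, of "h ` J" "h ` I"] ind by blast
  next
    fix I J assume IJ: "indep N I \<and> indep N J \<and> card I < card J"
    then have "card (h ` I) < card (h ` J)" using cd ind by simp
    then obtain y where y: "y \<in> h ` J - h ` I" "indep M (insert y (h ` I))"
      using matroidD(6)[OF M, of "h ` I" "h ` J"] IJ ind by blast
    then obtain x where x: "x \<in> J" "y = h x" by blast
    then show "\<exists>x\<in>J - I. indep N (insert x I)"
      using y IJ ind by (intro bexI[of _ x]) auto
  qed simp
  moreover have "isomorphic N M"
    unfolding isomorphic_def gr using h ind by blast
  ultimately show ?thesis using isomorphic_sym gr by blast
qed

text \<open>
  The symmetrized indicator function without its factor \<open>1 / n!\<close>, as a function of the rank function: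
  counts are integers, and rank functions can be relabelled by composition with a permutation.
\<close>

definition sym_count :: "nat \<Rightarrow> (nat set \<Rightarrow> nat) \<Rightarrow> (nat \<Rightarrow> real) \<Rightarrow> nat" where
  "sym_count n r x = card {\<sigma>. \<sigma> permutes {1..n} \<and> x \<circ> \<sigma> \<in> rank_polytope {1..n} r}"

lemma sym_count_eq_sum:
  "real (sym_count n r x) =
    (\<Sum>\<sigma> | \<sigma> permutes {1..n}. of_bool (x \<circ> \<sigma> \<in> rank_polytope {1..n} r))"
proof -
  have "finite {\<sigma>. \<sigma> permutes {1..n}}" by (simp add: finite_permutations)
  then show ?thesis
    unfolding sym_count_def of_bool_def
    by (simp add: sum.If_cases Int_def)
qed

lemma sym_indicator_base_polytope:
  assumes "matroid K" "ground K = {1..n}"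
  shows "sym_indicator n (base_polytope K) x = real (sym_count n (rank_in K) x) / fact n"
  unfolding sym_indicator_def sym_count_eq_sum base_polytope_eq_rank_polytope[OF assms(1)] assms(2)
  by (simp add: indicator_def of_bool_def sum_divide_distrib cong: if_cong)

lemma rank_polytope_cong:
  "(\<And>A. A \<subseteq> E \<Longrightarrow> r A = r' A) \<Longrightarrow> rank_polytope E r = rank_polytope E r'"
  unfolding rank_polytope_def by auto

lemma rank_polytope_permute:
  assumes p: "\<pi> permutes E"
  shows "x \<circ> \<pi> \<in> rank_polytope E r \<longleftrightarrow> x \<in> rank_polytope E (\<lambda>A. r (inv \<pi> ` A))"
proof -
  have s: "sum (x \<circ> \<pi>) A = sum x (\<pi> ` A)" for A
    using permutes_inj_on[OF p] by (simp add: sum.reindex)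
  have E: "\<pi> ` E = E" "inv \<pi> ` E = E" using permutes_image p permutes_inv by blast+
  have i: "inv \<pi> ` \<pi> ` A = A" "\<pi> ` inv \<pi> ` A = A" for A
    using permutes_inverses[OF p] by (auto simp: image_image)
  have sub: "\<pi> ` A \<subseteq> E \<longleftrightarrow> A \<subseteq> E" for A using E(1) permutes_in_image[OF p] by (auto simp: subset_iff)
  have all: "(\<forall>A\<subseteq>E. sum x (\<pi> ` A) \<le> real (r A)) \<longleftrightarrow> (\<forall>A\<subseteq>E. sum x A \<le> real (r (inv \<pi> ` A)))"
    using i sub by metis
  have "(\<forall>e. e \<notin> E \<longrightarrow> (x \<circ> \<pi>) e = 0) \<longleftrightarrow> (\<forall>e. e \<notin> E \<longrightarrow> x e = 0)"
    using permutes_not_in[OF p] by simp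
  moreover have "(\<forall>e\<in>E. 0 \<le> (x \<circ> \<pi>) e) \<longleftrightarrow> (\<forall>e\<in>E. 0 \<le> x e)"
    using E(1) by (metis (no_types, lifting) comp_apply imageE image_eqI)
  ultimately show ?thesis
    unfolding rank_polytope_def mem_Collect_eq s all E by simp
qed

lemma sym_count_permute:
  assumes p: "\<pi> permutes {1..n}"
  shows "sym_count n (\<lambda>A. r (\<pi> ` A)) x = sym_count n r x"
proof -
  have inv: "inv \<pi> permutes {1..n}" "inv (inv \<pi>) = \<pi>"
    using permutes_inv[OF p] permutes_inv_inv[OF p] by auto
  have "x \<circ> \<sigma> \<in> rank_polytope {1..n} (\<lambda>A. r (\<pi> ` A)) \<longleftrightarrow> x \<circ> (\<sigma> \<circ> inv \<pi>) \<in> rank_polytope {1..n} r" for \<sigma>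
    using rank_polytope_permute[OF inv(1), of "x \<circ> \<sigma>" r] unfolding inv(2) by (simp add: comp_assoc)
  then have "bij_betw (\<lambda>\<sigma>. \<sigma> \<circ> inv \<pi>)
      {\<sigma>. \<sigma> permutes {1..n} \<and> x \<circ> \<sigma> \<in> rank_polytope {1..n} (\<lambda>A. r (\<pi> ` A))}
      {\<sigma>. \<sigma> permutes {1..n} \<and> x \<circ> \<sigma> \<in> rank_polytope {1..n} r}"
    using permutes_compose[OF p] permutes_compose[OF inv(1)] permutes_inv_o[OF p]
    by (intro bij_betwI[where g = "\<lambda>\<sigma>. \<sigma> \<circ> \<pi>"]) (auto simp: comp_assoc)
  then show ?thesis unfolding sym_count_def by (rule bij_betw_same_card)
qed

lemma sym_count_cong:
  "(\<And>A. A \<subseteq> {1..n} \<Longrightarrow> r A = r' A) \<Longrightarrow> sym_count n r x = sym_count n r' x"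
  using rank_polytope_cong[of "{1..n}" r r'] unfolding sym_count_def by simp

lemma sym_count_isomorphic:
  assumes K: "ground K = {1..n}" "ground K' = {1..n}" and iso: "isomorphic K K'"
  shows "sym_count n (rank_in K) x = sym_count n (rank_in K') x"
proof -
  obtain f where f: "bij_betw f (ground K) (ground K')"
    "\<And>I. I \<subseteq> ground K \<Longrightarrow> indep K I \<longleftrightarrow> indep K' (f ` I)"
    using iso unfolding isomorphic_def by blast
  define \<pi> where "\<pi> e = (if e \<in> {1..n} then f e else e)" for e
  have "bij_betw \<pi> {1..n} {1..n}"
  proof (rule bij_betw_cong[THEN iffD2])
    show "bij_betw f {1..n} {1..n}" using f(1) unfolding K .
  qed (simp add: \<pi>_def)
  then have p: "\<pi> permutes {1..n}" by (rule bij_imp_permutes) (auto simp: \<pi>_def)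
  have "rank_in K A = rank_in K' (\<pi> ` A)" if A: "A \<subseteq> {1..n}" for A
  proof -
    have "\<pi> ` A = f ` A" using A by (intro image_cong) (auto simp: \<pi>_def)
    then show ?thesis using rank_image_isomorphism[OF f] A K by simp
  qed
  then show ?thesis
    using sym_count_cong[of n "rank_in K" "\<lambda>A. rank_in K' (\<pi> ` A)"] sym_count_permute[OF p, of "rank_in K'"]
    by simp
qed

text \<open>
  Any two copies on \<open>{1..n}\<close> differ by a permutation of the coordinates, which the symmetrization
  absorbs; so the choice that is made in \<^const>\<open>standard_copy\<close> does not matter.
\<close>

lemma sym_matroid_indicator_eq:
  assumes M: "matroid M" and K: "matroid K" "ground K = {1..n}" "isomorphic M K"
  shows "sym_matroid_indicator M = (\<lambda>x. real (sym_count n (rank_in K) x) / fact n)"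
proof -
  have n: "card (ground M) = n" using isomorphic_card_rank(1)[OF K(3)] K(2) by simp
  have S: "matroid (standard_copy M) \<and> ground (standard_copy M) = {1..n} \<and> isomorphic M (standard_copy M)"
    unfolding standard_copy_def n using standard_copy_exists[OF M] unfolding n by (rule someI_ex)
  then have "isomorphic (standard_copy M) K"
    using K(3) isomorphic_sym isomorphic_trans by blast
  then have "sym_count n (rank_in (standard_copy M)) x = sym_count n (rank_in K) x" for x
    using sym_count_isomorphic[of "standard_copy M" n K x] S K(2) by blast
  then show ?thesis
    unfolding sym_matroid_indicator_def n
    using sym_indicator_base_polytope[of "standard_copy M" n] S by (simp add: fun_eq_iff)
qed

lemma isomorphic_refl: "isomorphic M M"
  unfolding isomorphic_def by (intro exI[of _ id]) simp

lemma sym_matroid_indicator_isomorphic: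
  assumes "matroid M" "matroid N" "isomorphic M N"
  shows "sym_matroid_indicator M = sym_matroid_indicator N"
proof -
  obtain K :: "nat matroid" where K: "matroid K" "ground K = {1..card (ground N)}" "isomorphic N K"
    using standard_copy_exists[OF assms(2)] by blast
  show ?thesis
    unfolding sym_matroid_indicator_eq[OF assms(1) K(1,2) isomorphic_trans[OF assms(3) K(3)]]
      sym_matroid_indicator_eq[OF assms(2) K] ..
qed

section \<open>Integral expansions into nested matroids\<close>

text \<open>
  Sign-reversing involution: toggle membership of \<open>a\<close>.
\<close>

lemma alternating_sum_toggle:
  fixes h :: "'a set \<Rightarrow> real"
  assumes "finite E" "a \<in> E - F"
    and h: "\<And>F'. F \<subseteq> F' \<Longrightarrow> F' \<subseteq> E - {a} \<Longrightarrow> h (insert a F') = h F'"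
  shows "(\<Sum>F' | F \<subseteq> F' \<and> F' \<subseteq> E. (- 1) ^ card F' * h F') = 0"
proof -
  let ?S = "{F'. F \<subseteq> F' \<and> F' \<subseteq> E - {a}}"
  have fin: "finite ?S" using assms(1) by simp
  have inj: "inj_on (insert a) ?S" by (auto simp: inj_on_def)
  have split: "{F'. F \<subseteq> F' \<and> F' \<subseteq> E} = ?S \<union> insert a ` ?S"
  proof
    show "{F'. F \<subseteq> F' \<and> F' \<subseteq> E} \<subseteq> ?S \<union> insert a ` ?S"
    proof
      fix F' assume F': "F' \<in> {F'. F \<subseteq> F' \<and> F' \<subseteq> E}"
      show "F' \<in> ?S \<union> insert a ` ?S"
      proof (cases "a \<in> F'")
        case True
        then have "F' = insert a (F' - {a})" by blast
        moreover have "F' - {a} \<in> ?S" using F' assms(2) by blast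
        ultimately show ?thesis by blast
      qed (use F' in blast)
    qed
  qed (use assms(2) in blast)
  have flip: "(- 1) ^ card (insert a F') * h (insert a F') = - ((- 1) ^ card F' * h F')"
    if "F' \<in> ?S" for F'
  proof -
    have "finite F'" "a \<notin> F'" using that assms(1) by (auto intro: finite_subset)
    then show ?thesis using h[of F'] that by simp
  qed
  have "(\<Sum>F' | F \<subseteq> F' \<and> F' \<subseteq> E. (- 1) ^ card F' * h F') =
      (\<Sum>F'\<in>?S. (- 1) ^ card F' * h F') + (\<Sum>F'\<in>insert a ` ?S. (- 1) ^ card F' * h F')"
    unfolding split using fin by (intro sum.union_disjoint) auto
  also have "(\<Sum>F'\<in>insert a ` ?S. (- 1) ^ card F' * h F') = (\<Sum>F'\<in>?S. - ((- 1) ^ card F' * h F'))"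
    unfolding sum.reindex[OF inj] comp_def using flip by (intro sum.cong) auto
  finally show ?thesis by (simp add: sum_negf)
qed

text \<open>
  A Moebius inversion over the sets all of whose supersets are good. If \<open>F\<close> is good but has a bad
  superset, then a smallest bad superset \<open>A\<close> can be joined to every bad superset of \<open>F\<close> without
  making it good, so whether a set has a bad superset is not affected by an element of \<open>A - F\<close>.
\<close>

lemma alternating_sum_hereditarily_good:
  fixes good :: "'a set \<Rightarrow> bool"
  defines "U \<equiv> \<lambda>F' E. \<forall>A. F' \<subseteq> A \<and> A \<subseteq> E \<longrightarrow> good A"
  assumes fin: "finite E" and F: "F \<subset> E" "good F"
    and cross: "\<And>A B. A \<subseteq> E \<Longrightarrow> B \<subseteq> E \<Longrightarrow> \<not> good A \<Longrightarrow> \<not> good B \<Longrightarrow> \<not> good (A \<union> B) \<or> \<not> good (A \<inter> B)"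
  shows "(\<Sum>F' | F \<subseteq> F' \<and> F' \<subseteq> E. (- 1) ^ card F' * (of_bool (U F' E) :: real)) = 0"
proof -
  \<comment> \<open>An element whose membership does not affect whether a set between \<open>F\<close> and \<open>E\<close> has a bad superset.\<close>
  have "\<exists>a\<in>E - F. \<forall>F'. F \<subseteq> F' \<and> F' \<subseteq> E \<longrightarrow> (U (insert a F') E \<longleftrightarrow> U F' E)"
  proof (cases "U F E")
    case True
    then have up: "U F' E" if "F \<subseteq> F'" for F' using that unfolding U_def by (meson order_trans)
    obtain a where "a \<in> E - F" using F(1) by blast
    moreover have "\<forall>F'. F \<subseteq> F' \<and> F' \<subseteq> E \<longrightarrow> (U (insert a F') E \<longleftrightarrow> U F' E)"
    proof (intro allI impI)
      fix F' assume F': "F \<subseteq> F' \<and> F' \<subseteq> E"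
      have "U (insert a F') E" by (rule up) (use F' in auto)
      moreover have "U F' E" by (rule up) (use F' in auto)
      ultimately show "U (insert a F') E \<longleftrightarrow> U F' E" by simp
    qed
    ultimately show ?thesis by (rule bexI[rotated])
  next
    case False
    define Q where "Q A \<longleftrightarrow> F \<subseteq> A \<and> A \<subseteq> E \<and> \<not> good A" for A
    obtain A0 where A0: "Q A0" using False unfolding U_def Q_def by auto
    obtain A where A: "Q A" and min: "\<And>B. Q B \<Longrightarrow> card A \<le> card B"
      using ex_has_least_nat[of Q A0 card, OF A0] by auto
    have finA: "finite A" using A fin finite_subset unfolding Q_def by blast
    have join: "Q (A \<union> B)" if B: "Q B" for B
    proof (cases "good (A \<inter> B)")
      case True
      then show ?thesis using cross[of A B] A B unfolding Q_def by blast
    next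
      case False
      then have "Q (A \<inter> B)" using A B unfolding Q_def by blast
      from min[OF this] have "A \<inter> B = A" using finA card_seteq[of A "A \<inter> B"] by blast
      then have "A \<union> B = B" by blast
      then show ?thesis using B by simp
    qed
    obtain a where a: "a \<in> A" "a \<notin> F" using A F(2) unfolding Q_def by (metis subset_antisym subsetI)
    have "U (insert a F') E \<longleftrightarrow> U F' E" if F': "F \<subseteq> F' \<and> F' \<subseteq> E" for F'
    proof
      assume "U F' E" then show "U (insert a F') E" unfolding U_def by blast
    next
      assume up: "U (insert a F') E"
      show "U F' E" unfolding U_def
      proof (intro allI impI)
        fix B assume B: "F' \<subseteq> B \<and> B \<subseteq> E"
        show "good B"
        proof (rule ccontr)
          assume "\<not> good B"
          then have "Q (A \<union> B)" using join B F' unfolding Q_def by blast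
          then show False using up a B unfolding U_def Q_def by blast
        qed
      qed
    qed
    moreover have "a \<in> E - F" using a A unfolding Q_def by blast
    ultimately show ?thesis by blast
  qed
  then obtain a where a: "a \<in> E - F" "\<And>F'. F \<subseteq> F' \<Longrightarrow> F' \<subseteq> E \<Longrightarrow> U (insert a F') E \<longleftrightarrow> U F' E"
    by blast
  show ?thesis
  proof (rule alternating_sum_toggle[OF fin a(1)])
    fix F' assume "F \<subseteq> F'" "F' \<subseteq> E - {a}"
    then show "of_bool (U (insert a F') E) = (of_bool (U F' E) :: real)"
      using a(2)[of F'] by auto
  qed
qed

text \<open>
  The functions whose symmetrization is an integral combination of those of the listed nested
  matroids. This is a condition on functions rather than on matroids because the induction below runs
  through indicators of regions that are not base polytopes.
\<close>

definition nested_span :: "nat \<Rightarrow> nat \<Rightarrow> (nat \<Rightarrow> nat matroid) \<Rightarrow> ((nat \<Rightarrow> real) \<Rightarrow> real) set" where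
  "nested_span R n N = {f. \<exists>a. (\<forall>i. a i \<in> \<int>) \<and>
     (\<forall>x. (\<Sum>\<sigma> | \<sigma> permutes {1..n}. f (x \<circ> \<sigma>)) / fact n =
          (\<Sum>i = 1..n choose R. a i * sym_matroid_indicator (N i) x))}"

lemma nested_span_zero: "(\<lambda>x. 0) \<in> nested_span R n N"
  unfolding nested_span_def by (auto intro!: exI[of _ "\<lambda>i. 0"])

lemma nested_span_add:
  assumes "f \<in> nested_span R n N" "g \<in> nested_span R n N"
  shows "(\<lambda>x. f x + g x) \<in> nested_span R n N"
proof -
  obtain a b where "\<forall>i. a i \<in> \<int>" "\<forall>i. b i \<in> \<int>"
    and "\<And>x. (\<Sum>\<sigma> | \<sigma> permutes {1..n}. f (x \<circ> \<sigma>)) / fact n =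
      (\<Sum>i = 1..n choose R. a i * sym_matroid_indicator (N i) x)"
    and "\<And>x. (\<Sum>\<sigma> | \<sigma> permutes {1..n}. g (x \<circ> \<sigma>)) / fact n =
      (\<Sum>i = 1..n choose R. b i * sym_matroid_indicator (N i) x)"
    using assms unfolding nested_span_def by blast
  then show ?thesis
    unfolding nested_span_def mem_Collect_eq
    by (intro exI[of _ "\<lambda>i. a i + b i"]) (auto simp: sum.distrib add_divide_distrib distrib_right)
qed

lemma nested_span_scale:
  assumes "f \<in> nested_span R n N" "c \<in> \<int>"
  shows "(\<lambda>x. c * f x) \<in> nested_span R n N"
proof -
  obtain a where "\<forall>i. a i \<in> \<int>"
    and "\<And>x. (\<Sum>\<sigma> | \<sigma> permutes {1..n}. f (x \<circ> \<sigma>)) / fact n =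
      (\<Sum>i = 1..n choose R. a i * sym_matroid_indicator (N i) x)"
    using assms unfolding nested_span_def by blast
  then show ?thesis
    unfolding nested_span_def mem_Collect_eq using assms(2)
    by (intro exI[of _ "\<lambda>i. c * a i"])
      (auto simp: sum_distrib_left[symmetric] times_divide_eq_right[symmetric] mult.assoc
        simp del: times_divide_eq_right)
qed

lemma nested_span_sum:
  assumes "\<And>s. s \<in> S \<Longrightarrow> f s \<in> nested_span R n N"
  shows "(\<lambda>x. \<Sum>s\<in>S. f s x) \<in> nested_span R n N"
  using assms
  by (induction S rule: infinite_finite_induct) (simp_all add: nested_span_zero nested_span_add)

definition rank_box :: "'a set \<Rightarrow> nat \<Rightarrow> ('a \<Rightarrow> real) set" where
  "rank_box E R = {x. (\<forall>e. e \<notin> E \<longrightarrow> x e = 0) \<and> (\<forall>e\<in>E. 0 \<le> x e \<and> x e \<le> 1) \<and> sum x E = real R}"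

text \<open>
  The region where only the conditions for a chain are imposed is the base polytope of the chain
  matroid, which is nested. Its rank is still \<open>R\<close>, because \<open>r X + card (E - X) \<ge> r E\<close>.
\<close>

lemma chain_conditions_in_nested_span:
  assumes N: "nested_enumeration R n N" and rf: "rank_function {1..n} r" and R: "r {1..n} = R"
    and C: "C \<subseteq> Pow {1..n}" "chain\<^sub>\<subseteq> C" "{} \<in> C" "{1..n} \<in> C"
  shows "(\<lambda>x. of_bool (x \<in> rank_box {1..n} R \<and> (\<forall>X\<in>C. sum x X \<le> real (r X)))) \<in> nested_span R n N"
proof -
  let ?E = "{1..n}"
  let ?K = "chain_matroid ?E C r"
  have rc: "rank_chain ?E C r"
    using C rank_functionD(5)[OF rf] unfolding rank_chain_def by simp
  have M: "matroid ?K" using matroid_chain_matroid[OF rc] .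
  obtain X where X: "X \<in> C" "rank_in ?K ?E = r X + card (?E - X)"
    using rank_chain_matroid_attained[OF rc order_refl] by blast
  have XE: "X \<subseteq> ?E" using X(1) C by blast
  have "r (X \<union> (?E - X)) + r (X \<inter> (?E - X)) \<le> r X + r (?E - X)"
    by (rule rank_functionD(4)[OF rf XE]) blast
  moreover have "X \<union> (?E - X) = ?E" "X \<inter> (?E - X) = {}" using XE by blast+
  ultimately have "R \<le> r X + r (?E - X)" using R rank_functionD(5)[OF rf] by simp
  also have "r (?E - X) \<le> card (?E - X)" by (rule rank_functionD(2)[OF rf]) blast
  finally have "rank_in ?K ?E = R"
    using X(2) rank_chain_matroid_le[OF rc order_refl C(4)] R by simp
  then have rk: "matroid_rank ?K = R" unfolding matroid_rank_def by simp
  then have on: "?K \<in> matroids_on R n" using M unfolding matroids_on_def by simp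
  then obtain i where i: "i \<in> {1..n choose R}" "isomorphic ?K (N i)"
    using N nested_chain_matroid[OF rc] unfolding nested_enumeration_def by blast
  have "N i \<in> matroids_on R n" using N i(1) unfolding nested_enumeration_def by blast
  then have Ni: "matroid (N i)" unfolding matroids_on_def by simp
  have poly: "x \<in> rank_polytope ?E (rank_in ?K) \<longleftrightarrow>
      x \<in> rank_box ?E R \<and> (\<forall>X\<in>C. sum x X \<le> real (r X))" for x
    unfolding rank_polytope_chain_matroid[OF rc] rank_box_def \<open>rank_in ?K ?E = R\<close> by auto
  have "(\<Sum>\<sigma> | \<sigma> permutes ?E. of_bool (x \<circ> \<sigma> \<in> rank_polytope ?E (rank_in ?K))) / fact n =
      sym_matroid_indicator (N i) x" for x
    unfolding sym_matroid_indicator_isomorphic[OF M Ni i(2), symmetric]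
      sym_matroid_indicator_eq[OF M M ground_chain_matroid isomorphic_refl] sym_count_eq_sum ..
  moreover have "(\<Sum>j = 1..n choose R. of_bool (j = i) * sym_matroid_indicator (N j) x) =
      sym_matroid_indicator (N i) x" for x
  proof -
    have "(\<Sum>j = 1..n choose R. of_bool (j = i) * sym_matroid_indicator (N j) x) =
        (\<Sum>j = 1..n choose R. if j = i then sym_matroid_indicator (N j) x else 0)"
      by (intro sum.cong) auto
    then show ?thesis using i(1) by simp
  qed
  ultimately show ?thesis
    unfolding nested_span_def mem_Collect_eq poly
    by (intro exI[of _ "\<lambda>j. of_bool (j = i)"]) simp
qed

text \<open>
  The indicator of the base polytope is expanded chain by chain: the condition that all sets above
  the last member \<open>F\<close> of a chain are good is replaced, by the inversion formula, by the conditions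
  that belong to the chains with one more member.
\<close>

lemma rank_polytope_in_nested_span:
  assumes N: "nested_enumeration R n N" and rf: "rank_function {1..n} r" and R: "r {1..n} = R"
  shows "(\<lambda>x. of_bool (x \<in> rank_polytope {1..n} r)) \<in> nested_span R n N"
proof -
  let ?E = "{1..n}"
  define good where "good x A \<longleftrightarrow> sum x A \<le> real (r A)" for x A
  define U where "U x F \<longleftrightarrow> (\<forall>A. F \<subseteq> A \<and> A \<subseteq> ?E \<longrightarrow> good x A)" for x F
  define g :: "nat set set \<Rightarrow> nat set \<Rightarrow> (nat \<Rightarrow> real) \<Rightarrow> real" where
    "g C F x = of_bool (x \<in> rank_box ?E R \<and> (\<forall>X\<in>C. good x X) \<and> U x F)" for C F x
  have "g C F \<in> nested_span R n N"
    if "F \<subseteq> ?E" "C \<subseteq> Pow F" "chain\<^sub>\<subseteq> C" "{} \<in> C" "F \<in> C" for C F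
    using that
  proof (induction "card (?E - F)" arbitrary: F C rule: less_induct)
    case less
    show ?case
    proof (cases "F = ?E")
      case True
      have "U x F \<longleftrightarrow> good x F" for x unfolding U_def True by (metis order_refl subset_antisym)
      then have "g C F = (\<lambda>x. of_bool (x \<in> rank_box ?E R \<and> (\<forall>X\<in>C. sum x X \<le> real (r X))))"
        unfolding g_def good_def using less.prems(5) by (intro ext arg_cong[where f = of_bool]) blast
      then show ?thesis
        using chain_conditions_in_nested_span[OF N rf R, of C] less.prems True by simp
    next
      case False
      let ?S = "{F'. F \<subset> F' \<and> F' \<subseteq> ?E}"
      have step: "g C F x = (\<Sum>F'\<in>?S. - ((- 1) ^ card F * (- 1) ^ card F') * g (insert F' C) F' x)" for x
      proof (cases "x \<in> rank_box ?E R \<and> (\<forall>X\<in>C. good x X)")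
        case True
        have cross: "\<not> good x (A \<union> B) \<or> \<not> good x (A \<inter> B)"
          if AB: "A \<subseteq> ?E" "B \<subseteq> ?E" "\<not> good x A" "\<not> good x B" for A B
        proof -
          have "finite A" "finite B" using AB finite_subset by blast+
          then have "sum x (A \<union> B) + sum x (A \<inter> B) = sum x A + sum x B"
            by (rule sum.union_inter)
          then show ?thesis
            using AB(3,4) rank_functionD(4)[OF rf AB(1,2)] unfolding good_def by linarith
        qed
        have zero: "(\<Sum>F' | F \<subseteq> F' \<and> F' \<subseteq> ?E. (- 1) ^ card F' * (of_bool (U x F') :: real)) = 0"
          unfolding U_def
          by (rule alternating_sum_hereditarily_good) (use False less.prems True cross in auto)
        have ins: "{F'. F \<subseteq> F' \<and> F' \<subseteq> ?E} = insert F ?S" using less.prems(1) by blast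
        have "(\<Sum>F'\<in>insert F ?S. (- 1) ^ card F' * (of_bool (U x F') :: real)) =
            (- 1) ^ card F * of_bool (U x F) + (\<Sum>F'\<in>?S. (- 1) ^ card F' * of_bool (U x F'))"
          by (rule sum.insert) auto
        then have "(- 1) ^ card F * (of_bool (U x F) :: real) = - (\<Sum>F'\<in>?S. (- 1) ^ card F' * of_bool (U x F'))"
          using zero unfolding ins by linarith
        then have "(- 1) ^ card F * ((- 1) ^ card F * (of_bool (U x F) :: real)) =
            (- 1) ^ card F * - (\<Sum>F'\<in>?S. (- 1) ^ card F' * of_bool (U x F'))"
          by (rule arg_cong)
        then have "(of_bool (U x F) :: real) = (\<Sum>F'\<in>?S. - ((- 1) ^ card F * (- 1) ^ card F') * of_bool (U x F'))"
          by (simp add: sum_distrib_left sum_negf mult.assoc[symmetric] power_mult_distrib[symmetric])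
        moreover have "g C F x = of_bool (U x F)" using True unfolding g_def by simp
        moreover have "g (insert F' C) F' x = of_bool (U x F')" if "F' \<in> ?S" for F'
          using True that unfolding g_def U_def by auto
        ultimately show ?thesis by simp
      next
        case False
        then have "g C' F' x = 0" if "C \<subseteq> C'" for C' F' using that unfolding g_def by auto
        then show ?thesis by (simp add: subset_insertI)
      qed
      have "g (insert F' C) F' \<in> nested_span R n N" if F': "F' \<in> ?S" for F'
      proof (rule less.hyps)
        show "card (?E - F') < card (?E - F)" using F' by (intro psubset_card_mono) auto
        show "insert F' C \<subseteq> Pow F'" using less.prems(2) F' by blast
        show "chain\<^sub>\<subseteq> (insert F' C)"
          using less.prems F' unfolding chain_subset_def by blast
      qed (use F' less.prems in auto)
      then have "(\<lambda>x. \<Sum>F'\<in>?S. - ((- 1) ^ card F * (- 1) ^ card F') * g (insert F' C) F' x) \<in> nested_span R n N"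
        by (intro nested_span_sum nested_span_scale) auto
      then show ?thesis using step by presburger
    qed
  qed
  from this[of "{}" "{{}}"] have "g {{}} {} \<in> nested_span R n N"
    by (simp add: chain_subset_def)
  moreover have "g {{}} {} = (\<lambda>x. of_bool (x \<in> rank_polytope ?E r))"
  proof
    fix x
    have "x \<in> rank_polytope ?E r \<longleftrightarrow> x \<in> rank_box ?E R \<and> (\<forall>A\<subseteq>?E. good x A)"
      unfolding rank_box_def good_def using rank_polytope_le_1[OF rf, of x] R
      unfolding rank_polytope_def by blast
    moreover have "(\<forall>X\<in>{{}}. good x X) \<and> U x {} \<longleftrightarrow> (\<forall>A\<subseteq>?E. good x A)"
      unfolding U_def by auto
    ultimately show "g {{}} {} x = of_bool (x \<in> rank_polytope ?E r)" unfolding g_def by simp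
  qed
  ultimately show ?thesis by simp
qed

lemma nested_expansion_exists:
  assumes N: "nested_enumeration R n N" and K: "K \<in> matroids_on R n"
  shows "\<exists>a. (\<forall>i. a i \<in> \<int>) \<and> (\<forall>i. i \<notin> {1..n choose R} \<longrightarrow> a i = 0) \<and>
    sym_matroid_indicator K = (\<lambda>x. \<Sum>i = 1..n choose R. a i * sym_matroid_indicator (N i) x)"
proof -
  have M: "matroid K" and gr: "ground K = {1..n}" and R: "rank_in K {1..n} = R"
    using K unfolding matroids_on_def matroid_rank_def by auto
  have "rank_function {1..n} (rank_in K)" using rank_function_rank_in[OF M] gr by simp
  from rank_polytope_in_nested_span[OF N this R]
  obtain a where a: "\<And>i. a i \<in> \<int>"
    "\<And>x. (\<Sum>\<sigma> | \<sigma> permutes {1..n}. of_bool (x \<circ> \<sigma> \<in> rank_polytope {1..n} (rank_in K))) / fact n =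
      (\<Sum>i = 1..n choose R. a i * sym_matroid_indicator (N i) x)"
    unfolding nested_span_def by blast
  then show ?thesis
    unfolding sym_matroid_indicator_eq[OF M M gr isomorphic_refl] sym_count_eq_sum
    by (intro exI[of _ "\<lambda>i. if i \<in> {1..n choose R} then a i else 0"]) auto
qed

section \<open>Counting flags of flats by evaluating indicators\<close>

text \<open>
  Since ranks are integers, a perturbation of \<open>x\<close> by less than \<open>\<delta>\<close> cannot affect the inequalities that
  are not tight at \<open>x\<close>, whichever rank function is considered. The uniformity matters: the same
  perturbations are applied to all matroids in a linear relation.
\<close>

lemma integral_gap:
  fixes x :: "'a \<Rightarrow> real"
  assumes "finite E"
  obtains \<delta> where "\<delta> > 0" "\<And>A t. A \<subseteq> E \<Longrightarrow> t \<le> card E \<Longrightarrow> sum x A \<noteq> real t \<Longrightarrow> \<delta> \<le> \<bar>sum x A - real t\<bar>"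
proof -
  let ?S = "insert 1 ((\<lambda>(A, t). \<bar>sum x A - real t\<bar>) ` (Pow E \<times> {..card E}) - {0})"
  have fin: "finite ?S" using assms by simp
  then have "Min ?S \<in> ?S" by (intro Min_in) auto
  then have "Min ?S > 0" by auto
  moreover have "Min ?S \<le> \<bar>sum x A - real t\<bar>"
    if "A \<subseteq> E" "t \<le> card E" "sum x A \<noteq> real t" for A t
    using that by (intro Min_le[OF fin]) auto
  ultimately show thesis using that by blast
qed

text \<open>
  Mass leaves \<open>e0\<close> for the elements of \<open>T\<close>, so the total does not change. For small \<open>\<eta>\<close> only the
  inequalities that are tight at \<open>x\<close> can fail at the shifted point.
\<close>

definition shifted :: "('a \<Rightarrow> real) \<Rightarrow> real \<Rightarrow> 'a set \<Rightarrow> 'a \<Rightarrow> 'a \<Rightarrow> real" where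
  "shifted x \<eta> T e0 = (\<lambda>e. x e + (if e \<in> T then \<eta> else 0) - (if e = e0 then \<eta> * real (card T) else 0))"

lemma sum_shifted:
  assumes "finite A" "finite T"
  shows "sum (shifted x \<eta> T e0) A =
    sum x A + \<eta> * real (card (T \<inter> A)) - (if e0 \<in> A then \<eta> * real (card T) else 0)"
proof -
  have "(\<Sum>e\<in>A. if e \<in> T then \<eta> else 0) = \<eta> * real (card (T \<inter> A))"
    using assms by (simp add: sum.If_cases Int_commute Collect_mem_eq)
  then show ?thesis using assms(1) unfolding shifted_def by (simp add: sum.distrib sum_subtractf)
qed

lemma shifted_in_rank_polytope_iff:
  fixes x :: "'a \<Rightarrow> real"
  assumes rf: "rank_function E r" and T: "T \<subseteq> E" "e0 \<in> E" "e0 \<notin> T"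
    and gap: "\<And>A t. A \<subseteq> E \<Longrightarrow> t \<le> card E \<Longrightarrow> sum x A \<noteq> real t \<Longrightarrow> \<delta> \<le> \<bar>sum x A - real t\<bar>"
    and \<eta>: "0 < \<eta>" "\<eta> * real (card T) < \<delta>" "\<eta> * real (card T) \<le> x e0"
    and x: "\<And>e. e \<notin> E \<Longrightarrow> x e = 0" "\<And>e. e \<in> E \<Longrightarrow> 0 \<le> x e" "sum x E = real (r E)"
  shows "shifted x \<eta> T e0 \<in> rank_polytope E r \<longleftrightarrow>
    x \<in> rank_polytope E r \<and> (\<forall>A\<subseteq>E. sum x A = real (r A) \<and> e0 \<notin> A \<longrightarrow> T \<inter> A = {})"
proof -
  have finE: "finite E" using rank_functionD(1)[OF rf] .
  then have finT: "finite T" using T finite_subset by blast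
  have s: "sum (shifted x \<eta> T e0) A =
      sum x A + \<eta> * real (card (T \<inter> A)) - (if e0 \<in> A then \<eta> * real (card T) else 0)" if "A \<subseteq> E" for A
    by (rule sum_shifted[OF finite_subset[OF that finE] finT])
  have gap': "sum x A = real (r A) \<or> \<delta> \<le> \<bar>sum x A - real (r A)\<bar>" if A: "A \<subseteq> E" for A
  proof -
    have "r A \<le> card E" using rank_functionD(2)[OF rf A] card_mono[OF finE A] by linarith
    then show ?thesis using gap[OF A] by blast
  qed
  have cT: "0 \<le> \<eta> * real (card (T \<inter> A))" "\<eta> * real (card (T \<inter> A)) \<le> \<eta> * real (card T)" for A
    using \<eta>(1) finT by (auto intro!: card_mono)
  show ?thesis
  proof
    assume y: "shifted x \<eta> T e0 \<in> rank_polytope E r"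
    have le: "sum x A \<le> real (r A)" if A: "A \<subseteq> E" for A
    proof -
      have "sum x A - \<eta> * real (card T) \<le> real (r A)"
      proof -
        have "(if e0 \<in> A then \<eta> * real (card T) else 0) \<le> \<eta> * real (card T)" using \<eta>(1) by simp
        then show ?thesis using rank_polytopeD(3)[OF y A] cT[of A] unfolding s[OF A] by linarith
      qed
      then show ?thesis using gap'[OF A] \<eta>(2) by linarith
    qed
    moreover have "T \<inter> A = {}" if A: "A \<subseteq> E" "sum x A = real (r A)" "e0 \<notin> A" for A
    proof -
      have "\<eta> * real (card (T \<inter> A)) \<le> 0"
        using rank_polytopeD(3)[OF y A(1)] A unfolding s[OF A(1)] by simp
      then show ?thesis using \<eta>(1) finT by (simp add: mult_le_0_iff)
    qed
    ultimately show "x \<in> rank_polytope E r \<and> (\<forall>A\<subseteq>E. sum x A = real (r A) \<and> e0 \<notin> A \<longrightarrow> T \<inter> A = {})"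
      using x unfolding rank_polytope_def by blast
  next
    assume R: "x \<in> rank_polytope E r \<and> (\<forall>A\<subseteq>E. sum x A = real (r A) \<and> e0 \<notin> A \<longrightarrow> T \<inter> A = {})"
    show "shifted x \<eta> T e0 \<in> rank_polytope E r"
      unfolding rank_polytope_def mem_Collect_eq
    proof (intro conjI allI impI ballI)
      fix e assume "e \<notin> E" then show "shifted x \<eta> T e0 e = 0"
        using x(1) T unfolding shifted_def by auto
    next
      fix e assume "e \<in> E" then show "0 \<le> shifted x \<eta> T e0 e"
        using x(2) T \<eta> unfolding shifted_def by auto
    next
      fix A assume A: "A \<subseteq> E"
      have le: "sum x A \<le> real (r A)" using R rank_polytopeD(3)[of x E r A] A by blast
      show "sum (shifted x \<eta> T e0) A \<le> real (r A)"
      proof (cases "e0 \<in> A \<or> sum x A = real (r A)")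
        case True
        then have "T \<inter> A = {} \<or> e0 \<in> A" using R A by blast
        then have "\<eta> * real (card (T \<inter> A)) \<le> (if e0 \<in> A then \<eta> * real (card T) else 0)"
          using cT[of A] by auto
        then show ?thesis using le unfolding s[OF A] by linarith
      next
        case False
        then have "sum x A + \<delta> \<le> real (r A)" using gap'[OF A] le by linarith
        then show ?thesis using False cT[of A] \<eta>(2) unfolding s[OF A] by simp
      qed
    next
      have "T \<inter> E = T" using T by blast
      then show "sum (shifted x \<eta> T e0) E = real (r E)" unfolding s[OF order_refl] using x(3) T by simp
    qed
  qed
qed

lemma tight_Union:
  assumes rf: "rank_function E r" and x: "x \<in> rank_polytope E r"
    and "finite \<A>" "\<And>A. A \<in> \<A> \<Longrightarrow> A \<subseteq> E \<and> sum x A = real (r A)"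
  shows "\<Union>\<A> \<subseteq> E \<and> sum x (\<Union>\<A>) = real (r (\<Union>\<A>))"
  using assms(3,4)
proof (induction \<A> rule: finite_induct)
  case empty
  then show ?case using rank_functionD(5)[OF rf] by simp
next
  case (insert A \<A>)
  then show ?case using tight_Un_Int(1)[OF rf x, of A "\<Union>\<A>"] by simp
qed

text \<open>
  Moving a little mass from \<open>e0\<close> to the elements of \<open>T\<close> leads out of the polytope exactly when some
  tight set avoids \<open>e0\<close> and meets \<open>T\<close>. The union \<open>V\<close> of the tight sets that avoid \<open>e0\<close> is tight, so
  the alternating sum over all \<open>T \<subseteq> E'\<close> counts the \<open>T \<subseteq> E' - V\<close> with sign and detects \<open>E' \<subseteq> V\<close>.
\<close>

lemma alternating_sum_shifted:
  fixes x :: "'a \<Rightarrow> real"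
  assumes rf: "rank_function E r" and E': "E' \<subseteq> E" "e0 \<in> E" "e0 \<notin> E'"
    and gap: "\<And>A t. A \<subseteq> E \<Longrightarrow> t \<le> card E \<Longrightarrow> sum x A \<noteq> real t \<Longrightarrow> \<delta> \<le> \<bar>sum x A - real t\<bar>"
    and \<eta>: "0 < \<eta>" "\<eta> * real (card E) < \<delta>" "\<eta> * real (card E) \<le> x e0"
    and x: "\<And>e. e \<notin> E \<Longrightarrow> x e = 0" "\<And>e. e \<in> E \<Longrightarrow> 0 \<le> x e" "sum x E = real (r E)"
  shows "(\<Sum>T | {} \<subseteq> T \<and> T \<subseteq> E'. (- 1) ^ card T * (of_bool (shifted x \<eta> T e0 \<in> rank_polytope E r) :: real)) =
    of_bool (x \<in> rank_polytope E r \<and> (\<exists>V\<subseteq>E. E' \<subseteq> V \<and> e0 \<notin> V \<and> sum x V = real (r V)))"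
proof -
  have finE: "finite E" using rank_functionD(1)[OF rf] .
  then have finE': "finite E'" using E' finite_subset by blast
  have iff: "shifted x \<eta> T e0 \<in> rank_polytope E r \<longleftrightarrow>
      x \<in> rank_polytope E r \<and> (\<forall>A\<subseteq>E. sum x A = real (r A) \<and> e0 \<notin> A \<longrightarrow> T \<inter> A = {})" if T: "T \<subseteq> E'" for T
  proof -
    have "real (card T) \<le> real (card E)" using T E' finE by (intro of_nat_mono card_mono) auto
    then have "\<eta> * real (card T) \<le> \<eta> * real (card E)" using \<eta>(1) by simp
    then have "\<eta> * real (card T) < \<delta>" "\<eta> * real (card T) \<le> x e0" using \<eta>(2,3) by linarith+
    then show ?thesis
      using T E' by (intro shifted_in_rank_polytope_iff[OF rf _ E'(2) _ gap \<eta>(1) _ _ x]) auto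
  qed
  show ?thesis
  proof (cases "x \<in> rank_polytope E r")
    case False
    then show ?thesis using iff by (simp add: sum.neutral)
  next
    case True
    define \<A> where "\<A> = {A. A \<subseteq> E \<and> sum x A = real (r A) \<and> e0 \<notin> A}"
    define V where "V = \<Union>\<A>"
    have V: "V \<subseteq> E \<and> sum x V = real (r V)"
      unfolding V_def using finE by (intro tight_Union[OF rf True]) (auto simp: \<A>_def)
    have e0: "e0 \<notin> V" unfolding V_def \<A>_def by blast
    have VA: "A \<subseteq> V" if "A \<subseteq> E" "sum x A = real (r A)" "e0 \<notin> A" for A
      using that unfolding V_def \<A>_def by blast
    have mem: "shifted x \<eta> T e0 \<in> rank_polytope E r \<longleftrightarrow> T \<inter> V = {}" if T: "T \<subseteq> E'" for T
      unfolding iff[OF T] using True V e0 VA by blast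
    have rhs: "(\<exists>V\<subseteq>E. E' \<subseteq> V \<and> e0 \<notin> V \<and> sum x V = real (r V)) \<longleftrightarrow> E' \<subseteq> V"
      using V e0 VA by blast
    show ?thesis
    proof (cases "E' \<subseteq> V")
      case False
      then obtain a where a: "a \<in> E' - {}" "a \<notin> V" by blast
      have "(\<Sum>T | {} \<subseteq> T \<and> T \<subseteq> E'. (- 1) ^ card T * (of_bool (shifted x \<eta> T e0 \<in> rank_polytope E r) :: real)) = 0"
      proof (rule alternating_sum_toggle[OF finE' a(1)])
        fix T assume "T \<subseteq> E' - {a}"
        then have "T \<subseteq> E'" "insert a T \<subseteq> E'" using a by blast+
        then show "of_bool (shifted x \<eta> (insert a T) e0 \<in> rank_polytope E r) =
            (of_bool (shifted x \<eta> T e0 \<in> rank_polytope E r) :: real)"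
          using mem[of T] mem[of "insert a T"] a by simp
      qed
      then show ?thesis using rhs False by simp
    next
      case sub: True
      have fin: "finite {T. {} \<subseteq> T \<and> T \<subseteq> E'}" using finE' by simp
      have "(\<Sum>T | {} \<subseteq> T \<and> T \<subseteq> E'. (- 1) ^ card T * (of_bool (shifted x \<eta> T e0 \<in> rank_polytope E r) :: real)) =
          (\<Sum>T | {} \<subseteq> T \<and> T \<subseteq> E'. if T = {} then 1 else 0)"
        using mem sub by (intro sum.cong) auto
      also have "\<dots> = 1" using fin by simp
      finally show ?thesis using rhs sub True by simp
    qed
  qed
qed

text \<open>
  A flag \<open>X 0, \<dots>, X m\<close> of flats of the restriction to \<open>X m\<close>, with ranks \<open>0, \<dots>, m\<close>. It suffices to test
  \<open>X i\<close> against the elements of \<open>X (Suc i)\<close>: any other element is outside the closure of \<open>X (Suc i)\<close> as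
  soon as the later members are flats, hence outside the closure of \<open>X i\<close>.
\<close>

definition flag_of_flats :: "('a set \<Rightarrow> nat) \<Rightarrow> (nat \<Rightarrow> 'a set) \<Rightarrow> nat \<Rightarrow> bool" where
  "flag_of_flats r X m \<longleftrightarrow>
     (\<forall>i\<le>m. r (X i) = i) \<and> (\<forall>i<m. \<forall>b\<in>X (Suc i) - X i. i < r (insert b (X i)))"

text \<open>
  At a point with an integral sum on \<open>E'\<close> that is uniform with sum one on \<open>E - E'\<close>, every tight set that contains \<open>E'\<close> but not
  all of \<open>E\<close> is \<open>E'\<close> itself: the sum over any other such set is not an integer. Once \<open>E'\<close> is tight,
  the condition on the uniform part just says that \<open>E'\<close> is a hyperplane.
\<close>

lemma uniform_extension_iff:
  fixes p :: "'a \<Rightarrow> real"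
  assumes rf: "rank_function E r" and rE: "r E = Suc m" and E': "E' \<subseteq> E" "e0 \<in> E - E'"
    and p: "\<And>e. e \<notin> E' \<Longrightarrow> p e = 0" "\<And>e. e \<in> E' \<Longrightarrow> 0 \<le> p e" "sum p E' = real m"
  defines "x \<equiv> \<lambda>e. if e \<in> E - E' then 1 / real (card (E - E')) else p e"
  shows "x \<in> rank_polytope E r \<and> (\<exists>V\<subseteq>E. E' \<subseteq> V \<and> e0 \<notin> V \<and> sum x V = real (r V)) \<longleftrightarrow>
    r E' = m \<and> (\<forall>b\<in>E - E'. m < r (insert b E')) \<and> p \<in> rank_polytope E' r"
proof -
  have finE: "finite E" using rank_functionD(1)[OF rf] .
  let ?B = "E - E'"
  have b0: "real (card ?B) > 0" using E' finE by (auto simp: card_gt_0_iff)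
  have s: "sum x A = sum p (A \<inter> E') + real (card (A - E')) / real (card ?B)" if A: "A \<subseteq> E" for A
  proof -
    have finA: "finite A" using A finE finite_subset by blast
    have "sum x A = sum x (A \<inter> E') + sum x (A - E')" using finA by (metis sum.Int_Diff)
    moreover have "sum x (A \<inter> E') = sum p (A \<inter> E')" unfolding x_def by (intro sum.cong) auto
    moreover have "sum x (A - E') = (\<Sum>e\<in>A - E'. 1 / real (card ?B))"
      unfolding x_def using A by (intro sum.cong) auto
    ultimately show ?thesis by simp
  qed
  have sE': "sum x E' = real m" using s[OF E'(1)] p(3) by simp
  show ?thesis
  proof
    assume L: "x \<in> rank_polytope E r \<and> (\<exists>V\<subseteq>E. E' \<subseteq> V \<and> e0 \<notin> V \<and> sum x V = real (r V))"
    then obtain V where V: "V \<subseteq> E" "E' \<subseteq> V" "e0 \<notin> V" "sum x V = real (r V)" by blast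
    have x: "x \<in> rank_polytope E r" using L by blast
    have "V - E' \<subset> ?B" using V E' by blast
    then have lt: "card (V - E') < card ?B" using finE by (intro psubset_card_mono) auto
    have "V \<inter> E' = E'" using V by blast
    then have eq: "real (r V) = real m + real (card (V - E')) / real (card ?B)"
      using s[OF V(1)] V(4) p(3) by simp
    have "0 \<le> real (card (V - E')) / real (card ?B)" "real (card (V - E')) / real (card ?B) < 1"
      using lt b0 by auto
    then have "r V = m" using eq by linarith
    then have "card (V - E') = 0" using eq b0 by simp
    then have "V = E'" using V finE finite_subset[of "V - E'" E] by (auto simp: card_eq_0_iff)
    then have rE': "r E' = m" using \<open>r V = m\<close> by simp
    moreover have "m < r (insert b E')" if b: "b \<in> ?B" for b
    proof -
      have "insert b E' - E' = {b}" "insert b E' \<inter> E' = E'" "insert b E' \<subseteq> E" using b E' by blast+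
      then have "real m + 1 / real (card ?B) \<le> real (r (insert b E'))"
        using s[of "insert b E'"] p(3) rank_polytopeD(3)[OF x, of "insert b E'"] by simp
      moreover have "1 / real (card ?B) > 0" using b0 by simp
      ultimately show ?thesis by linarith
    qed
    moreover have "p \<in> rank_polytope E' r"
      unfolding rank_polytope_def mem_Collect_eq
    proof (intro conjI allI impI ballI)
      fix A assume A: "A \<subseteq> E'"
      then have "A \<inter> E' = A" "A \<subseteq> E" "A - E' = {}" using E' by blast+
      moreover have "card (A - E') = 0" unfolding \<open>A - E' = {}\<close> by simp
      ultimately show "sum p A \<le> real (r A)" using s[of A] rank_polytopeD(3)[OF x, of A] by simp
    qed (use p rE' in auto)
    ultimately show "r E' = m \<and> (\<forall>b\<in>?B. m < r (insert b E')) \<and> p \<in> rank_polytope E' r" by blast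
  next
    assume R: "r E' = m \<and> (\<forall>b\<in>?B. m < r (insert b E')) \<and> p \<in> rank_polytope E' r"
    have "x \<in> rank_polytope E r"
      unfolding rank_polytope_def mem_Collect_eq
    proof (intro conjI allI impI ballI)
      fix e assume "e \<notin> E" then show "x e = 0" using p(1) E' unfolding x_def by auto
    next
      fix e assume "e \<in> E" then show "0 \<le> x e" using p(2) unfolding x_def by auto
    next
      fix A assume A: "A \<subseteq> E"
      have pA: "sum p (A \<inter> E') \<le> real (r (A \<inter> E'))"
        using R rank_polytopeD(3)[of p E' r "A \<inter> E'"] by blast
      show "sum x A \<le> real (r A)"
      proof (cases "A \<subseteq> E'")
        case True
        then have "A \<inter> E' = A" "A - E' = {}" by blast+
        moreover have "card (A - E') = 0" unfolding \<open>A - E' = {}\<close> by simp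
        ultimately show ?thesis using s[OF A] pA by simp
      next
        case False
        then obtain b where b: "b \<in> A - E'" by blast
        have "m < r (insert b E')" using R b A by blast
        also have "\<dots> \<le> r (A \<union> E')" using b A E' by (intro rank_functionD(3)[OF rf]) auto
        finally have "r (A \<inter> E') + 1 \<le> r A"
          using rank_functionD(4)[OF rf A E'(1)] R by linarith
        moreover have "card (A - E') \<le> card ?B" using A finE by (intro card_mono) auto
        then have "real (card (A - E')) / real (card ?B) \<le> 1" using b0 by simp
        ultimately show ?thesis using s[OF A] pA by linarith
      qed
    next
      have "E \<inter> E' = E'" using E' by blast
      then show "sum x E = real (r E)" using s[OF order_refl] p(3) b0 rE by simp
    qed
    then show "x \<in> rank_polytope E r \<and> (\<exists>V\<subseteq>E. E' \<subseteq> V \<and> e0 \<notin> V \<and> sum x V = real (r V))"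
      using E' sE' R by blast
  qed
qed

text \<open>
  A linear relation between indicator functions of base polytopes forces the same relation between
  the truth values of the statements that \<open>X\<close> is a flag of flats; summed over relabellings these give
  numbers of flags of a prescribed shape. The flag is peeled off from the top: the
  alternating sums above turn the relation for \<open>X (Suc m)\<close> into one for the restrictions to \<open>X m\<close> of
  those rank functions for which \<open>X m\<close> is a hyperplane.
\<close>

theorem flag_relation:
  fixes r :: "'j \<Rightarrow> 'a set \<Rightarrow> nat" and w :: "'j \<Rightarrow> real"
  assumes "finite J" "\<And>j. j \<in> J \<Longrightarrow> rank_function (X m) (r j)"
    and "\<And>i. i < m \<Longrightarrow> X i \<subset> X (Suc i)"
    and "\<And>x. (\<Sum>j\<in>J. w j * of_bool (x \<in> rank_polytope (X m) (r j))) = 0"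
  shows "(\<Sum>j | j \<in> J \<and> flag_of_flats (r j) X m. w j) = 0"
  using assms
proof (induction m arbitrary: J)
  case 0
  have "(\<lambda>_. 0) \<in> rank_polytope (X 0) (r j) \<longleftrightarrow> flag_of_flats (r j) X 0" for j
    unfolding rank_polytope_def flag_of_flats_def by auto
  then show ?case using 0(1) 0(4)[of "\<lambda>_. 0"] by (simp add: sum.inter_filter[symmetric] of_bool_def
        if_distrib[of "\<lambda>c. _ * c"] cong: if_cong)
next
  case (Suc m)
  let ?E = "X (Suc m)" and ?E' = "X m"
  have E': "?E' \<subset> ?E" using Suc.prems(3) by simp
  define J1 where "J1 = {j\<in>J. r j ?E = Suc m}"
  define J2 where "J2 = {j\<in>J1. r j ?E' = m \<and> (\<forall>b\<in>?E - ?E'. m < r j (insert b ?E'))}"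
  have fin1: "finite J1" "finite J2" using Suc.prems(1) unfolding J1_def J2_def by auto
  have rf: "rank_function ?E (r j)" if "j \<in> J1" for j using that Suc.prems(2) unfolding J1_def by blast
  have "(\<Sum>j\<in>J2. w j * of_bool (p \<in> rank_polytope ?E' (r j))) = 0" for p
  proof (cases "J1 = {} \<or> \<not> ((\<forall>e. e \<notin> ?E' \<longrightarrow> p e = 0) \<and> (\<forall>e\<in>?E'. 0 \<le> p e) \<and> sum p ?E' = real m)")
    case True
    then have "p \<notin> rank_polytope ?E' (r j)" if "j \<in> J2" for j
      using that rank_polytopeD[of p ?E' "r j"] unfolding J2_def by fastforce
    then show ?thesis by (simp add: sum.neutral)
  next
    case False
    then have p: "\<And>e. e \<notin> ?E' \<Longrightarrow> p e = 0" "\<And>e. e \<in> ?E' \<Longrightarrow> 0 \<le> p e" "sum p ?E' = real m"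
      and "J1 \<noteq> {}" by blast+
    then have finE: "finite ?E" using rf rank_functionD(1) by blast
    obtain e0 where e0: "e0 \<in> ?E - ?E'" using E' by blast
    define x where "x = (\<lambda>e. if e \<in> ?E - ?E' then 1 / real (card (?E - ?E')) else p e)"
    have b0: "real (card (?E - ?E')) > 0" using e0 finE by (auto simp: card_gt_0_iff)
    have x: "\<And>e. e \<notin> ?E \<Longrightarrow> x e = 0" "\<And>e. e \<in> ?E \<Longrightarrow> 0 \<le> x e" "x e0 > 0"
      using p E' e0 b0 unfolding x_def by auto
    have "sum x ?E = sum x ?E' + sum x (?E - ?E')"
      using finE E' by (metis add.commute psubset_imp_subset sum.subset_diff)
    also have "sum x ?E' = sum p ?E'" unfolding x_def by (intro sum.cong) auto
    also have "sum x (?E - ?E') = 1" using b0 unfolding x_def by simp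
    finally have sx: "sum x ?E = real (Suc m)" using p(3) by simp
    obtain \<delta> where \<delta>: "\<delta> > 0" and
      gap: "\<And>A t. A \<subseteq> ?E \<Longrightarrow> t \<le> card ?E \<Longrightarrow> sum x A \<noteq> real t \<Longrightarrow> \<delta> \<le> \<bar>sum x A - real t\<bar>"
      using integral_gap[OF finE] by blast
    define \<eta> where "\<eta> = min \<delta> (x e0) / (real (card ?E) + 1)"
    have \<eta>0: "0 < \<eta>" unfolding \<eta>_def using \<delta> x(3) by simp
    have "\<eta> * real (card ?E) < \<eta> * (real (card ?E) + 1)" using \<eta>0 by simp
    also have "\<dots> = min \<delta> (x e0)" unfolding \<eta>_def by simp
    finally have \<eta>: "\<eta> * real (card ?E) < \<delta>" "\<eta> * real (card ?E) \<le> x e0" by auto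
    \<comment> \<open>The alternating sum over the shifted points detects that \<open>?E'\<close> is a hyperplane and \<open>p\<close> is in the smaller polytope.\<close>
    have detect: "(\<Sum>T | {} \<subseteq> T \<and> T \<subseteq> ?E'. (- 1) ^ card T *
          (of_bool (shifted x \<eta> T e0 \<in> rank_polytope ?E (r j)) :: real)) =
        of_bool (j \<in> J2 \<and> p \<in> rank_polytope ?E' (r j))" if j: "j \<in> J1" for j
    proof -
      have rj: "r j ?E = Suc m" using j unfolding J1_def by blast
      have "e0 \<in> ?E" "e0 \<notin> ?E'" using e0 by blast+
      moreover have "sum x ?E = real (r j ?E)" using sx rj by simp
      ultimately have "(\<Sum>T | {} \<subseteq> T \<and> T \<subseteq> ?E'. (- 1) ^ card T *
          (of_bool (shifted x \<eta> T e0 \<in> rank_polytope ?E (r j)) :: real)) =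
        of_bool (x \<in> rank_polytope ?E (r j) \<and> (\<exists>V\<subseteq>?E. ?E' \<subseteq> V \<and> e0 \<notin> V \<and> sum x V = real (r j V)))"
        by (intro alternating_sum_shifted[OF rf[OF j] psubset_imp_subset[OF E'] _ _ gap \<eta>0 \<eta> x(1,2)])
      also have "x \<in> rank_polytope ?E (r j) \<and> (\<exists>V\<subseteq>?E. ?E' \<subseteq> V \<and> e0 \<notin> V \<and> sum x V = real (r j V)) \<longleftrightarrow>
          r j ?E' = m \<and> (\<forall>b\<in>?E - ?E'. m < r j (insert b ?E')) \<and> p \<in> rank_polytope ?E' (r j)"
        unfolding x_def by (rule uniform_extension_iff[OF rf[OF j] rj psubset_imp_subset[OF E'] e0 p])
      also have "\<dots> \<longleftrightarrow> j \<in> J2 \<and> p \<in> rank_polytope ?E' (r j)"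
        using j unfolding J2_def by simp
      finally show ?thesis .
    qed
    \<comment> \<open>Rank functions outside \<open>J1\<close> have another total rank, so none of these points lies in their polytopes.\<close>
    have zero: "(\<Sum>j\<in>J1. w j * of_bool (shifted x \<eta> T e0 \<in> rank_polytope ?E (r j))) = 0"
      if T: "T \<subseteq> ?E'" for T
    proof -
      have "e0 \<in> ?E" using e0 by blast
      moreover have "finite T" using T E' finE by (meson finite_subset psubset_imp_subset)
      moreover have "T \<inter> ?E = T" using T E' by blast
      ultimately have "sum (shifted x \<eta> T e0) ?E = real (Suc m)"
        using sum_shifted[OF finE, of T x \<eta> e0] sx by simp
      then have "shifted x \<eta> T e0 \<notin> rank_polytope ?E (r j)" if "j \<in> J - J1" for j
        using that rank_polytopeD(4)[of "shifted x \<eta> T e0" ?E "r j"] unfolding J1_def by auto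
      then have "(\<Sum>j\<in>J1. w j * of_bool (shifted x \<eta> T e0 \<in> rank_polytope ?E (r j))) =
          (\<Sum>j\<in>J. w j * of_bool (shifted x \<eta> T e0 \<in> rank_polytope ?E (r j)))"
        using Suc.prems(1) by (intro sum.mono_neutral_left) (auto simp: J1_def)
      then show ?thesis using Suc.prems(4) by simp
    qed
    have "(\<Sum>j\<in>J2. w j * of_bool (p \<in> rank_polytope ?E' (r j))) =
        (\<Sum>j\<in>J1. w j * of_bool (j \<in> J2 \<and> p \<in> rank_polytope ?E' (r j)))"
      using fin1 by (intro sum.mono_neutral_cong_left) (auto simp: J2_def)
    also have "\<dots> = (\<Sum>j\<in>J1. w j * (\<Sum>T | {} \<subseteq> T \<and> T \<subseteq> ?E'. (- 1) ^ card T *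
          of_bool (shifted x \<eta> T e0 \<in> rank_polytope ?E (r j))))"
      using detect by (intro sum.cong) auto
    also have "\<dots> = (\<Sum>T | {} \<subseteq> T \<and> T \<subseteq> ?E'. (- 1) ^ card T *
          (\<Sum>j\<in>J1. w j * of_bool (shifted x \<eta> T e0 \<in> rank_polytope ?E (r j))))"
      unfolding sum_distrib_left by (subst sum.swap) (intro sum.cong refl, simp only: mult.left_commute)
    also have "\<dots> = 0" using zero by (intro sum.neutral) auto
    finally show ?thesis .
  qed
  moreover have "rank_function ?E' (r j)" if "j \<in> J2" for j
    using that rank_function_subset[OF rf psubset_imp_subset[OF E']] unfolding J2_def by blast
  ultimately have "(\<Sum>j | j \<in> J2 \<and> flag_of_flats (r j) X m. w j) = 0"
    using fin1(2) Suc.prems(3) by (intro Suc.IH) auto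
  moreover have "{j. j \<in> J2 \<and> flag_of_flats (r j) X m} = {j. j \<in> J \<and> flag_of_flats (r j) X (Suc m)}"
    unfolding J2_def J1_def flag_of_flats_def by (auto simp: le_Suc_eq less_Suc_eq)
  ultimately show ?case by simp
qed

section \<open>Linear independence of nested matroids\<close>

text \<open>
  Every set \<open>B\<close> encodes the lattice path that rises at the steps in \<open>B\<close>; the rank of the prefix
  \<open>{1..m}\<close> is the height of the path after \<open>m\<close> steps. These are the Schubert matroids.
\<close>

definition path_matroid :: "nat \<Rightarrow> nat set \<Rightarrow> nat matroid" where
  "path_matroid n B = chain_matroid {1..n} ((\<lambda>m. {1..m}) ` {..n}) (\<lambda>X. card (B \<inter> X))"

lemma rank_chain_prefixes: "rank_chain {1..n::nat} ((\<lambda>m. {1..m}) ` {..n}) (\<lambda>X. card (B \<inter> X))"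
proof -
  have cmp: "{1..m} \<subseteq> {1..m'} \<or> {1..m'} \<subseteq> {1..m}" for m m' :: nat by (cases "m \<le> m'") auto
  have "chain\<^sub>\<subseteq> ((\<lambda>m. {1..m}) ` {..n})"
    unfolding chain_subset_def ball_simps by (intro ballI cmp)
  moreover have "{} \<in> (\<lambda>m. {1..m}) ` {..n}" by (rule image_eqI[of _ _ 0]) auto
  ultimately show ?thesis unfolding rank_chain_def by auto
qed

lemma ground_path_matroid [simp]: "ground (path_matroid n B) = {1..n}"
  by (simp add: path_matroid_def)

lemma matroid_path_matroid: "matroid (path_matroid n B)"
  unfolding path_matroid_def by (rule matroid_chain_matroid[OF rank_chain_prefixes])

lemma nested_path_matroid: "nested (path_matroid n B)"
  unfolding path_matroid_def by (rule nested_chain_matroid[OF rank_chain_prefixes])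

lemma rank_function_path_matroid: "rank_function {1..n} (rank_in (path_matroid n B))"
  using rank_function_rank_in[OF matroid_path_matroid] by simp

text \<open>
  The left-hand side is the rank of the prefix with as many elements as \<open>F\<close>, so prefixes have the
  least rank among the sets of their size.
\<close>

lemma rank_path_matroid_ge:
  assumes "F \<subseteq> {1..n}" "finite B"
  shows "card (B \<inter> {1..card F}) \<le> rank_in (path_matroid n B) F"
proof -
  obtain m where m: "m \<le> n" "rank_in (path_matroid n B) F = card (B \<inter> {1..m}) + card (F - {1..m})"
    using rank_chain_matroid_attained[OF rank_chain_prefixes assms(1)] unfolding path_matroid_def by blast
  have "finite F" using assms(1) finite_subset by blast
  have "card F - m \<le> card (F - {1..m})" using diff_card_le_card_Diff[of "{1..m}" F] by simp
  moreover have "card (B \<inter> {1..card F}) \<le> card (B \<inter> {1..m}) + (card F - m)"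
  proof -
    have "card (B \<inter> {1..card F}) \<le> card ((B \<inter> {1..m}) \<union> {m<..card F})"
      using assms(2) by (intro card_mono) auto
    also have "\<dots> \<le> card (B \<inter> {1..m}) + card {m<..card F}" by (rule card_Un_le)
    finally show ?thesis by simp
  qed
  ultimately show ?thesis using m(2) by linarith
qed

lemma rank_path_matroid_prefix:
  assumes "m \<le> n" "finite B"
  shows "rank_in (path_matroid n B) {1..m} = card (B \<inter> {1..m})"
proof (rule antisym)
  have "{1..m} \<in> (\<lambda>m. {1..m}) ` {..n}" using assms(1) by (intro imageI) simp
  then show "rank_in (path_matroid n B) {1..m} \<le> card (B \<inter> {1..m})"
    using rank_chain_matroid_le[OF rank_chain_prefixes, of "{1..m}" n "{1..m}" B] assms(1)
    unfolding path_matroid_def by simp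
  show "card (B \<inter> {1..m}) \<le> rank_in (path_matroid n B) {1..m}"
    using rank_path_matroid_ge[of "{1..m}" n B] assms by simp
qed

lemma path_matroid_in_matroids_on:
  assumes "B \<subseteq> {1..n}" "card B = R"
  shows "path_matroid n B \<in> matroids_on R n"
proof -
  have "finite B" using assms(1) finite_subset by blast
  then have "matroid_rank (path_matroid n B) = card (B \<inter> {1..n})"
    unfolding matroid_rank_def using rank_path_matroid_prefix[of n n B] by simp
  then show ?thesis
    using assms matroid_path_matroid unfolding matroids_on_def by (simp add: Int_absorb2)
qed

lemma rank_function_permute:
  assumes rf: "rank_function E r" and p: "\<pi> permutes E"
  shows "rank_function E (\<lambda>A. r (\<pi> ` A))"
proof -
  have inj: "inj \<pi>" using permutes_inj[OF p] .
  have sub: "\<pi> ` A \<subseteq> E" if "A \<subseteq> E" for A using permutes_image[OF p] that by blast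
  show ?thesis
    unfolding rank_function_def
  proof (intro conjI allI impI)
    show "finite E" using rank_functionD(1)[OF rf] .
    fix A show "A \<subseteq> E \<Longrightarrow> r (\<pi> ` A) \<le> card A"
      using rank_functionD(2)[OF rf sub] card_image[OF inj_on_subset[OF inj subset_UNIV]] by metis
    fix B show "A \<subseteq> B \<and> B \<subseteq> E \<Longrightarrow> r (\<pi> ` A) \<le> r (\<pi> ` B)"
      using rank_functionD(3)[OF rf] sub by (simp add: image_mono)
    show "A \<subseteq> E \<and> B \<subseteq> E \<Longrightarrow> r (\<pi> ` (A \<union> B)) + r (\<pi> ` (A \<inter> B)) \<le> r (\<pi> ` A) + r (\<pi> ` B)"
      using rank_functionD(4)[OF rf sub sub] image_Int[OF inj] by (simp add: image_Un)
  qed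
qed

text \<open>
  The steps at which the lattice path of \<open>D\<close> rises cut \<open>{1..n}\<close> into a flag of flats of the path
  matroid of \<open>D\<close>. A path matroid has a flag of this shape only if its path stays below that of \<open>D\<close>,
  because a prefix has the least rank among all sets of its size.
\<close>

lemma path_flag:
  assumes D: "D \<subseteq> {1..n}" "card D = R"
  obtains X where "X R = {1..n}" "\<And>i. i < R \<Longrightarrow> X i \<subset> X (Suc i)"
    "flag_of_flats (rank_in (path_matroid n D)) X R"
    "\<And>B \<pi> m. finite B \<Longrightarrow> \<pi> permutes {1..n} \<Longrightarrow>
       flag_of_flats (\<lambda>A. rank_in (path_matroid n B) (\<pi> ` A)) X R \<Longrightarrow> m \<le> n \<Longrightarrow>
       card (B \<inter> {1..m}) \<le> card (D \<inter> {1..m})"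
proof -
  have finD: "finite D" using D(1) finite_subset by blast
  define f where "f e = card (D \<inter> {1..e})" for e
  have f_mono: "f e \<le> f e'" if "e \<le> e'" for e e'
    unfolding f_def using that finD by (intro card_mono) auto
  have fn: "f n = R" unfolding f_def using D by (simp add: Int_absorb2)
  have f_Suc: "f (Suc e) \<le> Suc (f e)" for e
  proof -
    have "D \<inter> {1..Suc e} \<subseteq> insert (Suc e) (D \<inter> {1..e})" by auto
    then have "f (Suc e) \<le> card (insert (Suc e) (D \<inter> {1..e}))"
      unfolding f_def using finD by (intro card_mono) auto
    also have "\<dots> \<le> Suc (f e)" unfolding f_def by (simp add: card_insert_le_m1 card_insert_if finD)
    finally show ?thesis .
  qed
  \<comment> \<open>The height of the path increases by at most one per step, so it takes every value up to \<open>R\<close>.\<close>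
  have hit: "\<exists>e\<le>n. f e = i" if i: "i \<le> R" for i
  proof -
    define e where "e = (LEAST e. i \<le> f e)"
    have ex: "i \<le> f n" using i fn by simp
    then have e: "i \<le> f e" "e \<le> n" unfolding e_def by (rule LeastI, rule Least_le)
    have "f e \<le> i"
    proof (cases e)
      case 0
      then show ?thesis unfolding f_def by simp
    next
      case (Suc e')
      then have "\<not> i \<le> f e'" using not_less_Least[of e' "\<lambda>e. i \<le> f e"] unfolding e_def by simp
      then show ?thesis using f_Suc[of e'] Suc by simp
    qed
    then show ?thesis using e by (intro exI[of _ e]) simp
  qed
  \<comment> \<open>The last step at which the path has height \<open>i\<close>; the next step is a rise.\<close>
  define g where "g i = Max {e. e \<le> n \<and> f e \<le> i}" for i
  have ming: "finite {e. e \<le> n \<and> f e \<le> i}" "{e. e \<le> n \<and> f e \<le> i} \<noteq> {}" for i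
    by (auto intro: exI[of _ 0] simp: f_def)
  have g_in: "g i \<le> n" "f (g i) \<le> i" for i using Max_in[OF ming] unfolding g_def by blast+
  have g_ge: "e \<le> g i" if "e \<le> n" "f e \<le> i" for e i
    unfolding g_def using that by (intro Max_ge ming) auto
  have fg: "f (g i) = i" if "i \<le> R" for i
    using hit[OF that] g_ge f_mono g_in(2)[of i] by (metis antisym order_refl)
  define X where "X i = {1..g i}" for i
  have gR: "g R = n" using g_ge[of n R] g_in(1)[of R] fn by simp
  have g_less: "g i < g (Suc i)" if "i < R" for i
  proof (rule ccontr)
    assume "\<not> g i < g (Suc i)"
    then have "f (g (Suc i)) \<le> f (g i)" by (intro f_mono) simp
    then show False using fg[of i] fg[of "Suc i"] that by simp
  qed
  show thesis
  proof (rule that[of X])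
    show "X R = {1..n}" unfolding X_def gR ..
    show "X i \<subset> X (Suc i)" if "i < R" for i
    proof -
      have "g (Suc i) \<in> X (Suc i) - X i" using g_less[OF that] unfolding X_def by simp
      then show ?thesis using g_less[OF that] unfolding X_def by auto
    qed
    show "flag_of_flats (rank_in (path_matroid n D)) X R"
      unfolding flag_of_flats_def
    proof (intro conjI allI impI ballI)
      fix i assume "i \<le> R"
      then show "rank_in (path_matroid n D) (X i) = i"
        using rank_path_matroid_prefix[OF g_in(1) finD] fg unfolding X_def f_def by simp
    next
      fix i b assume i: "i < R" and b: "b \<in> X (Suc i) - X i"
      let ?I = "insert b (D \<inter> X i)"
      have b': "g i < b" "b \<le> n" "1 \<le> b" using b g_in(1)[of "Suc i"] unfolding X_def by auto
      have "indep (path_matroid n D) ?I"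
        unfolding path_matroid_def indep_chain_matroid
      proof (intro conjI ballI)
        show "?I \<subseteq> {1..n}" using D b' by auto
        fix Y assume "Y \<in> (\<lambda>m. {1..m}) ` {..n}"
        then obtain m where m: "Y = {1..m}" "m \<le> n" by blast
        show "card (?I \<inter> Y) \<le> card (D \<inter> Y)"
        proof (cases "b \<le> m")
          case True
          then have "\<not> f m \<le> i" using g_ge[of m i] m(2) b' by auto
          moreover have "card (?I \<inter> Y) \<le> card ?I" using finD by (intro card_mono) auto
          moreover have "card ?I \<le> Suc (card (D \<inter> X i))" using finD by (simp add: card_insert_if)
          moreover have "card (D \<inter> X i) = i" using fg[of i] i unfolding f_def X_def by simp
          ultimately show ?thesis unfolding m(1) f_def by linarith
        next
          case False
          then have "?I \<inter> Y \<subseteq> D \<inter> Y" unfolding m(1) by auto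
          then show ?thesis using finD by (intro card_mono) auto
        qed
      qed
      moreover have "card ?I = Suc i"
        using fg[of i] i finD b unfolding f_def X_def by simp
      moreover have "?I \<subseteq> insert b (X i)" by blast
      ultimately show "i < rank_in (path_matroid n D) (insert b (X i))"
        using indep_card_le_rank[OF matroid_path_matroid] by (metis Suc_le_eq)
    qed
    fix B \<pi> m
    assume B: "finite B" and p: "\<pi> permutes {1..n}" and m: "m \<le> n"
      and fl: "flag_of_flats (\<lambda>A. rank_in (path_matroid n B) (\<pi> ` A)) X R"
    define i where "i = f m"
    have iR: "i \<le> R" using f_mono[OF m] fn unfolding i_def by simp
    have "m \<le> g i" using g_ge[OF m] unfolding i_def by simp
    then have "card (B \<inter> {1..m}) \<le> card (B \<inter> {1..g i})" using B by (intro card_mono) auto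
    also have "g i = card (\<pi> ` X i)"
      using permutes_inj_on[OF p, of "X i"] unfolding X_def by (simp add: card_image)
    also have "\<pi> ` X i \<subseteq> {1..n}"
      using permutes_image[OF p] g_in(1)[of i] unfolding X_def by (metis atLeastatMost_subset_iff image_mono order_refl)
    then have "card (B \<inter> {1..card (\<pi> ` X i)}) \<le> rank_in (path_matroid n B) (\<pi> ` X i)"
      by (rule rank_path_matroid_ge[OF _ B])
    also have "\<dots> = i" using fl iR unfolding flag_of_flats_def by blast
    finally show "card (B \<inter> {1..m}) \<le> card (D \<inter> {1..m})" unfolding i_def f_def .
  qed
qed

text \<open>
  The relation between flags is applied to all relabelled copies of the matroids at once, since a
  linear relation between counting functions is one between the indicators of these copies.
\<close>

lemma sum_sym_count_relation:
  fixes r :: "'j \<Rightarrow> nat set \<Rightarrow> nat" and w :: "'j \<Rightarrow> real"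
  assumes J: "finite J" and rf: "\<And>j. j \<in> J \<Longrightarrow> rank_function {1..n} (r j)"
    and X: "X m = {1..n}" "\<And>i. i < m \<Longrightarrow> X i \<subset> X (Suc i)"
    and zero: "\<And>x. (\<Sum>j\<in>J. w j * real (sym_count n (r j) x)) = 0"
  shows "(\<Sum>j\<in>J. w j * real (card {\<sigma>. \<sigma> permutes {1..n} \<and> flag_of_flats (\<lambda>A. r j (inv \<sigma> ` A)) X m})) = 0"
proof -
  let ?P = "{\<sigma>. \<sigma> permutes {1..n}}"
  have fin: "finite ?P" by (simp add: finite_permutations)
  have "(\<Sum>k | k \<in> J \<times> ?P \<and> flag_of_flats ((\<lambda>(j, \<sigma>) A. r j (inv \<sigma> ` A)) k) X m. w (fst k)) = 0"
  proof (rule flag_relation)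
    show "finite (J \<times> ?P)" using J fin by simp
    show "rank_function (X m) ((\<lambda>(j, \<sigma>) A. r j (inv \<sigma> ` A)) k)" if "k \<in> J \<times> ?P" for k
      using that rank_function_permute[OF rf permutes_inv] X(1) by (auto split: prod.splits)
    fix x
    have "(\<Sum>k\<in>J \<times> ?P. w (fst k) * of_bool (x \<in> rank_polytope (X m) ((\<lambda>(j, \<sigma>) A. r j (inv \<sigma> ` A)) k))) =
        (\<Sum>j\<in>J. \<Sum>\<sigma>\<in>?P. w j * of_bool (x \<in> rank_polytope {1..n} (\<lambda>A. r j (inv \<sigma> ` A))))"
      unfolding X(1) sum.cartesian_product by (intro sum.cong) auto
    also have "\<dots> = (\<Sum>j\<in>J. w j * real (sym_count n (r j) x))"
      unfolding sym_count_eq_sum sum_distrib_left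
      using rank_polytope_permute[of _ "{1..n}" x] by (intro sum.cong) auto
    finally show "(\<Sum>k\<in>J \<times> ?P. w (fst k) * of_bool (x \<in> rank_polytope (X m) ((\<lambda>(j, \<sigma>) A. r j (inv \<sigma> ` A)) k))) = 0"
      using zero by simp
  qed (use X(2) in auto)
  moreover have "{k. k \<in> J \<times> ?P \<and> flag_of_flats ((\<lambda>(j, \<sigma>) A. r j (inv \<sigma> ` A)) k) X m} =
      (SIGMA j:J. {\<sigma>. \<sigma> permutes {1..n} \<and> flag_of_flats (\<lambda>A. r j (inv \<sigma> ` A)) X m})" by auto
  moreover have "(\<Sum>k\<in>(SIGMA j:J. {\<sigma>. \<sigma> permutes {1..n} \<and> flag_of_flats (\<lambda>A. r j (inv \<sigma> ` A)) X m}). w (fst k)) =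
      (\<Sum>j\<in>J. \<Sum>\<sigma> | \<sigma> permutes {1..n} \<and> flag_of_flats (\<lambda>A. r j (inv \<sigma> ` A)) X m. w j)"
    using J fin by (subst sum.Sigma) (auto intro!: sum.cong)
  ultimately show ?thesis by (simp add: mult.commute)
qed

text \<open>
  Among the paths with nonzero coefficient choose one, \<open>D\<close>, with the least area below it, and count
  flags of the shape that belongs to \<open>D\<close>. Only paths weakly below \<open>D\<close> have such flags, so the
  resulting relation reduces to the coefficient of \<open>D\<close> times a positive number.
\<close>

lemma path_matroids_independent:
  assumes zero: "\<And>x. (\<Sum>B | B \<subseteq> {1..n} \<and> card B = R. c B * real (sym_count n (rank_in (path_matroid n B)) x)) = 0"
    and B: "B \<subseteq> {1..n}" "card B = R"
  shows "c B = 0"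
proof (rule ccontr)
  assume "c B \<noteq> 0"
  let ?\<B> = "{B. B \<subseteq> {1..n} \<and> card B = R}"
  define area where "area B = (\<Sum>m\<le>n. card (B \<inter> {1..m}))" for B
  obtain D where D: "D \<in> ?\<B>" "c D \<noteq> 0" and min: "\<And>B. B \<in> ?\<B> \<Longrightarrow> c B \<noteq> 0 \<Longrightarrow> area D \<le> area B"
    using ex_has_least_nat[of "\<lambda>B. B \<in> ?\<B> \<and> c B \<noteq> 0" B area] B \<open>c B \<noteq> 0\<close> by auto
  have fin: "finite ?\<B>" by simp
  obtain X where X: "X R = {1..n}" "\<And>i. i < R \<Longrightarrow> X i \<subset> X (Suc i)"
    and flag: "flag_of_flats (rank_in (path_matroid n D)) X R"
    and below: "\<And>B \<pi> m. finite B \<Longrightarrow> \<pi> permutes {1..n} \<Longrightarrow>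
       flag_of_flats (\<lambda>A. rank_in (path_matroid n B) (\<pi> ` A)) X R \<Longrightarrow> m \<le> n \<Longrightarrow>
       card (B \<inter> {1..m}) \<le> card (D \<inter> {1..m})"
    using path_flag[of D n R] D(1) by auto
  let ?F = "\<lambda>B. {\<sigma>. \<sigma> permutes {1..n} \<and> flag_of_flats (\<lambda>A. rank_in (path_matroid n B) (inv \<sigma> ` A)) X R}"
  have "(\<Sum>B\<in>?\<B>. c B * real (card (?F B))) = 0"
    using sum_sym_count_relation[OF fin rank_function_path_matroid X, of c] zero by simp
  moreover have "c B * real (card (?F B)) = 0" if B: "B \<in> ?\<B> - {D}" for B
  proof (rule ccontr)
    assume nz: "c B * real (card (?F B)) \<noteq> 0"
    then have "?F B \<noteq> {}" by (metis card.empty mult_zero_right of_nat_0)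
    then obtain \<sigma> where \<sigma>: "inv \<sigma> permutes {1..n}"
      "flag_of_flats (\<lambda>A. rank_in (path_matroid n B) (inv \<sigma> ` A)) X R"
      using permutes_inv by blast
    have finB: "finite B" using B finite_subset[of B "{1..n}"] by blast
    have le: "card (B \<inter> {1..m}) \<le> card (D \<inter> {1..m})" if "m \<le> n" for m
      using below[OF finB \<sigma> that] .
    have "area D \<le> area B" using min B nz by auto
    moreover have "area B \<le> area D" unfolding area_def using le by (intro sum_mono) simp
    ultimately have "(\<Sum>m\<le>n. card (B \<inter> {1..m})) = (\<Sum>m\<le>n. card (D \<inter> {1..m}))"
      unfolding area_def by (rule antisym[rotated])
    then have eq: "card (B \<inter> {1..m}) = card (D \<inter> {1..m})" if "m \<le> n" for m
      by (rule sum_mono_inv) (use le that in auto)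
    have "e \<in> B \<longleftrightarrow> e \<in> D" if e: "e \<in> {1..n}" for e
    proof -
      have split: "card (Y \<inter> {1..e}) = card (Y \<inter> {1..e - 1}) + (if e \<in> Y then 1 else 0)" for Y
      proof -
        have "{1..e} = insert e {1..e - 1}" using e by auto
        moreover have "e \<notin> {1..e - 1}" using e by auto
        ultimately show ?thesis by (simp add: Int_insert_right)
      qed
      have "e \<le> n" "e - 1 \<le> n" using e by auto
      then have "(if e \<in> B then 1 else 0) = (if e \<in> D then 1 else (0::nat))"
        using split[of B] split[of D] eq[of e] eq[of "e - 1"] by linarith
      then show ?thesis by (simp split: if_splits)
    qed
    then have "B = D" using B D(1) by blast
    then show False using B by blast
  qed
  ultimately have "c D * real (card (?F D)) = 0"
    using sum.remove[OF fin D(1), of "\<lambda>B. c B * real (card (?F B))"] by (simp add: sum.neutral)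
  then have c0: "card (?F D) = 0" using D(2) by simp
  have fin': "finite (?F D)" by (simp add: finite_permutations)
  have "id \<in> ?F D" using flag by (simp add: permutes_id inv_id image_ident)
  then show False using c0 card_0_eq[OF fin'] by blast
qed


section \<open>Coordinates with respect to nested matroids\<close>

text \<open>
  Each path matroid is isomorphic to a listed matroid, and independence makes this assignment
  injective. There are as many paths as entries in the list, so up to isomorphism the path matroids
  are all nested matroids.
\<close>

lemma nested_enumeration_by_paths:
  assumes N: "nested_enumeration R n N"
  obtains \<iota> where "bij_betw \<iota> {B. B \<subseteq> {1..n} \<and> card B = R} {1..n choose R}"
    "\<And>B x. B \<subseteq> {1..n} \<Longrightarrow> card B = R \<Longrightarrow>
      sym_matroid_indicator (N (\<iota> B)) x = real (sym_count n (rank_in (path_matroid n B)) x) / fact n"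
proof -
  let ?\<B> = "{B. B \<subseteq> {1..n} \<and> card B = R}"
  have "\<exists>i. i \<in> {1..n choose R} \<and> isomorphic (path_matroid n B) (N i)" if "B \<in> ?\<B>" for B
    using N path_matroid_in_matroids_on[of B n R] nested_path_matroid that
    unfolding nested_enumeration_def by blast
  then have "\<forall>B\<in>?\<B>. \<exists>i. i \<in> {1..n choose R} \<and> isomorphic (path_matroid n B) (N i)" by blast
  from bchoice[OF this] obtain \<iota> where \<iota>: "\<And>B. B \<in> ?\<B> \<Longrightarrow> \<iota> B \<in> {1..n choose R}"
      "\<And>B. B \<in> ?\<B> \<Longrightarrow> isomorphic (path_matroid n B) (N (\<iota> B))"
    by blast
  have ind: "sym_matroid_indicator (N (\<iota> B)) x = real (sym_count n (rank_in (path_matroid n B)) x) / fact n"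
    if B: "B \<in> ?\<B>" for B x
  proof -
    have "matroid (N (\<iota> B))"
      using N \<iota>(1)[OF B] unfolding nested_enumeration_def matroids_on_def by blast
    from sym_matroid_indicator_isomorphic[OF matroid_path_matroid this \<iota>(2)[OF B]] show ?thesis
      using sym_matroid_indicator_eq[OF matroid_path_matroid matroid_path_matroid ground_path_matroid isomorphic_refl]
      by metis
  qed
  have fin: "finite ?\<B>" by simp
  have inj: "inj_on \<iota> ?\<B>"
  proof (rule inj_onI, rule ccontr)
    fix B B' assume B: "B \<in> ?\<B>" "B' \<in> ?\<B>" "\<iota> B = \<iota> B'" "B \<noteq> B'"
    define c where "c D = (if D = B then 1 else 0) - (if D = B' then 1 else (0::real))" for D
    have eq: "sym_count n (rank_in (path_matroid n B)) x = sym_count n (rank_in (path_matroid n B')) x" for x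
      using ind[OF B(1), of x] ind[OF B(2), of x] B(3) by simp
    have "(\<Sum>D\<in>?\<B>. c D * real (sym_count n (rank_in (path_matroid n D)) x)) = 0" for x
    proof -
      have "(\<Sum>D\<in>?\<B>. c D * real (sym_count n (rank_in (path_matroid n D)) x)) =
          (\<Sum>D\<in>?\<B>. if D = B then real (sym_count n (rank_in (path_matroid n D)) x) else 0) -
          (\<Sum>D\<in>?\<B>. if D = B' then real (sym_count n (rank_in (path_matroid n D)) x) else 0)"
        unfolding sum_subtractf[symmetric] c_def by (intro sum.cong) auto
      then show ?thesis using fin B(1,2) eq[of x] by (simp add: sum.delta)
    qed
    from path_matroids_independent[OF this, of B] show False using B unfolding c_def by simp
  qed
  have "card ?\<B> = n choose R" using n_subsets[of "{1..n}" R] by simp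
  then have "\<iota> ` ?\<B> = {1..n choose R}"
    using \<iota>(1) card_image[OF inj] by (intro card_subset_eq) auto
  then have "bij_betw \<iota> ?\<B> {1..n choose R}" using inj unfolding bij_betw_def by blast
  then show thesis using that ind by blast
qed

lemma nested_expansion_unique:
  assumes N: "nested_enumeration R n N"
    and eq: "\<And>x. (\<Sum>i = 1..n choose R. a i * sym_matroid_indicator (N i) x) =
      (\<Sum>i = 1..n choose R. b i * sym_matroid_indicator (N i) x)"
    and i: "i \<in> {1..n choose R}"
  shows "a i = b i"
proof -
  let ?\<B> = "{B. B \<subseteq> {1..n} \<and> card B = R}"
  obtain \<iota> where \<iota>: "bij_betw \<iota> ?\<B> {1..n choose R}"
    "\<And>B x. B \<subseteq> {1..n} \<Longrightarrow> card B = R \<Longrightarrow>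
      sym_matroid_indicator (N (\<iota> B)) x = real (sym_count n (rank_in (path_matroid n B)) x) / fact n"
    using nested_enumeration_by_paths[OF N] by blast
  define c where "c B = a (\<iota> B) - b (\<iota> B)" for B
  have "(\<Sum>B\<in>?\<B>. c B * real (sym_count n (rank_in (path_matroid n B)) x)) = 0" for x
  proof -
    have "(\<Sum>B\<in>?\<B>. c B * real (sym_count n (rank_in (path_matroid n B)) x)) =
        (\<Sum>B\<in>?\<B>. fact n * ((a (\<iota> B) - b (\<iota> B)) * sym_matroid_indicator (N (\<iota> B)) x))"
      unfolding c_def using \<iota>(2) by (intro sum.cong) auto
    also have "\<dots> = (\<Sum>i = 1..n choose R. fact n * ((a i - b i) * sym_matroid_indicator (N i) x))"
      using sum.reindex_bij_betw[OF \<iota>(1), of "\<lambda>i. fact n * ((a i - b i) * sym_matroid_indicator (N i) x)"] .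
    also have "\<dots> = 0"
      using eq[of x] by (simp add: sum_distrib_left[symmetric] left_diff_distrib sum_subtractf)
    finally show ?thesis .
  qed
  from path_matroids_independent[OF this] have "c B = 0" if "B \<in> ?\<B>" for B using that by blast
  moreover obtain B where "B \<in> ?\<B>" "i = \<iota> B" using \<iota>(1) i unfolding bij_betw_def by blast
  ultimately show ?thesis unfolding c_def by force
qed

lemma nested_vector_expansion:
  assumes N: "nested_enumeration R n N" and K: "K \<in> matroids_on R n"
  shows "sym_matroid_indicator K = (\<lambda>x. \<Sum>i = 1..n choose R. nested_vector N K i * sym_matroid_indicator (N i) x)"
proof -
  let ?P = "\<lambda>a. (\<forall>i. a i \<in> \<int>) \<and> (\<forall>i. i \<notin> {1..n choose R} \<longrightarrow> a i = 0) \<and>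
    sym_matroid_indicator K = (\<lambda>x. \<Sum>i = 1..n choose R. a i * sym_matroid_indicator (N i) x)"
  have v: "nested_vector N K = (THE a. ?P a)"
    using K unfolding nested_vector_def matroids_on_def Let_def by simp
  have "\<exists>!a. ?P a"
  proof (rule ex_ex1I)
    show "\<exists>a. ?P a" using nested_expansion_exists[OF N K] .
    fix a b assume a: "?P a" and b: "?P b"
    then have "(\<Sum>i = 1..n choose R. a i * sym_matroid_indicator (N i) x) =
        (\<Sum>i = 1..n choose R. b i * sym_matroid_indicator (N i) x)" for x by metis
    from nested_expansion_unique[OF N this] have "a i = b i" for i
      using a b by (cases "i \<in> {1..n choose R}") simp_all
    then show "a = b" by blast
  qed
  from theI'[OF this] show ?thesis unfolding v by blast
qed

lemma nested_vector_cong: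
  assumes "card (ground M) = card (ground M')" "matroid_rank M = matroid_rank M'"
    and "sym_matroid_indicator M = sym_matroid_indicator M'"
  shows "nested_vector N M = nested_vector N M'"
  unfolding nested_vector_def assms ..

lemma finite_matroids_on: "finite (matroids_on R n)"
proof -
  have "matroids_on R n \<subseteq> (\<lambda>\<I>. \<lparr>ground = {1..n}, indep = (\<lambda>I. I \<in> \<I>)\<rparr>) ` Pow (Pow {1..n})"
  proof
    fix M assume M: "M \<in> matroids_on R n"
    then have "Collect (indep M) \<subseteq> Pow {1..n}"
      using matroidD(2)[of M] unfolding matroids_on_def by auto
    moreover have "M = \<lparr>ground = {1..n}, indep = (\<lambda>I. I \<in> Collect (indep M))\<rparr>"
      using M unfolding matroids_on_def by (cases M) simp
    ultimately show "M \<in> (\<lambda>\<I>. \<lparr>ground = {1..n}, indep = (\<lambda>I. I \<in> \<I>)\<rparr>) ` Pow (Pow {1..n})"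
      by blast
  qed
  then show ?thesis by (rule finite_subset) simp
qed

lemma extreme_point_of_hull_insert:
  fixes v :: "'v::real_vector"
  assumes "finite S" "v \<notin> convex hull S"
  shows "v extreme_point_of (convex hull (insert v S))"
proof (cases "S = {}")
  case False
  show ?thesis
    unfolding extreme_point_of_def
  proof (intro conjI ballI notI)
    show "v \<in> convex hull (insert v S)" by (rule hull_inc) simp
    fix a b assume ab: "a \<in> convex hull (insert v S)" "b \<in> convex hull (insert v S)"
      and seg: "v \<in> open_segment a b"
    obtain s a' where a: "0 \<le> s" "s \<le> 1" "a' \<in> convex hull S" "a = (1 - s) *\<^sub>R v + s *\<^sub>R a'"
      using ab(1) False unfolding convex_hull_insert_alt by auto
    obtain t b' where b: "0 \<le> t" "t \<le> 1" "b' \<in> convex hull S" "b = (1 - t) *\<^sub>R v + t *\<^sub>R b'"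
      using ab(2) False unfolding convex_hull_insert_alt by auto
    obtain u where u: "0 < u" "u < 1" "v = (1 - u) *\<^sub>R a + u *\<^sub>R b" and "a \<noteq> b"
      using seg unfolding in_segment by blast
    define c where "c = (1 - u) * s + u * t"
    have eq: "c *\<^sub>R v = ((1 - u) * s) *\<^sub>R a' + (u * t) *\<^sub>R b'"
      using u(3) unfolding a(4) b(4) c_def by (simp add: algebra_simps)
    have c0: "c > 0"
    proof (rule ccontr)
      assume "\<not> c > 0"
      moreover have "0 \<le> (1 - u) * s" "0 \<le> u * t" using u a b by auto
      ultimately have "(1 - u) * s = 0" "u * t = 0" unfolding c_def by linarith+
      then have "s = 0" "t = 0" using u by auto
      then show False using \<open>a \<noteq> b\<close> a b by simp
    qed
    have "v = ((1 - u) * s / c) *\<^sub>R a' + (u * t / c) *\<^sub>R b'"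
    proof -
      have "v = inverse c *\<^sub>R (c *\<^sub>R v)" using c0 by simp
      then show ?thesis unfolding eq by (simp add: scaleR_add_right divide_inverse mult.commute)
    qed
    also have "\<dots> \<in> convex hull S"
    proof (rule convexD[OF convex_convex_hull a(3) b(3)])
      show "(1 - u) * s / c + u * t / c = 1"
        unfolding add_divide_distrib[symmetric] c_def[symmetric] using c0 by simp
    qed (use u a b c0 in auto)
    finally show False using assms(2) by blast
  qed
qed simp

text \<open>
  The coordinates determine the symmetrized indicator function linearly and are determined by it, so
  a convex combination of coordinate vectors is the same thing as one of counting functions.
\<close>

lemma extremal_if_indicator_extreme:
  fixes M :: "'a matroid"
  defines "R \<equiv> matroid_rank M" and "n \<equiv> card (ground M)"
  assumes M: "matroid M" and N: "nested_enumeration R n N"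
    and K: "K \<in> matroids_on R n" "isomorphic M K"
    and rigid: "\<And>(J :: (nat \<Rightarrow> real) set) w K' j x. finite J \<Longrightarrow>
      (\<And>j. j \<in> J \<Longrightarrow> K' j \<in> matroids_on R n) \<Longrightarrow> (\<And>j. j \<in> J \<Longrightarrow> w j > 0) \<Longrightarrow> sum w J = 1 \<Longrightarrow>
      (\<And>x. real (sym_count n (rank_in K) x) = (\<Sum>j\<in>J. w j * real (sym_count n (rank_in (K' j)) x))) \<Longrightarrow>
      j \<in> J \<Longrightarrow> sym_count n (rank_in (K' j)) x = sym_count n (rank_in K) x"
  shows "extremal N M"
proof -
  have Kd: "matroid K" "ground K = {1..n}" "matroid_rank K = R"
    using K(1) unfolding matroids_on_def by auto
  have ind: "sym_matroid_indicator K' = (\<lambda>x. real (sym_count n (rank_in K') x) / fact n)"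
    if "K' \<in> matroids_on R n" for K'
    using that sym_matroid_indicator_eq[of K' K' n] isomorphic_refl unfolding matroids_on_def by blast
  have vM: "nested_vector N M = nested_vector N K"
    using sym_matroid_indicator_isomorphic[OF M Kd(1) K(2)] isomorphic_card_rank[OF K(2)]
    by (rule nested_vector_cong[rotated 2])
  let ?V = "nested_vector N ` matroids_on R n" and ?v = "nested_vector N K"
  have "?v \<notin> convex hull (?V - {?v})"
  proof
    assume "?v \<in> convex hull (?V - {?v})"
    then obtain S u where S: "finite S" "S \<subseteq> ?V - {?v}" "\<And>s. s \<in> S \<Longrightarrow> 0 \<le> u s" "sum u S = 1"
      and v: "(\<Sum>s\<in>S. u s *\<^sub>R s) = ?v"
      unfolding convex_hull_explicit by blast
    define J where "J = {s\<in>S. u s > 0}"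
    have finJ: "finite J" using S(1) unfolding J_def by simp
    have sumJ: "(\<Sum>s\<in>J. u s * h s) = (\<Sum>s\<in>S. u s * h s)" for h :: "(nat \<Rightarrow> real) \<Rightarrow> real"
    proof (rule sum.mono_neutral_left[OF S(1)])
      show "\<forall>s\<in>S - J. u s * h s = 0" using S(3) unfolding J_def by fastforce
    qed (auto simp: J_def)
    have "\<forall>s\<in>J. \<exists>K'. K' \<in> matroids_on R n \<and> nested_vector N K' = s"
    proof
      fix s assume "s \<in> J"
      then have "s \<in> ?V" using S(2) unfolding J_def by blast
      then show "\<exists>K'. K' \<in> matroids_on R n \<and> nested_vector N K' = s" by (metis imageE)
    qed
    from bchoice[OF this] obtain K' where K': "\<And>s. s \<in> J \<Longrightarrow> K' s \<in> matroids_on R n"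
      "\<And>s. s \<in> J \<Longrightarrow> nested_vector N (K' s) = s" by blast
    have w1: "sum u J = 1" using sumJ[of "\<lambda>_. 1"] S(4) by simp
    have eval: "sum (\<lambda>s. u s *\<^sub>R s) T i = (\<Sum>s\<in>T. u s * s i)" for T i
      by (induction T rule: infinite_finite_induct) (simp_all add: scaleR_fun_def)
    have comb: "real (sym_count n (rank_in K) x) = (\<Sum>j\<in>J. u j * real (sym_count n (rank_in (K' j)) x))" for x
    proof -
      have "real (sym_count n (rank_in K) x) / fact n = sym_matroid_indicator K x"
        using ind[OF K(1)] by simp
      also have "\<dots> = (\<Sum>i = 1..n choose R. (\<Sum>s\<in>S. u s * s i) * sym_matroid_indicator (N i) x)"
        unfolding fun_cong[OF nested_vector_expansion[OF N K(1)], of x] v[symmetric] eval ..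
      also have "\<dots> = (\<Sum>s\<in>S. u s * (\<Sum>i = 1..n choose R. s i * sym_matroid_indicator (N i) x))"
        unfolding sum_distrib_left sum_distrib_right by (subst sum.swap) (simp add: mult.assoc)
      also have "\<dots> = (\<Sum>s\<in>J. u s * (\<Sum>i = 1..n choose R. s i * sym_matroid_indicator (N i) x))"
        by (rule sumJ[symmetric])
      also have "\<dots> = (\<Sum>s\<in>J. u s * (real (sym_count n (rank_in (K' s)) x) / fact n))"
      proof (rule sum.cong[OF refl])
        fix s assume s: "s \<in> J"
        have "sym_matroid_indicator (K' s) x = (\<Sum>i = 1..n choose R. s i * sym_matroid_indicator (N i) x)"
          using fun_cong[OF nested_vector_expansion[OF N K'(1)[OF s]], of x] K'(2)[OF s] by simp
        then show "u s * (\<Sum>i = 1..n choose R. s i * sym_matroid_indicator (N i) x) =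
            u s * (real (sym_count n (rank_in (K' s)) x) / fact n)"
          using ind[OF K'(1)[OF s]] by simp
      qed
      finally show ?thesis by (simp add: sum_divide_distrib[symmetric])
    qed
    obtain s where s: "s \<in> J" using w1 by (metis ex_in_conv sum.empty zero_neq_one)
    have pos: "\<And>j. j \<in> J \<Longrightarrow> u j > 0" unfolding J_def by blast
    have "sym_count n (rank_in (K' s)) x = sym_count n (rank_in K) x" for x
      using rigid[OF finJ K'(1) pos w1 comb s] .
    then have "sym_matroid_indicator (K' s) = sym_matroid_indicator K"
      using ind[OF K'(1)[OF s]] ind[OF K(1)] by simp
    moreover have "ground (K' s) = {1..n}" "matroid_rank (K' s) = R"
      using K'(1)[OF s] unfolding matroids_on_def by simp_all
    ultimately have "nested_vector N (K' s) = ?v"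
      using Kd(2,3) by (intro nested_vector_cong) simp_all
    with K'(2)[OF s] have "s = ?v" by (rule trans[OF sym])
    moreover have "s \<in> S" using s unfolding J_def by simp
    then have "s \<in> ?V - {?v}" by (rule subsetD[OF S(2)])
    then have "s \<noteq> ?v" by simp
    ultimately show False by contradiction
  qed
  moreover have "finite (?V - {?v})" using finite_matroids_on by simp
  moreover have "insert ?v (?V - {?v}) = ?V" using imageI[OF K(1), of "nested_vector N"] by (rule insert_Diff)
  ultimately show ?thesis
    using extreme_point_of_hull_insert[of "?V - {?v}" ?v]
    unfolding extremal_def Omega_def vM R_def[symmetric] n_def[symmetric] by simp
qed

section \<open>Free products\<close>

lemma rank_insert_le:
  assumes rf: "rank_function E r" and "A \<subseteq> E" "x \<in> E"
  shows "r (insert x A) \<le> Suc (r A)"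
proof -
  have "r (A \<union> {x}) + r (A \<inter> {x}) \<le> r A + r {x}" by (rule rank_functionD(4)[OF rf]) (use assms in auto)
  moreover have "r {x} \<le> card {x}" by (rule rank_functionD(2)[OF rf]) (use assms in auto)
  ultimately show ?thesis by simp
qed

lemma rank_closure:
  assumes rf: "rank_function E r" and "A \<subseteq> E" "S \<subseteq> E"
    and same: "\<And>x. x \<in> S \<Longrightarrow> r (insert x A) \<le> r A"
  shows "r (A \<union> S) = r A"
proof -
  have "finite S" using rank_functionD(1)[OF rf] assms(3) finite_subset by blast
  then show ?thesis using assms(3) same
  proof (induction S)
    case (insert x S)
    have xE: "x \<in> E" "S \<subseteq> E" using insert.prems by auto
    have "r ((A \<union> S) \<union> insert x A) + r ((A \<union> S) \<inter> insert x A) \<le> r (A \<union> S) + r (insert x A)"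
      by (rule rank_functionD(4)[OF rf]) (use xE assms(2) in auto)
    moreover have "r A \<le> r ((A \<union> S) \<inter> insert x A)"
      by (rule rank_functionD(3)[OF rf]) (use xE assms(2) in auto)
    moreover have "(A \<union> S) \<union> insert x A = A \<union> insert x S" by blast
    moreover have "r A \<le> r (A \<union> insert x S)"
      by (rule rank_functionD(3)[OF rf]) (use xE assms(2) in auto)
    moreover have "r (insert x A) \<le> r A" "r (A \<union> S) = r A" using insert by auto
    ultimately show ?case by simp
  qed simp
qed

text \<open>
  The submodular presentation of matroids, which is how the free product is shown to be one.
\<close>

lemma matroid_of_rank_function:
  assumes rf: "rank_function E r"
  defines "M \<equiv> \<lparr>ground = E, indep = (\<lambda>I. I \<subseteq> E \<and> r I = card I)\<rparr>"
  shows "matroid M" and "\<And>A. A \<subseteq> E \<Longrightarrow> rank_in M A = r A"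
proof -
  have ind: "indep M I \<longleftrightarrow> I \<subseteq> E \<and> r I = card I" and gr: "ground M = E" for I
    unfolding M_def by simp_all
  have finE: "finite E" using rank_functionD(1)[OF rf] .
  have ext: "r (insert x I) \<le> r I" if "I \<subseteq> E" "r I = card I" "x \<in> E" "\<not> indep M (insert x I)" for x I
  proof (rule ccontr)
    assume c: "\<not> r (insert x I) \<le> r I"
    then have "x \<notin> I" by (metis insert_absorb order_refl)
    moreover have "finite I" using that finE finite_subset by blast
    ultimately have "r (insert x I) = card (insert x I)"
      using rank_insert_le[OF rf that(1,3)] c that(2) by simp
    then show False using that ind by simp
  qed
  show M: "matroid M"
    unfolding matroid_def gr
  proof (intro conjI allI impI)
    show "finite E" using finE .
    show "indep M {}" using ind rank_functionD(5)[OF rf] by simp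
    show "indep M I \<Longrightarrow> I \<subseteq> E" for I using ind by blast
  next
    fix I J assume IJ: "indep M J \<and> I \<subseteq> J"
    then have J: "J \<subseteq> E" "r J = card J" using ind by auto
    then have "finite J" using finE by (meson finite_subset)
    have "r (I \<union> (J - I)) + r (I \<inter> (J - I)) \<le> r I + r (J - I)"
      by (rule rank_functionD(4)[OF rf]) (use J IJ in auto)
    moreover have "I \<union> (J - I) = J" using IJ by blast
    moreover have "r (J - I) \<le> card (J - I)" by (rule rank_functionD(2)[OF rf]) (use J in auto)
    moreover have "card J = card I + card (J - I)"
      using \<open>finite J\<close> IJ by (metis card_Diff_subset card_mono finite_subset le_add_diff_inverse)
    ultimately have "card I \<le> r I" using J(2) by simp
    moreover have "r I \<le> card I" by (rule rank_functionD(2)[OF rf]) (use J IJ in auto)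
    ultimately show "indep M I" using ind J IJ by auto
  next
    fix I J assume IJ: "indep M I \<and> indep M J \<and> card I < card J"
    show "\<exists>x\<in>J - I. indep M (insert x I)"
    proof (rule ccontr)
      assume no: "\<not> ?thesis"
      have "r (I \<union> (J - I)) = r I"
      proof (rule rank_closure[OF rf])
        fix x assume "x \<in> J - I"
        then show "r (insert x I) \<le> r I" using IJ ind no by (intro ext) auto
      qed (use IJ ind in auto)
      moreover have "r J \<le> r (I \<union> (J - I))"
        by (rule rank_functionD(3)[OF rf]) (use IJ ind in auto)
      ultimately show False using IJ ind by auto
    qed
  qed
  fix A assume A: "A \<subseteq> E"
  show "rank_in M A = r A"
  proof (rule antisym)
    show "rank_in M A \<le> r A"
      using ind rank_functionD(3)[OF rf _ A] by (intro rank_leI[OF M]) metis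
    obtain I where I: "I \<subseteq> A" "indep M I" "card I = rank_in M A"
      using rank_attained[OF M] by metis
    have finI: "finite I" using I A finE by (meson finite_subset)
    have "r (I \<union> (A - I)) = r I"
    proof (rule rank_closure[OF rf])
      fix x assume x: "x \<in> A - I"
      have "\<not> indep M (insert x I)"
      proof
        assume "indep M (insert x I)"
        then have "card (insert x I) \<le> rank_in M A"
          by (rule indep_card_le_rank[OF M]) (use x I in auto)
        then show False using x I finI by simp
      qed
      then show "r (insert x I) \<le> r I" using x A I ind by (intro ext) auto
    qed (use I A in auto)
    moreover have "I \<union> (A - I) = A" using I by blast
    ultimately show "r A \<le> rank_in M A" using I ind by simp
  qed
qed

text \<open>
  The rank in \<open>M \<box> N\<close> is the minimum of two submodular functions whose difference is monotone, and
  such a minimum is submodular.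
\<close>

lemma free_product_rank:
  assumes M: "matroid M" and N: "matroid N" and disj: "ground M \<inter> ground N = {}"
  shows "matroid (M \<box> N)" and "ground (M \<box> N) = ground M \<union> ground N"
    and "\<And>A. A \<subseteq> ground M \<union> ground N \<Longrightarrow> rank_in (M \<box> N) A =
      min (rank_in M (A \<inter> ground M) + card (A \<inter> ground N)) (matroid_rank M + rank_in N (A \<inter> ground N))"
proof -
  let ?E = "ground M \<union> ground N"
  define f where "f A = rank_in M (A \<inter> ground M) + card (A \<inter> ground N)" for A
  define g where "g A = matroid_rank M + rank_in N (A \<inter> ground N)" for A
  define r where "r A = min (f A) (g A)" for A
  have rM: "rank_function (ground M) (rank_in M)" and rN: "rank_function (ground N) (rank_in N)"
    using rank_function_rank_in M N by blast+
  have fin: "finite (ground M)" "finite (ground N)" using matroidD(1) M N by blast+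
  have dist: "(A \<union> B) \<inter> G = (A \<inter> G) \<union> (B \<inter> G)" "(A \<inter> B) \<inter> G = (A \<inter> G) \<inter> (B \<inter> G)" for A B G :: "'a set"
    by blast+
  have fsub: "f (A \<union> B) + f (A \<inter> B) \<le> f A + f B" for A B
  proof -
    have "rank_in M ((A \<inter> ground M) \<union> (B \<inter> ground M)) + rank_in M ((A \<inter> ground M) \<inter> (B \<inter> ground M)) \<le>
        rank_in M (A \<inter> ground M) + rank_in M (B \<inter> ground M)"
      by (rule rank_functionD(4)[OF rM]) auto
    moreover have "card ((A \<inter> ground N) \<union> (B \<inter> ground N)) + card ((A \<inter> ground N) \<inter> (B \<inter> ground N)) =
        card (A \<inter> ground N) + card (B \<inter> ground N)"
      using fin by (intro card_Un_Int[symmetric]) auto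
    ultimately show ?thesis unfolding f_def dist[of A B "ground M"] dist[of A B "ground N"] by linarith
  qed
  have gsub: "g (A \<union> B) + g (A \<inter> B) \<le> g A + g B" for A B
  proof -
    have "rank_in N ((A \<inter> ground N) \<union> (B \<inter> ground N)) + rank_in N ((A \<inter> ground N) \<inter> (B \<inter> ground N)) \<le>
        rank_in N (A \<inter> ground N) + rank_in N (B \<inter> ground N)"
      by (rule rank_functionD(4)[OF rN]) auto
    then show ?thesis unfolding g_def dist[of A B "ground N"] by linarith
  qed
  have f_mono: "f A \<le> f B" and g_mono: "g A \<le> g B" if "A \<subseteq> B" for A B
    unfolding f_def g_def using that fin
    by (auto intro!: add_mono rank_functionD(3)[OF rM] rank_functionD(3)[OF rN] card_mono)
  have diff: "f A + g B \<le> f B + g A" if AB: "A \<subseteq> B" for A B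
  proof -
    have "rank_in N ((A \<inter> ground N) \<union> ((B - A) \<inter> ground N)) + rank_in N ((A \<inter> ground N) \<inter> ((B - A) \<inter> ground N)) \<le>
        rank_in N (A \<inter> ground N) + rank_in N ((B - A) \<inter> ground N)"
      by (rule rank_functionD(4)[OF rN]) auto
    moreover have un: "(A \<inter> ground N) \<union> ((B - A) \<inter> ground N) = B \<inter> ground N" using AB by blast
    ultimately have "rank_in N (B \<inter> ground N) \<le> rank_in N (A \<inter> ground N) + rank_in N ((B - A) \<inter> ground N)"
      by simp
    moreover have "rank_in N ((B - A) \<inter> ground N) \<le> card ((B - A) \<inter> ground N)"
      by (rule rank_functionD(2)[OF rN]) auto
    moreover have "card (B \<inter> ground N) = card (A \<inter> ground N) + card ((B - A) \<inter> ground N)"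
      unfolding un[symmetric]
      using fin by (intro card_Un_disjoint) auto
    moreover have "rank_in M (A \<inter> ground M) \<le> rank_in M (B \<inter> ground M)"
      by (rule rank_functionD(3)[OF rM]) (use AB in auto)
    ultimately show ?thesis unfolding f_def g_def by linarith
  qed
  have rf: "rank_function ?E r"
    unfolding rank_function_def
  proof (intro conjI allI impI)
    show "finite ?E" using fin by simp
  next
    fix A assume A: "A \<subseteq> ?E"
    have "rank_in M (A \<inter> ground M) \<le> card (A \<inter> ground M)"
      by (rule rank_functionD(2)[OF rM]) auto
    moreover have "card A = card (A \<inter> ground M) + card (A \<inter> ground N)"
    proof -
      have "A = (A \<inter> ground M) \<union> (A \<inter> ground N)" using A by blast
      moreover have "card ((A \<inter> ground M) \<union> (A \<inter> ground N)) = card (A \<inter> ground M) + card (A \<inter> ground N)"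
        using fin disj by (intro card_Un_disjoint) auto
      ultimately show ?thesis by simp
    qed
    ultimately show "r A \<le> card A" unfolding r_def f_def by linarith
  next
    fix A B assume "A \<subseteq> B \<and> B \<subseteq> ?E"
    then show "r A \<le> r B" unfolding r_def using f_mono[of A B] g_mono[of A B] by linarith
  next
    fix A B assume "A \<subseteq> ?E \<and> B \<subseteq> ?E"
    show "r (A \<union> B) + r (A \<inter> B) \<le> r A + r B"
      using fsub[of A B] gsub[of A B] diff[of A "A \<union> B"] diff[of B "A \<union> B"]
      unfolding r_def by (simp add: min_def)
  qed
  have ind: "indep (M \<box> N) S \<longleftrightarrow> S \<subseteq> ?E \<and> r S = card S" for S
  proof -
    let ?I = "S \<inter> ground M" and ?J = "S \<inter> ground N"
    have "indep (M \<box> N) S \<longleftrightarrow> S \<subseteq> ?E \<and> indep M ?I \<and> card S \<le> g S"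
    proof
      assume "indep (M \<box> N) S"
      then obtain I J where IJ: "S = I \<union> J" "indep M I" "J \<subseteq> ground N"
        "card (I \<union> J) \<le> matroid_rank M + rank_in N J"
        unfolding free_product_def by auto
      have "I \<subseteq> ground M" using matroidD(2)[OF M IJ(2)] .
      then have "?I = I" "?J = J" using IJ disj by blast+
      then show "S \<subseteq> ?E \<and> indep M ?I \<and> card S \<le> g S"
        using IJ \<open>I \<subseteq> ground M\<close> unfolding g_def by auto
    next
      assume S: "S \<subseteq> ?E \<and> indep M ?I \<and> card S \<le> g S"
      then have "S = ?I \<union> ?J" by blast
      then have "S = ?I \<union> ?J \<and> indep M ?I \<and> ?J \<subseteq> ground N \<and>
          card (?I \<union> ?J) \<le> matroid_rank M + rank_in N ?J"
        using S unfolding g_def by simp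
      then show "indep (M \<box> N) S" unfolding free_product_def matroid.simps by blast
    qed
    also have "\<dots> \<longleftrightarrow> S \<subseteq> ?E \<and> r S = card S"
    proof (cases "S \<subseteq> ?E")
      case True
      have "card ?I + card ?J = card S"
      proof -
        have "card (?I \<union> ?J) = card ?I + card ?J" using fin disj by (intro card_Un_disjoint) auto
        moreover have "?I \<union> ?J = S" using True by blast
        ultimately show ?thesis by simp
      qed
      moreover have "rank_in M ?I \<le> card ?I" by (rule rank_functionD(2)[OF rM]) auto
      moreover have "indep M ?I \<longleftrightarrow> rank_in M ?I = card ?I" using indep_iff_rank[OF M, of ?I] by simp
      ultimately show ?thesis using True unfolding r_def f_def by (auto simp: min_def)
    qed simp
    finally show ?thesis .
  qed
  have eq: "M \<box> N = \<lparr>ground = ?E, indep = (\<lambda>I. I \<subseteq> ?E \<and> r I = card I)\<rparr>"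
    using ind unfolding free_product_def by (auto simp: fun_eq_iff)
  show "matroid (M \<box> N)" unfolding eq by (rule matroid_of_rank_function(1)[OF rf])
  show "ground (M \<box> N) = ?E" unfolding free_product_def by simp
  show "rank_in (M \<box> N) A = min (rank_in M (A \<inter> ground M) + card (A \<inter> ground N))
      (matroid_rank M + rank_in N (A \<inter> ground N))" if "A \<subseteq> ?E" for A
  proof -
    have "rank_in (M \<box> N) A = r A" unfolding eq by (rule matroid_of_rank_function(2)[OF rf that])
    then show ?thesis unfolding r_def f_def g_def .
  qed
qed


section \<open>Finite planes\<close>

definition linear_space :: "'a set \<Rightarrow> 'a set set \<Rightarrow> nat \<Rightarrow> bool" where
  "linear_space P L s \<longleftrightarrow> finite P \<and> L \<subseteq> Pow P \<and> (\<forall>l\<in>L. card l = s) \<and> 2 \<le> s \<and>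
     (\<forall>x\<in>P. \<forall>y\<in>P. x \<noteq> y \<longrightarrow> (\<exists>!l. l \<in> L \<and> x \<in> l \<and> y \<in> l))"

lemma linear_space_unique:
  assumes "linear_space P L s" "l \<in> L" "m \<in> L" "x \<in> l" "y \<in> l" "x \<in> m" "y \<in> m" "x \<noteq> y"
  shows "l = m"
  using assms unfolding linear_space_def by (metis PowD subset_iff)

lemma linear_space_line:
  assumes "linear_space P L s" "x \<in> P" "y \<in> P" "x \<noteq> y"
  obtains l where "l \<in> L" "x \<in> l" "y \<in> l"
  using assms unfolding linear_space_def by metis

lemma linear_space_size:
  assumes S: "linear_space P L s" and p: "p \<in> P"
  shows "card P = card {l\<in>L. p \<in> l} * (s - 1) + 1"
proof -
  let ?Lp = "{l\<in>L. p \<in> l}"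
  have fin: "finite P" "L \<subseteq> Pow P" and cl: "\<And>l. l \<in> L \<Longrightarrow> card l = s"
    using S unfolding linear_space_def by auto
  have finL: "finite ?Lp" using fin by (auto intro: finite_subset)
  have "P - {p} = (\<Union>l\<in>?Lp. l - {p})"
  proof
    show "P - {p} \<subseteq> (\<Union>l\<in>?Lp. l - {p})"
    proof
      fix y assume y: "y \<in> P - {p}"
      then obtain l where "l \<in> L" "p \<in> l" "y \<in> l" using linear_space_line[OF S p, of y] by blast
      then show "y \<in> (\<Union>l\<in>?Lp. l - {p})" using y by blast
    qed
  qed (use fin in blast)
  moreover have "card (\<Union>l\<in>?Lp. l - {p}) = (\<Sum>l\<in>?Lp. card (l - {p}))"
  proof (rule card_UN_disjoint[OF finL])
    show "\<forall>l\<in>?Lp. finite (l - {p})" using fin by (auto intro: finite_subset)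
    show "\<forall>l\<in>?Lp. \<forall>m\<in>?Lp. l \<noteq> m \<longrightarrow> (l - {p}) \<inter> (m - {p}) = {}"
      using linear_space_unique[OF S] by blast
  qed
  moreover have "(\<Sum>l\<in>?Lp. card (l - {p})) = card ?Lp * (s - 1)"
    using cl by simp
  moreover have "card P = card (P - {p}) + 1" using card_Suc_Diff1[OF fin(1) p] by linarith
  ultimately show ?thesis by simp
qed

text \<open>
  If all lines passed through \<open>p\<close>, then the lines joining a point \<open>a\<close> of \<open>Q\<close> to two others would
  coincide with the line through \<open>a\<close> and \<open>p\<close>, and contain three points of \<open>Q\<close>.
\<close>

lemma line_missing_point:
  assumes S: "linear_space P L s" and Q: "Q \<subseteq> P" "3 \<le> card Q" "\<And>l. l \<in> L \<Longrightarrow> card (Q \<inter> l) \<le> 2"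
    and p: "p \<in> P"
  shows "\<exists>l\<in>L. p \<notin> l"
proof (rule ccontr)
  assume all: "\<not> ?thesis"
  have finQ: "finite Q" using Q(2) card.infinite by fastforce
  have "card (Q - {p}) \<ge> 2" using Q(2) finQ by (cases "p \<in> Q") auto
  then obtain a where a: "a \<in> Q" "a \<noteq> p" by (metis Diff_iff all_not_in_conv card.empty insertCI not_numeral_le_zero)
  have "card (Q - {a}) \<ge> 2" using a Q(2) finQ by simp
  then obtain T where "T \<subseteq> Q - {a}" "card T = 2" using obtain_subset_with_card_n by metis
  then obtain b c where bc: "b \<in> Q - {a}" "c \<in> Q - {a}" "b \<noteq> c" unfolding card_2_iff by auto
  obtain l where l: "l \<in> L" "a \<in> l" "b \<in> l" using linear_space_line[OF S, of a b] a bc Q(1) by blast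
  obtain m where m: "m \<in> L" "a \<in> m" "c \<in> m" using linear_space_line[OF S, of a c] a bc Q(1) by blast
  have "l = m" using linear_space_unique[OF S l(1) m(1), of p a] l m a all by blast
  then have "{a, b, c} \<subseteq> Q \<inter> l" using l m a bc by blast
  moreover have "finite (Q \<inter> l)" using finQ by simp
  ultimately have "card {a, b, c} \<le> 2" using Q(3)[OF l(1)] card_mono[of "Q \<inter> l" "{a, b, c}"] by linarith
  then show False using bc by auto
qed

text \<open>
  The lines through \<open>p\<close> are counted on a line \<open>l\<close> that misses \<open>p\<close>: in a projective plane all of them meet
  \<open>l\<close>, in an affine plane all but the parallel one. In both cases there are \<open>q + 1\<close> lines through \<open>p\<close>.
\<close>

lemma card_lines_meeting:
  assumes S: "linear_space P L s" and l: "l \<in> L" and p: "p \<in> P" "p \<notin> l"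
  shows "card {m\<in>L. p \<in> m \<and> m \<inter> l \<noteq> {}} = s"
proof -
  have lP: "l \<subseteq> P" and cl: "card l = s" using S l unfolding linear_space_def by auto
  have "\<forall>y\<in>l. \<exists>m. m \<in> L \<and> p \<in> m \<and> y \<in> m"
    using linear_space_line[OF S p(1)] lP p(2) by (metis subsetD)
  then obtain h where h: "\<And>y. y \<in> l \<Longrightarrow> h y \<in> L \<and> p \<in> h y \<and> y \<in> h y" by metis
  have "bij_betw h l {m\<in>L. p \<in> m \<and> m \<inter> l \<noteq> {}}"
    unfolding bij_betw_def
  proof
    show "inj_on h l"
    proof (rule inj_onI, rule ccontr)
      fix y z assume yz: "y \<in> l" "z \<in> l" "h y = h z" "y \<noteq> z"
      then have "h y = l" using linear_space_unique[OF S _ l, of "h y" y z] h by metis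
      then show False using h[OF yz(1)] p(2) by blast
    qed
    show "h ` l = {m\<in>L. p \<in> m \<and> m \<inter> l \<noteq> {}}"
    proof
      show "{m\<in>L. p \<in> m \<and> m \<inter> l \<noteq> {}} \<subseteq> h ` l"
      proof
        fix m assume m: "m \<in> {m\<in>L. p \<in> m \<and> m \<inter> l \<noteq> {}}"
        then obtain y where y: "y \<in> m" "y \<in> l" by blast
        then have "h y = m" using linear_space_unique[OF S, of "h y" m p y] h[OF y(2)] m p(2) by blast
        then show "m \<in> h ` l" using y by blast
      qed
    qed (use h in blast)
  qed
  then show ?thesis using bij_betw_same_card cl by fastforce
qed

lemma projective_plane_linear_space:
  assumes "projective_plane q P L"
  shows "linear_space P L (q + 1)" "card P = q * q + q + 1"
proof -
  show S: "linear_space P L (q + 1)" using assms unfolding projective_plane_def linear_space_def by simp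
  have "\<exists>Q\<subseteq>P. card Q = 4 \<and> (\<forall>l\<in>L. card (Q \<inter> l) \<le> 2)"
    using assms unfolding projective_plane_def by (elim conjE)
  then obtain Q where Q: "Q \<subseteq> P" "card Q = 4" "\<And>l. l \<in> L \<Longrightarrow> card (Q \<inter> l) \<le> 2"
    by (elim exE conjE) simp
  then obtain p where p: "p \<in> P" by (cases "Q = {}") auto
  obtain l where l: "l \<in> L" "p \<notin> l"
    using line_missing_point[OF S Q(1) _ Q(3) p] Q(2) by auto
  have "{m\<in>L. p \<in> m \<and> m \<inter> l \<noteq> {}} = {m\<in>L. p \<in> m}"
    using assms l unfolding projective_plane_def by (auto, metis disjoint_iff)
  then have "card {m\<in>L. p \<in> m} = q + 1" using card_lines_meeting[OF S l(1) p l(2)] by simp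
  then show "card P = q * q + q + 1" using linear_space_size[OF S p] by simp
qed

lemma affine_plane_linear_space:
  assumes "affine_plane q P L"
  shows "linear_space P L q" "card P = q * q"
proof -
  show S: "linear_space P L q" using assms unfolding affine_plane_def linear_space_def by simp
  have q: "2 \<le> q" and fin: "finite P" "L \<subseteq> Pow P" using assms unfolding affine_plane_def by auto
  have "\<exists>Q\<subseteq>P. card Q = 3 \<and> (\<forall>l\<in>L. card (Q \<inter> l) \<le> 2)"
    using assms unfolding affine_plane_def by (elim conjE)
  then obtain Q where Q: "Q \<subseteq> P" "card Q = 3" "\<And>l. l \<in> L \<Longrightarrow> card (Q \<inter> l) \<le> 2"
    by (elim exE conjE) simp
  then obtain p where p: "p \<in> P" by (cases "Q = {}") auto
  obtain l where l: "l \<in> L" "p \<notin> l"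
    using line_missing_point[OF S Q(1) _ Q(3) p] Q(2) by auto
  have "\<forall>l\<in>L. \<forall>x\<in>P - l. \<exists>!m. m \<in> L \<and> x \<in> m \<and> l \<inter> m = {}"
    using assms unfolding affine_plane_def by (elim conjE)
  then have "\<exists>!m. m \<in> L \<and> p \<in> m \<and> l \<inter> m = {}" using p l by simp
  then obtain m where m: "m \<in> L" "p \<in> m" "l \<inter> m = {}" "\<And>m'. m' \<in> L \<Longrightarrow> p \<in> m' \<Longrightarrow> l \<inter> m' = {} \<Longrightarrow> m' = m"
    by (elim ex1E) blast
  have eq: "{m'\<in>L. p \<in> m'} = insert m {m'\<in>L. p \<in> m' \<and> m' \<inter> l \<noteq> {}}" using m by blast
  have "finite {m'\<in>L. p \<in> m' \<and> m' \<inter> l \<noteq> {}}" using fin by (auto intro: finite_subset)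
  moreover have "m \<notin> {m'\<in>L. p \<in> m' \<and> m' \<inter> l \<noteq> {}}" using m by blast
  ultimately have "card {m'\<in>L. p \<in> m'} = q + 1"
    unfolding eq using card_lines_meeting[OF S l(1) p l(2)] by simp
  moreover have "(q + 1) * (q - 1) + 1 = q * q"
    using q by (cases q) (simp_all add: algebra_simps)
  ultimately show "card P = q * q" using linear_space_size[OF S p] by metis
qed

lemma simple_matroid_indep:
  assumes M: "matroid M" and simple: "simple_matroid M" and A: "A \<subseteq> ground M" "card A \<le> 2"
  shows "indep M A"
proof (rule ccontr)
  assume "\<not> indep M A"
  then obtain D where D: "D \<subseteq> A \<and> \<not> indep M D" and min: "\<And>D'. D' \<subseteq> A \<and> \<not> indep M D' \<Longrightarrow> card D \<le> card D'"
    using ex_has_least_nat[of "\<lambda>D. D \<subseteq> A \<and> \<not> indep M D" A card] by auto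
  have finA: "finite A" using A(1) matroidD(1)[OF M] finite_subset by blast
  have "circuit M D"
    unfolding circuit_def
  proof (intro conjI allI impI)
    fix D' assume D': "D' \<subset> D"
    then have "card D' < card D" using D finA by (meson finite_subset psubset_card_mono)
    then show "indep M D'" using min[of D'] D D' by (meson leD order_trans psubset_imp_subset)
  qed (use D A in auto)
  then have "3 \<le> card D" using simple unfolding simple_matroid_def by blast
  moreover have "card D \<le> card A" using D finA card_mono by blast
  ultimately show False using A(2) by simp
qed

definition matroid_lines :: "'a matroid \<Rightarrow> 'a set set" where
  "matroid_lines M = {F. flat M F \<and> rank_in M F = 2}"

text \<open>
  The sizes of planes of order \<open>q\<close>, affine or projective, lie between \<open>q * q\<close> and \<open>(q + 1) * (q + 1) - 1\<close>.
  These ranges are disjoint for different \<open>q\<close>, so a plane of larger order has more points.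
\<close>

lemma plane_matroid_linear_space:
  assumes "projective_plane_matroid q M \<or> affine_plane_matroid q M"
  shows "matroid M" "simple_matroid M" "matroid_rank M = 3"
    and "\<exists>s. linear_space (ground M) (matroid_lines M) s \<and> 3 * s \<le> 2 * card (ground M)"
    and "q * q \<le> card (ground M)" "card (ground M) < (q + 1) * (q + 1)"
proof -
  let ?P = "ground M" and ?L = "matroid_lines M"
  show "matroid M" "simple_matroid M" "matroid_rank M = 3"
    using assms unfolding projective_plane_matroid_def affine_plane_matroid_def by auto
  have q2: "2 \<le> q"
    using assms unfolding projective_plane_matroid_def affine_plane_matroid_def
      projective_plane_def affine_plane_def by auto
  define z where "z = q * q"
  have qq: "2 * q \<le> z" unfolding z_def using q2 by simp
  have cases: "(linear_space ?P ?L (q + 1) \<and> card ?P = q * q + q + 1) \<or> (linear_space ?P ?L q \<and> card ?P = q * q)"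
    using assms projective_plane_linear_space[of q ?P ?L] affine_plane_linear_space[of q ?P ?L]
    unfolding projective_plane_matroid_def affine_plane_matroid_def matroid_lines_def by blast
  from cases show "\<exists>s. linear_space ?P ?L s \<and> 3 * s \<le> 2 * card ?P"
  proof
    assume L: "linear_space ?P ?L (q + 1) \<and> card ?P = q * q + q + 1"
    have "3 * (q + 1) \<le> 2 * card ?P"
      unfolding conjunct2[OF L] z_def[symmetric] using qq q2 by presburger
    then show ?thesis using L by blast
  next
    assume L: "linear_space ?P ?L q \<and> card ?P = q * q"
    have "3 * q \<le> 2 * card ?P"
      unfolding conjunct2[OF L] z_def[symmetric] using qq by linarith
    then show ?thesis using L by blast
  qed
  show "q * q \<le> card ?P" "card ?P < (q + 1) * (q + 1)" using cases q2 by auto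
qed

lemma plane_matroid_ranks:
  assumes M: "matroid M" "simple_matroid M" "matroid_rank M = 3"
  shows "a \<in> ground M \<Longrightarrow> rank_in M {a} = 1"
    and "a \<in> ground M \<Longrightarrow> b \<in> ground M \<Longrightarrow> a \<noteq> b \<Longrightarrow> rank_in M {a, b} = 2"
    and "l \<in> matroid_lines M \<Longrightarrow> c \<in> ground M - l \<Longrightarrow> rank_in M (insert c l) = 3"
    and "A \<subseteq> ground M \<Longrightarrow> rank_in M A \<le> 3"
proof -
  have rf: "rank_function (ground M) (rank_in M)" using rank_function_rank_in[OF M(1)] .
  show "a \<in> ground M \<Longrightarrow> rank_in M {a} = 1"
    using simple_matroid_indep[OF M(1,2), of "{a}"] indep_iff_rank[OF M(1)] by simp
  show "a \<in> ground M \<Longrightarrow> b \<in> ground M \<Longrightarrow> a \<noteq> b \<Longrightarrow> rank_in M {a, b} = 2"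
    using simple_matroid_indep[OF M(1,2), of "{a, b}"] indep_iff_rank[OF M(1)] by simp
  show le: "rank_in M A \<le> 3" if "A \<subseteq> ground M" for A
    using rank_functionD(3)[OF rf that order_refl] M(3) unfolding matroid_rank_def by simp
  show "rank_in M (insert c l) = 3" if "l \<in> matroid_lines M" "c \<in> ground M - l"
    using that le[of "insert c l"] unfolding matroid_lines_def flat_def by force
qed

lemma rank_2_in_line:
  assumes M: "matroid M" "simple_matroid M" "matroid_rank M = 3"
    and S: "linear_space (ground M) (matroid_lines M) s"
    and A: "A \<subseteq> ground M" "rank_in M A = 2"
  shows "\<exists>l\<in>matroid_lines M. A \<subseteq> l"
proof -
  have rf: "rank_function (ground M) (rank_in M)" using rank_function_rank_in[OF M(1)] .
  obtain I where "I \<subseteq> A" "card I = 2" using rank_attained[OF M(1), of A] A(2) by auto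
  then obtain a b where ab: "a \<in> A" "b \<in> A" "a \<noteq> b" by (metis card_2_iff' subset_iff)
  then obtain l where l: "l \<in> matroid_lines M" "a \<in> l" "b \<in> l"
    using linear_space_line[OF S, of a b] A(1) by blast
  have lP: "l \<subseteq> ground M" "rank_in M l = 2" using l unfolding matroid_lines_def flat_def by auto
  have "c \<in> l" if c: "c \<in> A" for c
  proof (rule ccontr)
    assume "c \<notin> l"
    then have "rank_in M (insert c l) = 3" using plane_matroid_ranks(3)[OF M l(1)] c A(1) by blast
    moreover have "insert c l \<subseteq> l \<union> A" using c by blast
    ultimately have "3 \<le> rank_in M (l \<union> A)"
      using rank_functionD(3)[OF rf, of "insert c l" "l \<union> A"] lP A by simp
    moreover have "2 \<le> rank_in M (l \<inter> A)"
    proof -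
      have "rank_in M {a, b} = 2" by (rule plane_matroid_ranks(2)[OF M]) (use ab A in auto)
      moreover have "{a, b} \<subseteq> l \<inter> A" "l \<inter> A \<subseteq> ground M" using ab l A by blast+
      ultimately show ?thesis using rank_functionD(3)[OF rf] by metis
    qed
    ultimately show False using rank_functionD(4)[OF rf lP(1) A(1)] lP(2) A(2) by linarith
  qed
  then show ?thesis using l(1) by blast
qed

text \<open>
  In the intended use \<open>c\<close> is the sum of \<open>x\<close> over the elements below the plane and \<open>d\<close> is their rank.
  Every subset of the plane lies in the empty set, a point, a line or the whole plane of the same
  rank, and the condition for the larger set is the stronger one.
\<close>

lemma plane_rank_conditions:
  fixes x :: "'a \<Rightarrow> real"
  assumes M: "matroid M" "simple_matroid M" "matroid_rank M = 3"
    and S: "linear_space (ground M) (matroid_lines M) s"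
    and x: "\<And>e. e \<in> ground M \<Longrightarrow> 0 \<le> x e" "\<And>e. e \<in> ground M \<Longrightarrow> x e \<le> 1"
    and bounds: "c \<le> d" "\<And>l. l \<in> matroid_lines M \<Longrightarrow> c + sum x l \<le> d + 2" "c + sum x (ground M) \<le> d + 3"
    and A: "A \<subseteq> ground M"
  shows "c + sum x A \<le> d + real (rank_in M A)"
proof -
  have fin: "finite (ground M)" using matroidD(1)[OF M(1)] .
  have rf: "rank_function (ground M) (rank_in M)" using rank_function_rank_in[OF M(1)] .
  have mono: "sum x A \<le> sum x B" if "A \<subseteq> B" "B \<subseteq> ground M" for B
    using that x(1) fin by (intro sum_mono2) (auto intro: finite_subset)
  consider "A = {}" | a where "A = {a}" | a b where "a \<in> A" "b \<in> A" "a \<noteq> b" by blast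
  then show ?thesis
  proof cases
    case 1
    then show ?thesis using bounds(1) by simp
  next
    case 2
    then show ?thesis using bounds(1) x(2)[of a] A plane_matroid_ranks(1)[OF M, of a] by simp
  next
    case 3
    have "rank_in M {a, b} \<le> rank_in M A" using 3 A by (intro rank_functionD(3)[OF rf]) auto
    then have "rank_in M A = 2 \<or> rank_in M A = 3"
      using plane_matroid_ranks(2)[OF M, of a b] plane_matroid_ranks(4)[OF M A] 3 A by force
    then show ?thesis
    proof
      assume r2: "rank_in M A = 2"
      then obtain l where l: "l \<in> matroid_lines M" "A \<subseteq> l" using rank_2_in_line[OF M S A] by blast
      have "l \<subseteq> ground M" using l(1) unfolding matroid_lines_def flat_def by blast
      then show ?thesis using mono[OF l(2)] bounds(2)[OF l(1)] r2 by simp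
    next
      assume "rank_in M A = 3"
      then show ?thesis using mono[OF A order_refl] bounds(3) by simp
    qed
  qed
qed

section \<open>Towers of planes\<close>

lemma linear_space_sub: "linear_space P L s \<Longrightarrow> l \<in> L \<Longrightarrow> l \<subseteq> P"
  unfolding linear_space_def by auto

text \<open>
  The structure of an iterated free product of planes that matters: the blocks
  \<open>X (Suc i) - X i\<close> carry planes with lines \<open>L i\<close>, the ranks of sets just above \<open>X i\<close> are those of
  the plane, shifted by \<open>3 * i\<close>, and apart from the bounds \<open>0 \<le> x \<le> 1\<close> the base polytope is cut
  out by the conditions for the members of the chain and for the lines.
\<close>

locale plane_tower =
  fixes k :: nat and X :: "nat \<Rightarrow> 'a set" and L :: "nat \<Rightarrow> 'a set set" and s :: "nat \<Rightarrow> nat"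
    and r :: "'a set \<Rightarrow> nat"
  assumes rank: "rank_function (X k) r"
    and X_0: "X 0 = {}" and X_Suc: "i < k \<Longrightarrow> X i \<subseteq> X (Suc i)"
    and lines: "i < k \<Longrightarrow> linear_space (X (Suc i) - X i) (L i) (s i)"
    and line_short: "i < k \<Longrightarrow> 3 * s i \<le> 2 * card (X (Suc i) - X i)"
    and decreasing: "Suc i < k \<Longrightarrow> card (X (Suc (Suc i)) - X (Suc i)) < card (X (Suc i) - X i)"
    and rank_X: "i \<le> k \<Longrightarrow> r (X i) = 3 * i"
    and rank_point: "i < k \<Longrightarrow> a \<in> X (Suc i) - X i \<Longrightarrow> r (X i \<union> {a}) = 3 * i + 1"
    and rank_pair: "i < k \<Longrightarrow> a \<in> X (Suc i) - X i \<Longrightarrow> b \<in> X (Suc i) - X i \<Longrightarrow> a \<noteq> b \<Longrightarrow>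
      r (X i \<union> {a, b}) = 3 * i + 2"
    and rank_line: "i < k \<Longrightarrow> l \<in> L i \<Longrightarrow> r (X i \<union> l) = 3 * i + 2"
    and rank_plane: "i < k \<Longrightarrow> l \<in> L i \<Longrightarrow> c \<in> X (Suc i) - X i - l \<Longrightarrow>
      r (X i \<union> insert c l) = 3 * i + 3"
    and polytope: "\<And>(x :: 'a \<Rightarrow> real) A. (\<forall>e\<in>X k. 0 \<le> x e \<and> x e \<le> 1) \<Longrightarrow>
      (\<forall>i<k. sum x (X (Suc i)) \<le> 3 * real (Suc i)) \<Longrightarrow>
      (\<forall>i<k. \<forall>l\<in>L i. sum x (X i \<union> l) \<le> 3 * real i + 2) \<Longrightarrow>
      A \<subseteq> X k \<Longrightarrow> sum x A \<le> real (r A)"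
begin

lemma X_mono: "i \<le> j \<Longrightarrow> j \<le> k \<Longrightarrow> X i \<subseteq> X j"
proof (induction j)
  case (Suc j)
  then show ?case using X_Suc[of j] by (cases "i = Suc j") auto
qed simp

lemma finite_X: "i \<le> k \<Longrightarrow> finite (X i)"
  by (rule finite_subset[OF X_mono[OF _ order_refl] rank_functionD(1)[OF rank]])

lemma line_sub: "i < k \<Longrightarrow> l \<in> L i \<Longrightarrow> l \<subseteq> X (Suc i) - X i"
  using lines[of i] linear_space_sub by metis

end

lemma linear_space_image:
  assumes S: "linear_space P L s" and inj: "inj_on f P"
  shows "linear_space (f ` P) (image f ` L) s"
proof -
  have P: "finite P" "L \<subseteq> Pow P" "\<And>l. l \<in> L \<Longrightarrow> card l = s" "2 \<le> s"
    and ex1: "\<And>x y. x \<in> P \<Longrightarrow> y \<in> P \<Longrightarrow> x \<noteq> y \<Longrightarrow> \<exists>!l. l \<in> L \<and> x \<in> l \<and> y \<in> l"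
    using S unfolding linear_space_def by auto
  have mem: "f x \<in> f ` l \<longleftrightarrow> x \<in> l" if "x \<in> P" "l \<in> L" for x l
    using inj_on_image_mem_iff[OF inj that(1)] that P(2) by blast
  show ?thesis
    unfolding linear_space_def
  proof (intro conjI ballI impI)
    show "finite (f ` P)" using P(1) by simp
    show "image f ` L \<subseteq> Pow (f ` P)" using P(2) by blast
    show "2 \<le> s" using P(4) .
    show "card m = s" if m: "m \<in> image f ` L" for m
    proof -
      obtain l where "l \<in> L" "m = f ` l" using m by blast
      then show ?thesis using card_image[OF inj_on_subset[OF inj]] P(2,3) by blast
    qed
    fix x' y' assume "x' \<in> f ` P" "y' \<in> f ` P" "x' \<noteq> y'"
    then obtain x y where xy: "x \<in> P" "y \<in> P" "x \<noteq> y" "x' = f x" "y' = f y" by blast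
    obtain l where l: "l \<in> L" "x \<in> l" "y \<in> l" using ex1[OF xy(1-3)] by blast
    show "\<exists>!m. m \<in> image f ` L \<and> x' \<in> m \<and> y' \<in> m"
    proof (rule ex1I[of _ "f ` l"])
      show "f ` l \<in> image f ` L \<and> x' \<in> f ` l \<and> y' \<in> f ` l" using l xy by blast
      fix m assume m: "m \<in> image f ` L \<and> x' \<in> m \<and> y' \<in> m"
      then obtain l' where l': "l' \<in> L" "m = f ` l'" by blast
      then have "x \<in> l'" "y \<in> l'" using m xy mem by auto
      then have "l' = l" using ex1[OF xy(1-3)] l l'(1) by blast
      then show "m = f ` l" using l'(2) by simp
    qed
  qed
qed

lemma plane_tower_image:
  assumes T: "plane_tower k X L s r" and inj: "inj_on f (X k)"
    and r': "\<And>A. A \<subseteq> X k \<Longrightarrow> r' (f ` A) = r A" and rf: "rank_function (f ` X k) r'"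
  shows "plane_tower k (\<lambda>i. f ` X i) (\<lambda>i. image f ` L i) s r'"
proof -
  interpret plane_tower k X L s r by (rule T)
  have sub: "X i \<subseteq> X k" if "i \<le> k" for i using X_mono[OF that order_refl] .
  have block: "f ` X (Suc i) - f ` X i = f ` (X (Suc i) - X i)" if "i < k" for i
    using that sub[of "Suc i"] sub[of i] by (intro inj_on_image_set_diff[OF inj, symmetric]) auto
  have injb: "inj_on f (X (Suc i) - X i)" if "i < k" for i
    using inj sub[of "Suc i"] that by (meson Diff_subset inj_on_subset less_eq_Suc_le)
  have cb: "card (f ` X (Suc i) - f ` X i) = card (X (Suc i) - X i)" if "i < k" for i
    unfolding block[OF that] by (rule card_image[OF injb[OF that]])
  have lsub: "l \<subseteq> X k" if "i < k" "l \<in> L i" for i l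
    using line_sub[OF that] sub[of "Suc i"] that(1) by auto
  have bsub: "a \<in> X k" if "i < k" "a \<in> X (Suc i) - X i" for i a
    using sub[of "Suc i"] that by auto
  show ?thesis
  proof
    show "rank_function (f ` X k) r'" by (rule rf)
    show "f ` X 0 = {}" using X_0 by simp
    fix i
    show "f ` X i \<subseteq> f ` X (Suc i)" if "i < k" using X_Suc[OF that] by blast
    show "linear_space (f ` X (Suc i) - f ` X i) (image f ` L i) (s i)" if "i < k"
      unfolding block[OF that] by (rule linear_space_image[OF lines[OF that] injb[OF that]])
    show "3 * s i \<le> 2 * card (f ` X (Suc i) - f ` X i)" if "i < k"
      unfolding cb[OF that] by (rule line_short[OF that])
    show "card (f ` X (Suc (Suc i)) - f ` X (Suc i)) < card (f ` X (Suc i) - f ` X i)" if "Suc i < k"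
      using decreasing[OF that] cb[of i] cb[of "Suc i"] that by simp
    show "r' (f ` X i) = 3 * i" if "i \<le> k" using rank_X[OF that] r'[OF sub[OF that]] by simp
    show "r' (f ` X i \<union> {a}) = 3 * i + 1" if i: "i < k" and a: "a \<in> f ` X (Suc i) - f ` X i" for a
    proof -
      obtain a' where a': "a' \<in> X (Suc i) - X i" "a = f a'" using a unfolding block[OF i] by blast
      have eq: "f ` X i \<union> {a} = f ` (X i \<union> {a'})" using a' by simp
      have sb: "X i \<union> {a'} \<subseteq> X k" using sub[of i] i bsub[OF i a'(1)] by simp
      show ?thesis unfolding eq r'[OF sb] by (rule rank_point[OF i a'(1)])
    qed
    show "r' (f ` X i \<union> {a, b}) = 3 * i + 2"
      if i: "i < k" and a: "a \<in> f ` X (Suc i) - f ` X i" and b: "b \<in> f ` X (Suc i) - f ` X i"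
        and ab: "a \<noteq> b" for a b
    proof -
      obtain a' where a': "a' \<in> X (Suc i) - X i" "a = f a'" using a unfolding block[OF i] by blast
      obtain b' where b': "b' \<in> X (Suc i) - X i" "b = f b'" using b unfolding block[OF i] by blast
      have ne: "a' \<noteq> b'" using ab a' b' by blast
      have eq: "f ` X i \<union> {a, b} = f ` (X i \<union> {a', b'})" using a' b' by simp
      have sb: "X i \<union> {a', b'} \<subseteq> X k"
        using sub[of i] i bsub[OF i a'(1)] bsub[OF i b'(1)] by simp
      show ?thesis unfolding eq r'[OF sb] by (rule rank_pair[OF i a'(1) b'(1) ne])
    qed
    show "r' (f ` X i \<union> l) = 3 * i + 2" if i: "i < k" and l: "l \<in> image f ` L i" for l
    proof -
      obtain l' where l': "l' \<in> L i" "l = f ` l'" using l by blast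
      have eq: "f ` X i \<union> l = f ` (X i \<union> l')" using l' by blast
      have sb: "X i \<union> l' \<subseteq> X k" using sub[of i] i lsub[OF i l'(1)] by simp
      show ?thesis unfolding eq r'[OF sb] by (rule rank_line[OF i l'(1)])
    qed
    show "r' (f ` X i \<union> insert c l) = 3 * i + 3"
      if i: "i < k" and l: "l \<in> image f ` L i" and c: "c \<in> f ` X (Suc i) - f ` X i - l" for l c
    proof -
      obtain l' where l': "l' \<in> L i" "l = f ` l'" using l by blast
      obtain c' where c': "c' \<in> X (Suc i) - X i - l'" "c = f c'"
        using c l' unfolding block[OF i] by blast
      have eq: "f ` X i \<union> insert c l = f ` (X i \<union> insert c' l')" using l' c' by blast
      have sb: "X i \<union> insert c' l' \<subseteq> X k"
        using sub[of i] i lsub[OF i l'(1)] bsub[OF i, of c'] c' by simp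
      show ?thesis unfolding eq r'[OF sb] by (rule rank_plane[OF i l'(1) c'(1)])
    qed
    fix x :: "'b \<Rightarrow> real" and A
    assume x: "\<forall>e\<in>f ` X k. 0 \<le> x e \<and> x e \<le> 1"
      and chain: "\<forall>i<k. sum x (f ` X (Suc i)) \<le> 3 * real (Suc i)"
      and ln: "\<forall>i<k. \<forall>l\<in>image f ` L i. sum x (f ` X i \<union> l) \<le> 3 * real i + 2"
      and A: "A \<subseteq> f ` X k"
    have sm: "sum (x \<circ> f) D = sum x (f ` D)" if "D \<subseteq> X k" for D
      using inj_on_subset[OF inj that] by (simp add: sum.reindex)
    obtain A' where A': "A' \<subseteq> X k" "A = f ` A'" using A by (meson subset_imageE)
    have "sum (x \<circ> f) A' \<le> real (r A')"
    proof (rule polytope[OF _ _ _ A'(1)])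
      show "\<forall>e\<in>X k. 0 \<le> (x \<circ> f) e \<and> (x \<circ> f) e \<le> 1" using x by simp
      show "\<forall>i<k. sum (x \<circ> f) (X (Suc i)) \<le> 3 * real (Suc i)"
        using chain sm sub by simp
      show "\<forall>i<k. \<forall>l\<in>L i. sum (x \<circ> f) (X i \<union> l) \<le> 3 * real i + 2"
      proof (intro allI impI ballI)
        fix i l assume i: "i < k" and l: "l \<in> L i"
        have "X i \<union> l \<subseteq> X k" using sub[of i] i lsub[OF i l] by simp
        then have "sum (x \<circ> f) (X i \<union> l) = sum x (f ` X i \<union> f ` l)" using sm by (simp add: image_Un)
        then show "sum (x \<circ> f) (X i \<union> l) \<le> 3 * real i + 2" using ln i l by simp
      qed
    qed
    then show "sum x A \<le> real (r' A)" using A' sm[OF A'(1)] r'[OF A'(1)] by simp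
  qed
qed

lemma iterated_free_product_Suc:
  assumes "1 \<le> i"
  shows "iterated_free_product M (Suc i) = iterated_free_product M i \<box> M (Suc i)"
proof -
  have "[2..<Suc (Suc i)] = [2..<Suc i] @ [Suc i]" using assms by simp
  then show ?thesis unfolding iterated_free_product_def by simp
qed

text \<open>
  The rank function of the product satisfies the recursion \<open>rec\<close> below. Restricting it to the prefixes
  shows that adding further planes does not change the ranks inside the earlier ones.
\<close>

theorem plane_tower_iterated_free_product:
  fixes M :: "nat \<Rightarrow> 'a matroid"
  assumes n: "1 \<le> n"
    and planes: "\<And>i. i \<in> {1..n} \<Longrightarrow> projective_plane_matroid (q i) (M i) \<or> affine_plane_matroid (q i) (M i)"
    and disj: "disjoint_family_on (\<lambda>i. ground (M i)) {1..n}"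
    and orders: "\<And>i j. 1 \<le> i \<Longrightarrow> i < j \<Longrightarrow> j \<le> n \<Longrightarrow> q i > q j"
  defines "X \<equiv> \<lambda>i. \<Union>j\<in>{1..i}. ground (M j)"
  shows "matroid (iterated_free_product M n)" "ground (iterated_free_product M n) = X n"
    and "\<exists>s. plane_tower n X (\<lambda>i. matroid_lines (M (Suc i))) s (rank_in (iterated_free_product M n))"
proof -
  let ?P = "iterated_free_product M"
  let ?E = "\<lambda>i. ground (M i)"
  \<comment> \<open>For \<open>i = 0\<close> the empty matroid, so that the recursion also covers the first plane.\<close>
  define rk where "rk i A = (if i = 0 then 0 else rank_in (?P i) A)" for i A
  have pl: "projective_plane_matroid (q (Suc i)) (M (Suc i)) \<or> affine_plane_matroid (q (Suc i)) (M (Suc i))"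
    if "i < n" for i
    using planes that by simp
  note pm = plane_matroid_linear_space[OF pl]
  have X_Suc: "X (Suc i) = X i \<union> ?E (Suc i)" for i
    unfolding X_def by (auto simp: atLeastAtMostSuc_conv)
  have X_0: "X 0 = {}" unfolding X_def by simp
  have dj: "X i \<inter> ?E (Suc i) = {}" if "i < n" for i
  proof -
    have "ground (M j) \<inter> ?E (Suc i) = {}" if "j \<in> {1..i}" for j
      using disjoint_family_onD[OF disj, of j "Suc i"] that \<open>i < n\<close> by auto
    then show ?thesis unfolding X_def by blast
  qed
  have block: "X (Suc i) - X i = ?E (Suc i)" if "i < n" for i
    using dj[OF that] X_Suc[of i] by blast
  have E1: "?P 1 = M 1" unfolding iterated_free_product_def by simp
  have struct: "1 \<le> i \<Longrightarrow> i \<le> n \<Longrightarrow> matroid (?P i) \<and> ground (?P i) = X i \<and> matroid_rank (?P i) = 3 * i" for i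
  proof (induction i)
    case (Suc i)
    show ?case
    proof (cases "i = 0")
      case True
      then show ?thesis using pm(1)[of 0] pm(3)[of 0] Suc.prems E1 X_Suc[of 0] X_0 by simp
    next
      case False
      then have IH: "matroid (?P i)" "ground (?P i) = X i" "matroid_rank (?P i) = 3 * i"
        using Suc by auto
      have i: "i < n" using Suc.prems by simp
      have d: "ground (?P i) \<inter> ?E (Suc i) = {}" using IH(2) dj[OF i] by simp
      have eq: "?P (Suc i) = ?P i \<box> M (Suc i)" using iterated_free_product_Suc[of i M] False by simp
      note fp = free_product_rank[OF IH(1) pm(1)[OF i] d, folded eq]
      have gr: "ground (?P (Suc i)) = X (Suc i)" using fp(2) IH(2) X_Suc by simp
      have "X (Suc i) \<inter> X i = X i" "X (Suc i) \<inter> ?E (Suc i) = ?E (Suc i)" using X_Suc by blast+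
      then have "matroid_rank (?P (Suc i)) = min (3 * i + card (?E (Suc i))) (3 * i + 3)"
        using fp(3)[of "X (Suc i)"] IH pm(3)[OF i] X_Suc gr unfolding matroid_rank_def by simp
      moreover have "3 \<le> card (?E (Suc i))"
        using rank_functionD(2)[OF rank_function_rank_in[OF pm(1)[OF i]], of "?E (Suc i)"] pm(3)[OF i]
        unfolding matroid_rank_def by simp
      ultimately show ?thesis using fp(1) gr by simp
    qed
  qed simp
  show "matroid (?P n)" "ground (?P n) = X n" using struct[of n] n by auto
  have rf: "rank_function (X i) (rk i)" if "i \<le> n" for i
  proof (cases "i = 0")
    case True
    then show ?thesis using X_0 unfolding rank_function_def rk_def by simp
  next
    case False
    then have "rk i = rank_in (?P i)" by (simp add: rk_def fun_eq_iff)
    then show ?thesis using False struct[of i] that rank_function_rank_in[of "?P i"] by simp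
  qed
  have rkX: "rk i (X i) = 3 * i" if "i \<le> n" for i
    using struct[of i] that by (cases "i = 0") (auto simp: rk_def matroid_rank_def)
  have rfM: "rank_function (?E (Suc i)) (rank_in (M (Suc i)))" if "i < n" for i
    by (rule rank_function_rank_in[OF pm(1)[OF that]])
  have rec: "rk (Suc i) A = min (rk i (A \<inter> X i) + card (A \<inter> ?E (Suc i)))
      (3 * i + rank_in (M (Suc i)) (A \<inter> ?E (Suc i)))" if i: "i < n" and A: "A \<subseteq> X (Suc i)" for i A
  proof (cases "i = 0")
    case True
    then have "A \<inter> ?E (Suc 0) = A" "A \<subseteq> ?E (Suc 0)" using A X_Suc[of 0] X_0 by auto
    then show ?thesis
      using True E1 rank_functionD(2)[OF rfM[OF i], of A] unfolding rk_def by simp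
  next
    case False
    have d: "ground (?P i) \<inter> ?E (Suc i) = {}" using struct[of i] False i dj[OF i] by simp
    have "matroid (?P i)" using struct[of i] False i by simp
    note fp = free_product_rank(3)[OF this pm(1)[OF i] d]
    show ?thesis
      using fp[of A] A False i struct[of i] X_Suc[of i] iterated_free_product_Suc[of i M]
      unfolding rk_def by simp
  qed
  have restrict: "rk j A = rk i A" if "i \<le> j" "j \<le> n" "A \<subseteq> X i" for i j A
    using that
  proof (induction j)
    case (Suc j)
    show ?case
    proof (cases "i = Suc j")
      case False
      then have ij: "i \<le> j" using Suc.prems by simp
      have Xm: "X i \<subseteq> X j" using ij unfolding X_def by (intro UN_mono) auto
      have j: "j < n" using Suc.prems by simp
      have "A \<inter> X j = A" "A \<inter> ?E (Suc j) = {}" using Suc.prems(3) Xm dj[OF j] by blast+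
      moreover have "A \<subseteq> X (Suc j)" using Suc.prems(3) Xm X_Suc by blast
      moreover have "rk j A \<le> 3 * j"
        using rank_functionD(3)[OF rf[of j], of A "X j"] Suc.prems(3) Xm rkX[of j] j by simp
      ultimately have "rk (Suc j) A = rk j A"
        using rec[OF j, of A] rank_functionD(5)[OF rfM[OF j]] by simp
      then show ?thesis using Suc ij by simp
    qed simp
  qed simp
  have above: "rk n (X i \<union> S) = 3 * i + rank_in (M (Suc i)) S" if i: "i < n" and S: "S \<subseteq> ?E (Suc i)" for i S
  proof -
    have "(X i \<union> S) \<inter> X i = X i" "(X i \<union> S) \<inter> ?E (Suc i) = S" "X i \<union> S \<subseteq> X (Suc i)"
      using S dj[OF i] X_Suc[of i] by blast+
    then show ?thesis
      using restrict[of "Suc i" n "X i \<union> S"] rec[OF i, of "X i \<union> S"] rkX[of i] i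
        rank_functionD(2)[OF rfM[OF i] S] by simp
  qed
  have "\<forall>i\<in>{..<n}. \<exists>t. linear_space (?E (Suc i)) (matroid_lines (M (Suc i))) t \<and> 3 * t \<le> 2 * card (?E (Suc i))"
    using pm(4) by blast
  from bchoice[OF this] obtain s where s: "\<And>i. i < n \<Longrightarrow>
      linear_space (?E (Suc i)) (matroid_lines (M (Suc i))) (s i) \<and> 3 * s i \<le> 2 * card (?E (Suc i))"
    by auto
  have rkn: "rank_in (?P n) = rk n" using n unfolding rk_def by (simp add: fun_eq_iff)
  have "plane_tower n X (\<lambda>i. matroid_lines (M (Suc i))) s (rk n)"
  proof
    show "rank_function (X n) (rk n)" using rf by simp
    show "X 0 = {}" by (rule X_0)
    fix i
    show "X i \<subseteq> X (Suc i)" using X_Suc by blast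
    show "linear_space (X (Suc i) - X i) (matroid_lines (M (Suc i))) (s i)" if "i < n"
      using s[OF that] block[OF that] by simp
    show "3 * s i \<le> 2 * card (X (Suc i) - X i)" if "i < n"
      using s[OF that] block[OF that] by simp
    show "rk n (X i) = 3 * i" if "i \<le> n" using restrict[OF that, of "X i"] rkX[OF that] by simp
    show "card (X (Suc (Suc i)) - X (Suc i)) < card (X (Suc i) - X i)" if i: "Suc i < n"
    proof -
      have "q (Suc (Suc i)) + 1 \<le> q (Suc i)" using orders[of "Suc i" "Suc (Suc i)"] i by simp
      then have "(q (Suc (Suc i)) + 1) * (q (Suc (Suc i)) + 1) \<le> q (Suc i) * q (Suc i)"
        by (intro mult_mono) auto
      then show ?thesis
        using pm(6)[of "Suc i"] pm(5)[of i] block[of i] block[of "Suc i"] i by simp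
    qed
    show "rk n (X i \<union> {a}) = 3 * i + 1" if i: "i < n" and a: "a \<in> X (Suc i) - X i" for a
      using above[OF i, of "{a}"] a plane_matroid_ranks(1)[OF pm(1-3)[OF i], of a] block[OF i] by simp
    show "rk n (X i \<union> {a, b}) = 3 * i + 2"
      if i: "i < n" and a: "a \<in> X (Suc i) - X i" "b \<in> X (Suc i) - X i" "a \<noteq> b" for a b
      using above[OF i, of "{a, b}"] a plane_matroid_ranks(2)[OF pm(1-3)[OF i], of a b] block[OF i] by simp
    show "rk n (X i \<union> l) = 3 * i + 2" if i: "i < n" and l: "l \<in> matroid_lines (M (Suc i))" for l
      using above[OF i, of l] l unfolding matroid_lines_def flat_def by simp
    show "rk n (X i \<union> insert c l) = 3 * i + 3"
      if i: "i < n" and l: "l \<in> matroid_lines (M (Suc i))" and c: "c \<in> X (Suc i) - X i - l" for l c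
    proof -
      have "l \<subseteq> ?E (Suc i)" using l unfolding matroid_lines_def flat_def by simp
      then show ?thesis
        using above[OF i, of "insert c l"] plane_matroid_ranks(3)[OF pm(1-3)[OF i] l, of c] c
        unfolding block[OF i] by simp
    qed
    fix x :: "'a \<Rightarrow> real" and A
    assume x: "\<forall>e\<in>X n. 0 \<le> x e \<and> x e \<le> 1"
      and chain: "\<forall>i<n. sum x (X (Suc i)) \<le> 3 * real (Suc i)"
      and ln: "\<forall>i<n. \<forall>l\<in>matroid_lines (M (Suc i)). sum x (X i \<union> l) \<le> 3 * real i + 2"
      and A: "A \<subseteq> X n"
    have Xn: "X i \<subseteq> X n" if "i \<le> n" for i using that unfolding X_def by (intro UN_mono) auto
    have finX: "finite (X i)" if "i \<le> n" for i using rank_functionD(1)[OF rf[OF that]] .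
    have "A \<subseteq> X i \<Longrightarrow> sum x A \<le> real (rk i A)" if "i \<le> n" for i
      using that
    proof (induction i arbitrary: A)
      case 0
      then show ?case using X_0 by simp
    next
      case (Suc i)
      have i: "i < n" using Suc.prems by simp
      let ?F = "?E (Suc i)"
      have EX: "?F \<subseteq> X n" using Xn[of "Suc i"] X_Suc[of i] i by auto
      have finE: "finite ?F" using EX finX[of n] finite_subset by blast
      have x01: "\<And>e. e \<in> ?F \<Longrightarrow> 0 \<le> x e" "\<And>e. e \<in> ?F \<Longrightarrow> x e \<le> 1" using x EX by blast+
      have union: "sum x (X i \<union> S) = sum x (X i) + sum x S" if "S \<subseteq> ?F" for S
        using that dj[OF i] finX[of i] finite_subset[OF that finE] i by (intro sum.union_disjoint) auto
      have split: "sum x A = sum x (A \<inter> X i) + sum x (A \<inter> ?F)"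
      proof -
        have "A = (A \<inter> X i) \<union> (A \<inter> ?F)" using Suc.prems(1) X_Suc[of i] by blast
        moreover have "sum x ((A \<inter> X i) \<union> (A \<inter> ?F)) = sum x (A \<inter> X i) + sum x (A \<inter> ?F)"
          using dj[OF i] finX[of i] finE i by (intro sum.union_disjoint) auto
        ultimately show ?thesis by simp
      qed
      have "sum x (A \<inter> X i) \<le> real (rk i (A \<inter> X i))" using Suc.IH[of "A \<inter> X i"] i by simp
      moreover have "sum x (A \<inter> ?F) \<le> (\<Sum>e\<in>A \<inter> ?F. 1)" using x01 by (intro sum_mono) auto
      ultimately have le1: "sum x A \<le> real (rk i (A \<inter> X i) + card (A \<inter> ?F))" using split by simp
      have "sum x (X i) + sum x (A \<inter> ?F) \<le> 3 * real i + real (rank_in (M (Suc i)) (A \<inter> ?F))"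
      proof (rule plane_rank_conditions[OF pm(1-3)[OF i] conjunct1[OF s[OF i]] x01])
        show "sum x (X i) \<le> 3 * real i"
        proof (cases i)
          case 0
          then show ?thesis using X_0 by simp
        next
          case (Suc j)
          then show ?thesis using chain i by simp
        qed
        show "sum x (X i) + sum x l \<le> 3 * real i + 2" if l: "l \<in> matroid_lines (M (Suc i))" for l
        proof -
          have "l \<subseteq> ?F" using l unfolding matroid_lines_def flat_def by simp
          then have "sum x (X i \<union> l) = sum x (X i) + sum x l" by (rule union)
          moreover have "sum x (X i \<union> l) \<le> 3 * real i + 2" using ln i l by blast
          ultimately show ?thesis by linarith
        qed
        show "sum x (X i) + sum x ?F \<le> 3 * real i + 3"
          using chain i union[of ?F] X_Suc[of i] by (auto simp: algebra_simps)
      qed auto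
      moreover have "sum x (A \<inter> X i) \<le> sum x (X i)"
        using x Xn[of i] finX[of i] i by (intro sum_mono2) auto
      ultimately have "sum x A \<le> real (3 * i + rank_in (M (Suc i)) (A \<inter> ?F))" using split by simp
      with le1 show ?case using rec[OF i Suc.prems(1)] by simp
    qed
    then show "sum x A \<le> real (rk n A)" using A by simp
  qed
  then show "\<exists>s. plane_tower n X (\<lambda>i. matroid_lines (M (Suc i))) s (rank_in (?P n))"
    unfolding rkn by blast
qed

section \<open>Counting arrangements in the polytope of a tower\<close>

text \<open>
  This provides the relabellings that carry one configuration inside the blocks to another: a
  configuration is encoded as a refinement of the chain of prefixes.
\<close>

lemma chain_permutation:
  assumes fin: "finite E" and Z: "\<And>t. t < m \<Longrightarrow> Z t \<subseteq> Z (Suc t)" "Z m = E"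
    and Z': "\<And>t. t < m \<Longrightarrow> Z' t \<subseteq> Z' (Suc t)" "Z' m = E"
    and cd: "\<And>t. t \<le> m \<Longrightarrow> card (Z t) = card (Z' t)"
  shows "\<exists>\<pi>. \<pi> permutes E \<and> (\<forall>t\<le>m. \<pi> ` Z t = Z' t)"
proof -
  have sub: "Z t \<subseteq> E" "Z' t \<subseteq> E" if "t \<le> m" for t
  proof -
    show "Z t \<subseteq> E" using that by (induction rule: inc_induct) (use Z in auto)
    show "Z' t \<subseteq> E" using that by (induction rule: inc_induct) (use Z' in auto)
  qed
  have finZ: "finite (Z t)" "finite (Z' t)" if "t \<le> m" for t
    using sub[OF that] fin finite_subset by blast+
  have "j \<le> m \<Longrightarrow> \<exists>f. bij_betw f (Z j) (Z' j) \<and> (\<forall>t\<le>j. f ` Z t = Z' t)" for j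
  proof (induction j)
    case 0
    then obtain f where "bij_betw f (Z 0) (Z' 0)"
      using finite_same_card_bij[OF finZ cd] by blast
    then show ?case by (auto simp: bij_betw_def)
  next
    case (Suc j)
    then obtain f where f: "bij_betw f (Z j) (Z' j)" "\<And>t. t \<le> j \<Longrightarrow> f ` Z t = Z' t" by auto
    have inc: "Z j \<subseteq> Z (Suc j)" "Z' j \<subseteq> Z' (Suc j)" using Z(1) Z'(1) Suc.prems by auto
    have mono: "Z t \<subseteq> Z j" if "t \<le> j" for t
      using that
    proof (induction rule: inc_induct)
      case (step i)
      then show ?case using Z(1)[of i] Suc.prems by auto
    qed simp
    have "card (Z (Suc j) - Z j) = card (Z' (Suc j) - Z' j)"
      using cd[of j] cd[of "Suc j"] card_Diff_subset[OF finZ(1) inc(1)] card_Diff_subset[OF finZ(2) inc(2)]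
        Suc.prems by simp
    then obtain g where g: "bij_betw g (Z (Suc j) - Z j) (Z' (Suc j) - Z' j)"
      using finite_same_card_bij[of "Z (Suc j) - Z j" "Z' (Suc j) - Z' j"] finZ[OF Suc.prems] by blast
    define h where "h x = (if x \<in> Z j then f x else g x)" for x
    have hf: "h ` A = f ` A" if "A \<subseteq> Z j" for A
      using that by (intro image_cong) (auto simp: h_def)
    have "bij_betw h (Z j) (Z' j)" using f(1) bij_betw_cong[of "Z j" h f] by (simp add: h_def)
    moreover have "bij_betw h (Z (Suc j) - Z j) (Z' (Suc j) - Z' j)"
      using g bij_betw_cong[of "Z (Suc j) - Z j" h g] by (simp add: h_def)
    ultimately have "bij_betw h (Z j \<union> (Z (Suc j) - Z j)) (Z' j \<union> (Z' (Suc j) - Z' j))"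
      by (rule bij_betw_combine) blast
    moreover have "Z j \<union> (Z (Suc j) - Z j) = Z (Suc j)" "Z' j \<union> (Z' (Suc j) - Z' j) = Z' (Suc j)"
      using inc by blast+
    ultimately have h: "bij_betw h (Z (Suc j)) (Z' (Suc j))" by simp
    moreover have "h ` Z t = Z' t" if "t \<le> Suc j" for t
    proof (cases "t = Suc j")
      case True
      then show ?thesis using h by (simp add: bij_betw_def)
    next
      case False
      then have "t \<le> j" using that by simp
      then show ?thesis using hf[OF mono] f(2) by simp
    qed
    ultimately show ?case by blast
  qed
  then obtain f where f: "bij_betw f E E" "\<And>t. t \<le> m \<Longrightarrow> f ` Z t = Z' t" using Z(2) Z'(2) by force
  define \<pi> where "\<pi> e = (if e \<in> E then f e else e)" for e
  have "bij_betw \<pi> E E" using f(1) bij_betw_cong[of E \<pi> f] by (simp add: \<pi>_def)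
  then have "\<pi> permutes E" by (rule bij_imp_permutes) (auto simp: \<pi>_def)
  moreover have "\<pi> ` Z t = Z' t" if "t \<le> m" for t
  proof -
    have "\<pi> ` Z t = f ` Z t" using sub(1)[OF that] by (intro image_cong) (auto simp: \<pi>_def)
    then show ?thesis using f(2)[OF that] by simp
  qed
  ultimately show ?thesis by blast
qed

lemma linear_space_card_lines:
  assumes S: "linear_space P L s"
  shows "card L * s * (s - 1) = card P * (card P - 1)"
proof -
  have P: "finite P" "L \<subseteq> Pow P" "\<And>l. l \<in> L \<Longrightarrow> card l = s" using S unfolding linear_space_def by auto
  have finL: "finite L" using P finite_subset by blast
  have "(\<Sum>l\<in>L. card l) = (\<Sum>l\<in>L. \<Sum>a\<in>P. if a \<in> l then 1 else 0)"
  proof (rule sum.cong[OF refl])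
    fix l assume "l \<in> L"
    then have "{a\<in>P. a \<in> l} = l" using P by blast
    then show "card l = (\<Sum>a\<in>P. if a \<in> l then 1 else 0)" using P(1) by (simp add: sum.If_cases Int_def)
  qed
  also have "\<dots> = (\<Sum>a\<in>P. \<Sum>l\<in>L. if a \<in> l then 1 else 0)" by (rule sum.swap)
  also have "\<dots> = (\<Sum>a\<in>P. card {l\<in>L. a \<in> l})"
    using finL by (simp add: sum.If_cases Int_def)
  finally have "card L * s = (\<Sum>a\<in>P. card {l\<in>L. a \<in> l})" using P(3) by simp
  then have "card L * s * (s - 1) = (\<Sum>a\<in>P. card {l\<in>L. a \<in> l} * (s - 1))"
    by (simp add: sum_distrib_right)
  also have "\<dots> = (\<Sum>a\<in>P. card P - 1)"
    using linear_space_size[OF S] by (intro sum.cong) auto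
  finally show ?thesis by simp
qed

lemma linear_space_same_number:
  assumes "linear_space P L s" "linear_space P L' s"
  shows "card L = card L'"
proof -
  have "2 \<le> s" using assms(1) unfolding linear_space_def by blast
  then have "s * (s - 1) > 0" by simp
  moreover have "card L * (s * (s - 1)) = card L' * (s * (s - 1))"
    using linear_space_card_lines[OF assms(1)] linear_space_card_lines[OF assms(2)] by (simp add: mult.assoc)
  ultimately show ?thesis by simp
qed

definition chain_region :: "nat \<Rightarrow> (nat \<Rightarrow> 'a set) \<Rightarrow> ('a \<Rightarrow> real) set" where
  "chain_region k X = {x. (\<forall>e. e \<notin> X k \<longrightarrow> x e = 0) \<and> (\<forall>e\<in>X k. 0 \<le> x e \<and> x e \<le> 1) \<and>
     sum x (X k) = 3 * real k \<and> (\<forall>i<k. sum x (X (Suc i)) \<le> 3 * real (Suc i))}"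

definition line_polytope :: "nat \<Rightarrow> (nat \<Rightarrow> 'a set) \<Rightarrow> (nat \<Rightarrow> 'a set set) \<Rightarrow> ('a \<Rightarrow> real) set" where
  "line_polytope k X L = {x\<in>chain_region k X. \<forall>i<k. \<forall>l\<in>L i. sum x (X i \<union> l) \<le> 3 * real i + 2}"

text \<open>
  Two violated line conditions would add up: the lines \<open>l\<close>, \<open>l'\<close> share at most one point, so
  \<open>x(X i \<union> l) + x(X i \<union> l') \<le> x(X (Suc i)) + x(X i) + 1\<close>. So each block violates at most one.
\<close>

lemma violated_line_unique:
  assumes x: "x \<in> chain_region k X" and X: "X 0 = {}" "finite (X k)" "\<And>i. i < k \<Longrightarrow> X i \<subseteq> X (Suc i)"
    and i: "i < k" and S: "linear_space (X (Suc i) - X i) L s"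
    and l: "l \<in> L" "3 * real i + 2 < sum x (X i \<union> l)" and l': "l' \<in> L" "3 * real i + 2 < sum x (X i \<union> l')"
  shows "l = l'"
proof (rule ccontr)
  assume ne: "l \<noteq> l'"
  have mono: "X j \<subseteq> X k" if "j \<le> k" for j
    using that by (induction rule: inc_induct) (use X(3) in auto)
  have x01: "\<And>e. 0 \<le> x e" "\<And>e. x e \<le> 1"
  proof -
    fix e show "0 \<le> x e" "x e \<le> 1" using x unfolding chain_region_def by (cases "e \<in> X k"; simp)+
  qed
  have B: "X (Suc i) \<subseteq> X k" "X i \<subseteq> X k" using mono i by auto
  have sub: "l \<subseteq> X (Suc i) - X i" "l' \<subseteq> X (Suc i) - X i" using linear_space_sub[OF S] l l' by blast+
  have fin: "finite (X i)" "finite (X (Suc i))" using B X(2) finite_subset by blast+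
  then have finl: "finite l" "finite l'" using sub finite_subset by blast+
  have "card (l \<inter> l') \<le> 1"
  proof (rule ccontr)
    assume "\<not> card (l \<inter> l') \<le> 1"
    then have "2 \<le> card (l \<inter> l')" by simp
    from obtain_subset_with_card_n[OF this] obtain T where "T \<subseteq> l \<inter> l'" "card T = 2" by metis
    then obtain a b where "a \<in> l \<inter> l'" "b \<in> l \<inter> l'" "a \<noteq> b" unfolding card_2_iff by auto
    then show False using linear_space_unique[OF S l(1) l'(1), of a b] ne by blast
  qed
  moreover have "sum x (l \<inter> l') \<le> (\<Sum>e\<in>l \<inter> l'. 1)" using x01 by (intro sum_mono)
  ultimately have one: "sum x (l \<inter> l') \<le> 1" by simp
  have "sum x (X i) \<le> 3 * real i"
  proof (cases i)
    case 0
    then show ?thesis using X(1) by simp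
  next
    case (Suc j)
    then show ?thesis using x i unfolding chain_region_def by simp
  qed
  moreover have "sum x (X i \<union> (l \<inter> l')) = sum x (X i) + sum x (l \<inter> l')"
    using sub fin finl by (intro sum.union_disjoint) auto
  ultimately have "sum x (X i \<union> (l \<inter> l')) \<le> 3 * real i + 1" using one by linarith
  moreover have "sum x (X i \<union> l \<union> l') \<le> sum x (X (Suc i))"
    using sub X(3)[OF i] fin x01(1) by (intro sum_mono2) auto
  moreover have "sum x (X (Suc i)) \<le> 3 * real (Suc i)" using x i unfolding chain_region_def by blast
  moreover have "sum x ((X i \<union> l) \<union> (X i \<union> l')) + sum x ((X i \<union> l) \<inter> (X i \<union> l')) =
      sum x (X i \<union> l) + sum x (X i \<union> l')"
    using fin finl by (intro sum.union_inter) auto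
  moreover have "(X i \<union> l) \<union> (X i \<union> l') = X i \<union> l \<union> l'" "(X i \<union> l) \<inter> (X i \<union> l') = X i \<union> (l \<inter> l')"
    by blast+
  ultimately show False using l(2) l'(2) by simp
qed

text \<open>
  The terms of \<open>1 - (\<Sum>l\<in>L. [l is violated])\<close>, where the empty set, which is never a line, stands for
  the term 1. As at most one line is violated, this sum indicates that none is.
\<close>

definition line_factor :: "(nat \<Rightarrow> 'a set) \<Rightarrow> ('a \<Rightarrow> real) \<Rightarrow> nat \<Rightarrow> 'a set \<Rightarrow> real" where
  "line_factor X x i l = (if l = {} then 1 else - of_bool (3 * real i + 2 < sum x (X i \<union> l)))"

lemma line_polytope_product:
  assumes x: "x \<in> chain_region k X" and X: "X 0 = {}" "finite (X k)" "\<And>i. i < k \<Longrightarrow> X i \<subseteq> X (Suc i)"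
    and S: "\<And>i. i < k \<Longrightarrow> linear_space (X (Suc i) - X i) (L i) (s i)"
  shows "of_bool (x \<in> line_polytope k X L) =
    (\<Sum>\<phi>\<in>PiE {..<k} (\<lambda>i. insert {} (L i)). \<Prod>i<k. line_factor X x i (\<phi> i))"
proof -
  have finL: "finite (L i)" and ne: "{} \<notin> L i" if "i < k" for i
  proof -
    have "finite (X (Suc i) - X i)" "L i \<subseteq> Pow (X (Suc i) - X i)" using S[OF that] unfolding linear_space_def by auto
    then show "finite (L i)" using finite_subset by blast
    show "{} \<notin> L i" using S[OF that] unfolding linear_space_def by auto
  qed
  have factor: "(\<Sum>l\<in>insert {} (L i). line_factor X x i l) =
      of_bool (\<forall>l\<in>L i. sum x (X i \<union> l) \<le> 3 * real i + 2)" if i: "i < k" for i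
  proof -
    have "(\<Sum>l\<in>insert {} (L i). line_factor X x i l) = 1 + (\<Sum>l\<in>L i. line_factor X x i l)"
      using finL[OF i] ne[OF i] by (simp add: line_factor_def)
    also have "(\<Sum>l\<in>L i. line_factor X x i l) = - (\<Sum>l\<in>L i. of_bool (3 * real i + 2 < sum x (X i \<union> l)))"
      unfolding sum_negf[symmetric] using ne[OF i] by (intro sum.cong) (auto simp: line_factor_def)
    also have "1 + \<dots> = of_bool (\<forall>l\<in>L i. sum x (X i \<union> l) \<le> 3 * real i + 2)"
    proof (cases "\<exists>l\<in>L i. 3 * real i + 2 < sum x (X i \<union> l)")
      case True
      then obtain l0 where l0: "l0 \<in> L i" "3 * real i + 2 < sum x (X i \<union> l0)" by blast
      have "(\<Sum>l\<in>L i. of_bool (3 * real i + 2 < sum x (X i \<union> l))) = (\<Sum>l\<in>L i. if l = l0 then 1 else (0::real))"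
      proof (rule sum.cong[OF refl])
        fix l assume l: "l \<in> L i"
        show "of_bool (3 * real i + 2 < sum x (X i \<union> l)) = (if l = l0 then 1 else (0::real))"
        proof (cases "l = l0")
          case True
          then show ?thesis using l0(2) by simp
        next
          case False
          then have "\<not> 3 * real i + 2 < sum x (X i \<union> l)"
            using violated_line_unique[OF x X i S[OF i] l0 l] by blast
          then show ?thesis using False by simp
        qed
      qed
      also have "\<dots> = 1" using finL[OF i] l0 by simp
      finally show ?thesis using True by force
    next
      case False
      then have "(\<Sum>l\<in>L i. of_bool (3 * real i + 2 < sum x (X i \<union> l))) = (0::real)"
        by (intro sum.neutral) auto
      then show ?thesis using False by (simp add: not_less)
    qed
    finally show ?thesis .
  qed
  have "of_bool (x \<in> line_polytope k X L) =
      (\<Prod>i<k. of_bool (\<forall>l\<in>L i. sum x (X i \<union> l) \<le> 3 * real i + 2) :: real)"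
  proof (cases "x \<in> line_polytope k X L")
    case True
    then show ?thesis unfolding line_polytope_def by (simp add: prod.neutral)
  next
    case False
    then obtain i where "i < k" "\<not> (\<forall>l\<in>L i. sum x (X i \<union> l) \<le> 3 * real i + 2)"
      using x unfolding line_polytope_def by blast
    then have "(\<Prod>i<k. of_bool (\<forall>l\<in>L i. sum x (X i \<union> l) \<le> 3 * real i + 2) :: real) = 0"
      by (intro prod_zero) auto
    then show ?thesis using False by simp
  qed
  also have "\<dots> = (\<Prod>i<k. \<Sum>l\<in>insert {} (L i). line_factor X x i l)"
    using factor by (intro prod.cong) auto
  also have "\<dots> = (\<Sum>\<phi>\<in>PiE {..<k} (\<lambda>i. insert {} (L i)). \<Prod>i<k. line_factor X x i (\<phi> i))"
    using finL by (intro prod_sum_PiE) auto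
  finally show ?thesis .
qed

text \<open>
  Two choices of one line in each of some blocks, the same blocks for both choices, are related by a
  permutation that preserves the chain. So, in the expansion of the product, the number of
  arrangements of \<open>x\<close> depends on the lines only through their number and their sizes.
\<close>

lemma line_polytope_count:
  fixes X :: "nat \<Rightarrow> 'a set"
  assumes X: "X 0 = {}" "finite (X k)" "\<And>i. i < k \<Longrightarrow> X i \<subseteq> X (Suc i)"
    and S: "\<And>i. i < k \<Longrightarrow> linear_space (X (Suc i) - X i) (L i) (s i)"
    and S': "\<And>i. i < k \<Longrightarrow> linear_space (X (Suc i) - X i) (L' i) (s i)"
  shows "card {\<sigma>. \<sigma> permutes X k \<and> x \<circ> \<sigma> \<in> line_polytope k X L} =
    card {\<sigma>. \<sigma> permutes X k \<and> x \<circ> \<sigma> \<in> line_polytope k X L'}"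
proof -
  let ?P = "{\<sigma>. \<sigma> permutes X k}"
  define g where "g \<phi> y = of_bool (y \<in> chain_region k X) * (\<Prod>i<k. line_factor X y i (\<phi> i))"
    for \<phi> :: "nat \<Rightarrow> 'a set" and y
  define W where "W \<phi> = (\<Sum>\<sigma>\<in>?P. g \<phi> (x \<circ> \<sigma>))" for \<phi>
  have finP: "finite ?P" using X(2) by (simp add: finite_permutations)
  have count: "real (card {\<sigma>. \<sigma> permutes X k \<and> x \<circ> \<sigma> \<in> line_polytope k X K}) =
      (\<Sum>\<phi>\<in>PiE {..<k} (\<lambda>i. insert {} (K i)). W \<phi>)"
    if K: "\<And>i. i < k \<Longrightarrow> linear_space (X (Suc i) - X i) (K i) (s i)" for K
  proof -
    have "real (card {\<sigma>. \<sigma> permutes X k \<and> x \<circ> \<sigma> \<in> line_polytope k X K}) =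
        (\<Sum>\<sigma>\<in>?P. of_bool (x \<circ> \<sigma> \<in> line_polytope k X K))"
      using finP by (simp add: of_bool_def sum.If_cases Int_def)
    also have "\<dots> = (\<Sum>\<sigma>\<in>?P. \<Sum>\<phi>\<in>PiE {..<k} (\<lambda>i. insert {} (K i)). g \<phi> (x \<circ> \<sigma>))"
    proof (rule sum.cong[OF refl])
      fix \<sigma>
      show "of_bool (x \<circ> \<sigma> \<in> line_polytope k X K) = (\<Sum>\<phi>\<in>PiE {..<k} (\<lambda>i. insert {} (K i)). g \<phi> (x \<circ> \<sigma>))"
      proof (cases "x \<circ> \<sigma> \<in> chain_region k X")
        case True
        then show ?thesis unfolding g_def using line_polytope_product[OF True X K] by simp
      qed (simp add: g_def line_polytope_def)
    qed
    also have "\<dots> = (\<Sum>\<phi>\<in>PiE {..<k} (\<lambda>i. insert {} (K i)). W \<phi>)" unfolding W_def by (rule sum.swap)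
    finally show ?thesis .
  qed
  \<comment> \<open>Choices of the same sizes are related by a permutation that fixes the prefixes.\<close>
  have W_eq: "W \<phi> = W \<psi>"
    if sub: "\<And>i. i < k \<Longrightarrow> \<phi> i \<subseteq> X (Suc i) - X i" "\<And>i. i < k \<Longrightarrow> \<psi> i \<subseteq> X (Suc i) - X i"
      and cd: "\<And>i. i < k \<Longrightarrow> card (\<phi> i) = card (\<psi> i)" for \<phi> \<psi>
  proof -
    \<comment> \<open>The chain of prefixes, with the chosen line of each block inserted between two of them.\<close>
    define Z where "Z \<phi> t = (if even t then X (t div 2) else X (t div 2) \<union> \<phi> (t div 2))"
      for \<phi> :: "nat \<Rightarrow> 'a set" and t
    have fX: "finite (X i)" "X i \<subseteq> X k" if "i \<le> k" for i
    proof -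
      show "X i \<subseteq> X k" using that by (induction rule: inc_induct) (use X(3) in auto)
      then show "finite (X i)" using X(2) finite_subset by blast
    qed
    have step: "Z \<xi> t \<subseteq> Z \<xi> (Suc t)"
      if "t < 2 * k" "\<And>i. i < k \<Longrightarrow> \<xi> i \<subseteq> X (Suc i) - X i" for \<xi> t
    proof (cases "even t")
      case False
      then have "Suc t div 2 = Suc (t div 2)" "t div 2 < k" using that(1) by presburger+
      then show ?thesis using False that(2)[of "t div 2"] X(3)[of "t div 2"] unfolding Z_def by auto
    qed (auto simp: Z_def)
    have "\<exists>\<tau>. \<tau> permutes X k \<and> (\<forall>t\<le>2 * k. \<tau> ` Z \<phi> t = Z \<psi> t)"
    proof (rule chain_permutation[OF X(2)])
      show "card (Z \<phi> t) = card (Z \<psi> t)" if "t \<le> 2 * k" for t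
      proof (cases "even t")
        case False
        then have t: "t div 2 < k" using that by presburger
        have fin: "finite (\<phi> (t div 2))" "finite (\<psi> (t div 2))"
          using sub[OF t] fX(1)[of "Suc (t div 2)"] t by (meson Diff_subset finite_subset Suc_leI)+
        then have "card (X (t div 2) \<union> \<phi> (t div 2)) = card (X (t div 2)) + card (\<phi> (t div 2))"
          "card (X (t div 2) \<union> \<psi> (t div 2)) = card (X (t div 2)) + card (\<psi> (t div 2))"
          using sub[OF t] fX(1)[of "t div 2"] t by (intro card_Un_disjoint; auto)+
        then show ?thesis using False cd[OF t] unfolding Z_def by simp
      qed (simp add: Z_def)
    qed (use step sub in \<open>auto simp: Z_def\<close>)
    then obtain \<tau> where \<tau>: "\<tau> permutes X k" "\<And>t. t \<le> 2 * k \<Longrightarrow> \<tau> ` Z \<phi> t = Z \<psi> t" by blast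
    have \<tau>X: "\<tau> ` X i = X i" if "i \<le> k" for i using \<tau>(2)[of "2 * i"] that unfolding Z_def by simp
    have \<tau>l: "\<tau> ` (X i \<union> \<phi> i) = X i \<union> \<psi> i" if "i < k" for i
      using \<tau>(2)[of "2 * i + 1"] that unfolding Z_def by simp
    have sm: "sum (y \<circ> \<tau>) A = sum y (\<tau> ` A)" for y :: "'a \<Rightarrow> real" and A
      using permutes_inj_on[OF \<tau>(1)] by (simp add: sum.reindex)
    have "g \<phi> (y \<circ> \<tau>) = g \<psi> y" for y
    proof -
      have "(\<forall>e. e \<notin> X k \<longrightarrow> (y \<circ> \<tau>) e = 0) \<longleftrightarrow> (\<forall>e. e \<notin> X k \<longrightarrow> y e = 0)"
        using permutes_not_in[OF \<tau>(1)] by simp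
      moreover have "(\<forall>e\<in>X k. 0 \<le> (y \<circ> \<tau>) e \<and> (y \<circ> \<tau>) e \<le> 1) \<longleftrightarrow> (\<forall>e\<in>\<tau> ` X k. 0 \<le> y e \<and> y e \<le> 1)"
        by simp
      ultimately have "y \<circ> \<tau> \<in> chain_region k X \<longleftrightarrow> y \<in> chain_region k X"
        unfolding chain_region_def mem_Collect_eq sm using \<tau>X by simp
      moreover have "line_factor X (y \<circ> \<tau>) i (\<phi> i) = line_factor X y i (\<psi> i)" if i: "i < k" for i
      proof -
        have "finite (\<phi> i)" "finite (\<psi> i)"
          using sub[OF i] fX(1)[of "Suc i"] i by (meson Diff_subset finite_subset Suc_leI)+
        then have "\<phi> i = {} \<longleftrightarrow> \<psi> i = {}" using cd[OF i] by (metis card_eq_0_iff)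
        then show ?thesis unfolding line_factor_def sm \<tau>l[OF i] by simp
      qed
      then have "(\<Prod>i<k. line_factor X (y \<circ> \<tau>) i (\<phi> i)) = (\<Prod>i<k. line_factor X y i (\<psi> i))"
        by (intro prod.cong) auto
      ultimately show ?thesis unfolding g_def by simp
    qed
    then have "g \<psi> (x \<circ> \<sigma>) = g \<phi> (x \<circ> (\<sigma> \<circ> \<tau>))" for \<sigma>
      unfolding comp_assoc[symmetric] by (rule sym)
    then have "W \<psi> = (\<Sum>\<sigma>\<in>?P. g \<phi> (x \<circ> (\<sigma> \<circ> \<tau>)))" unfolding W_def by simp
    also have "\<dots> = W \<phi>"
      unfolding W_def using sum_permutations_compose_right[OF \<tau>(1), of "\<lambda>\<sigma>. g \<phi> (x \<circ> \<sigma>)"] by simp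
    finally show ?thesis ..
  qed
  have Lfin: "finite K" "{} \<notin> K" "\<And>l. l \<in> K \<Longrightarrow> card l = s i \<and> l \<subseteq> X (Suc i) - X i"
    if "i < k" "linear_space (X (Suc i) - X i) K (s i)" for K :: "'a set set" and i
  proof -
    have "finite (X (Suc i) - X i)" "K \<subseteq> Pow (X (Suc i) - X i)" using that(2) unfolding linear_space_def by auto
    then show "finite K" using finite_subset by blast
    show "{} \<notin> K" using that(2) unfolding linear_space_def by auto
    show "\<And>l. l \<in> K \<Longrightarrow> card l = s i \<and> l \<subseteq> X (Suc i) - X i" using that(2) unfolding linear_space_def by auto
  qed
  have "\<forall>i\<in>{..<k}. \<exists>\<beta>. bij_betw \<beta> (L i) (L' i)"
    using finite_same_card_bij Lfin(1) S S' linear_space_same_number by (metis lessThan_iff)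
  from bchoice[OF this] obtain \<beta> where \<beta>: "\<And>i. i < k \<Longrightarrow> bij_betw (\<beta> i) (L i) (L' i)" by auto
  define \<gamma> where "\<gamma> i l = (if l = {} then {} else \<beta> i l)" for i l
  have \<gamma>: "bij_betw (\<gamma> i) (insert {} (L i)) (insert {} (L' i))" if i: "i < k" for i
  proof -
    have "bij_betw (\<gamma> i) (L i) (L' i)"
      using \<beta>[OF i] Lfin(2)[OF i S[OF i]] bij_betw_cong[of "L i" "\<gamma> i" "\<beta> i"] unfolding \<gamma>_def by metis
    moreover have "bij_betw (\<gamma> i) {{}} {{}}" unfolding \<gamma>_def by (simp add: bij_betw_def)
    ultimately have "bij_betw (\<gamma> i) ({{}} \<union> L i) ({{}} \<union> L' i)"
      using Lfin(2)[OF i S'[OF i]] by (intro bij_betw_combine) auto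
    then show ?thesis by simp
  qed
  define \<Phi> where "\<Phi> \<phi> = restrict (\<lambda>i. \<gamma> i (\<phi> i)) {..<k}" for \<phi>
  define \<Psi> where "\<Psi> \<phi> = restrict (\<lambda>i. inv_into (insert {} (L i)) (\<gamma> i) (\<phi> i)) {..<k}" for \<phi>
  have "bij_betw \<Phi> (PiE {..<k} (\<lambda>i. insert {} (L i))) (PiE {..<k} (\<lambda>i. insert {} (L' i)))"
  proof (rule bij_betwI[where g = \<Psi>])
    show "\<Phi> \<in> PiE {..<k} (\<lambda>i. insert {} (L i)) \<rightarrow> PiE {..<k} (\<lambda>i. insert {} (L' i))"
    proof
      fix \<phi> assume \<phi>: "\<phi> \<in> PiE {..<k} (\<lambda>i. insert {} (L i))"
      show "\<Phi> \<phi> \<in> PiE {..<k} (\<lambda>i. insert {} (L' i))"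
      proof (rule PiE_I)
        fix i assume i: "i \<in> {..<k}"
        then have "\<gamma> i (\<phi> i) \<in> insert {} (L' i)"
          using bij_betwE[OF \<gamma>] PiE_mem[OF \<phi> i] by blast
        then show "\<Phi> \<phi> i \<in> insert {} (L' i)" using i unfolding \<Phi>_def by simp
      qed (simp add: \<Phi>_def)
    qed
    show "\<Psi> \<in> PiE {..<k} (\<lambda>i. insert {} (L' i)) \<rightarrow> PiE {..<k} (\<lambda>i. insert {} (L i))"
    proof
      fix \<phi> assume \<phi>: "\<phi> \<in> PiE {..<k} (\<lambda>i. insert {} (L' i))"
      show "\<Psi> \<phi> \<in> PiE {..<k} (\<lambda>i. insert {} (L i))"
      proof (rule PiE_I)
        fix i assume i: "i \<in> {..<k}"
        then have "inv_into (insert {} (L i)) (\<gamma> i) (\<phi> i) \<in> insert {} (L i)"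
          using bij_betwE[OF bij_betw_inv_into[OF \<gamma>]] PiE_mem[OF \<phi> i] by blast
        then show "\<Psi> \<phi> i \<in> insert {} (L i)" using i unfolding \<Psi>_def by simp
      qed (simp add: \<Psi>_def)
    qed
    show "\<Psi> (\<Phi> \<phi>) = \<phi>" if \<phi>: "\<phi> \<in> PiE {..<k} (\<lambda>i. insert {} (L i))" for \<phi>
    proof
      fix i show "\<Psi> (\<Phi> \<phi>) i = \<phi> i"
      proof (cases "i < k")
        case True
        then show ?thesis
          using bij_betw_inv_into_left[OF \<gamma>[OF True], of "\<phi> i"] PiE_mem[OF \<phi>, of i]
          unfolding \<Psi>_def \<Phi>_def by simp
      next
        case False
        then show ?thesis using PiE_arb[OF \<phi>, of i] unfolding \<Psi>_def by simp
      qed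
    qed
    show "\<Phi> (\<Psi> \<phi>) = \<phi>" if \<phi>: "\<phi> \<in> PiE {..<k} (\<lambda>i. insert {} (L' i))" for \<phi>
    proof
      fix i show "\<Phi> (\<Psi> \<phi>) i = \<phi> i"
      proof (cases "i < k")
        case True
        then show ?thesis
          using bij_betw_inv_into_right[OF \<gamma>[OF True], of "\<phi> i"] PiE_mem[OF \<phi>, of i]
          unfolding \<Psi>_def \<Phi>_def by simp
      next
        case False
        then show ?thesis using PiE_arb[OF \<phi>, of i] unfolding \<Phi>_def by simp
      qed
    qed
  qed
  then have "(\<Sum>\<phi>\<in>PiE {..<k} (\<lambda>i. insert {} (L' i)). W \<phi>) =
      (\<Sum>\<phi>\<in>PiE {..<k} (\<lambda>i. insert {} (L i)). W (\<Phi> \<phi>))"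
    by (rule sum.reindex_bij_betw[symmetric])
  also have "\<dots> = (\<Sum>\<phi>\<in>PiE {..<k} (\<lambda>i. insert {} (L i)). W \<phi>)"
  proof (rule sum.cong[OF refl])
    fix \<phi> assume \<phi>: "\<phi> \<in> PiE {..<k} (\<lambda>i. insert {} (L i))"
    have "(\<Phi> \<phi> i \<subseteq> X (Suc i) - X i \<and> \<phi> i \<subseteq> X (Suc i) - X i) \<and> card (\<Phi> \<phi> i) = card (\<phi> i)" if i: "i < k" for i
    proof (cases "\<phi> i = {}")
      case True
      then show ?thesis using i unfolding \<Phi>_def \<gamma>_def by simp
    next
      case False
      then have "\<phi> i \<in> L i" using PiE_mem[OF \<phi>, of i] i by simp
      moreover from this have "\<beta> i (\<phi> i) \<in> L' i" using bij_betwE[OF \<beta>[OF i]] by blast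
      ultimately show ?thesis
        using Lfin(3)[OF i S[OF i]] Lfin(3)[OF i S'[OF i]] False i unfolding \<Phi>_def \<gamma>_def by simp
    qed
    then show "W (\<Phi> \<phi>) = W \<phi>" by (intro W_eq) auto
  qed
  finally have "real (card {\<sigma>. \<sigma> permutes X k \<and> x \<circ> \<sigma> \<in> line_polytope k X L}) =
      real (card {\<sigma>. \<sigma> permutes X k \<and> x \<circ> \<sigma> \<in> line_polytope k X L'})"
    using count[OF S] count[OF S'] by simp
  then show ?thesis by simp
qed

section \<open>The chain of a tower is forced\<close>

text \<open>
  Exchange the elements of \<open>T - Y\<close> for those of \<open>Y - T\<close> along a bijection.
\<close>

lemma lowest_sum:
  fixes u :: "'a \<Rightarrow> real"
  assumes fin: "finite E" and Y: "Y \<subseteq> E" "T \<subseteq> E" "card T = card Y"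
    and low: "\<And>a b. a \<in> Y \<Longrightarrow> b \<in> E - Y \<Longrightarrow> u a \<le> u b"
  shows "sum u Y \<le> sum u T"
    and "(\<And>a b. a \<in> Y \<Longrightarrow> b \<in> E - Y \<Longrightarrow> u a < u b) \<Longrightarrow> sum u T \<le> sum u Y \<Longrightarrow> T = Y"
proof -
  have finY: "finite Y" "finite T" using Y fin finite_subset by blast+
  have "card (T - Y) = card (Y - T)"
    using card_Int_Diff[OF finY(1), of T] card_Int_Diff[OF finY(2), of Y] Y(3)
    by (simp add: Int_commute)
  then obtain h where h: "bij_betw h (T - Y) (Y - T)"
    using finite_same_card_bij[of "T - Y" "Y - T"] finY by blast
  have hm: "h b \<in> Y" "b \<in> E - Y" if "b \<in> T - Y" for b
    using bij_betwE[OF h] that Y by blast+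
  have eq: "sum u T - sum u Y = (\<Sum>b\<in>T - Y. u b - u (h b))"
  proof -
    have "sum u T = sum u (T \<inter> Y) + sum u (T - Y)" using finY by (metis sum.Int_Diff)
    moreover have "sum u Y = sum u (Y \<inter> T) + sum u (Y - T)" using finY by (metis sum.Int_Diff)
    moreover have "sum u (Y - T) = (\<Sum>b\<in>T - Y. u (h b))" using sum.reindex_bij_betw[OF h, of u] by simp
    ultimately show ?thesis by (simp add: sum_subtractf Int_commute)
  qed
  have "0 \<le> (\<Sum>b\<in>T - Y. u b - u (h b))" using low hm by (intro sum_nonneg) force
  then show "sum u Y \<le> sum u T" using eq by linarith
  assume strict: "\<And>a b. a \<in> Y \<Longrightarrow> b \<in> E - Y \<Longrightarrow> u a < u b" and le: "sum u T \<le> sum u Y"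
  have "T - Y = {}"
  proof (rule ccontr)
    assume "T - Y \<noteq> {}"
    then have "0 < (\<Sum>b\<in>T - Y. u b - u (h b))" using strict hm finY by (intro sum_pos) auto
    then show False using eq le by linarith
  qed
  then show "T = Y" using finY Y(3) by (intro card_subset_eq) auto
qed

context plane_tower
begin

text \<open>The index of the block that contains \<open>a\<close>.\<close>

definition level :: "'a \<Rightarrow> nat" where
  "level a = (LEAST i. a \<in> X (Suc i))"

text \<open>
  The weight is uniform on each block, with total three. It grows from block to block, since the
  blocks shrink.
\<close>

definition weight :: "'a \<Rightarrow> real" where
  "weight a = (if a \<in> X k then 3 / real (card (X (Suc (level a)) - X (level a))) else 0)"

lemma level_bounds:
  assumes "a \<in> X k"
  shows "level a < k" "a \<in> X (Suc (level a)) - X (level a)"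
proof -
  obtain k' where k': "k = Suc k'" using assms X_0 by (cases k) auto
  then have ex: "a \<in> X (Suc k')" using assms by simp
  show lt: "level a < k" using Least_le[of "\<lambda>i. a \<in> X (Suc i)", OF ex] k' unfolding level_def by simp
  have "a \<in> X (Suc (level a))" using LeastI[of "\<lambda>i. a \<in> X (Suc i)", OF ex] unfolding level_def .
  moreover have "a \<notin> X (level a)"
  proof (cases "level a")
    case 0
    then show ?thesis using X_0 by simp
  next
    case (Suc j)
    then show ?thesis using not_less_Least[of j "\<lambda>i. a \<in> X (Suc i)"] unfolding level_def by simp
  qed
  ultimately show "a \<in> X (Suc (level a)) - X (level a)" by blast
qed

lemma level_less_iff:
  assumes "a \<in> X k" "i \<le> k"
  shows "a \<in> X i \<longleftrightarrow> level a < i"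
proof
  assume "a \<in> X i"
  then show "level a < i"
    using level_bounds[OF assms(1)] X_mono[of i "level a"] by (meson DiffD2 less_imp_le_nat not_le subsetD)
next
  assume "level a < i"
  then show "a \<in> X i" using level_bounds[OF assms(1)] X_mono[of "Suc (level a)" i] assms(2) by auto
qed

lemma level_eq: "i < k \<Longrightarrow> a \<in> X (Suc i) - X i \<Longrightarrow> level a = i"
  using level_less_iff[of a i] level_less_iff[of a "Suc i"] X_mono[of "Suc i" k] by force

lemma weight_block: "i < k \<Longrightarrow> a \<in> X (Suc i) - X i \<Longrightarrow> weight a = 3 / real (card (X (Suc i) - X i))"
  using level_eq[of i a] X_mono[of "Suc i" k] unfolding weight_def by auto

lemma card_block_ge_3: "i < k \<Longrightarrow> 3 \<le> card (X (Suc i) - X i)"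
proof -
  assume i: "i < k"
  have "2 \<le> s i" using lines[OF i] unfolding linear_space_def by blast
  then show ?thesis using line_short[OF i] by linarith
qed

lemma card_block_less: "i < j \<Longrightarrow> j < k \<Longrightarrow> card (X (Suc j) - X j) < card (X (Suc i) - X i)"
proof (induction j)
  case (Suc j)
  then show ?case using decreasing[of j] by (cases "i = j") auto
qed simp

lemma weight_less:
  assumes "i \<le> k" "a \<in> X i" "b \<in> X k - X i"
  shows "weight a < weight b"
proof -
  have a: "a \<in> X k" using assms X_mono[of i k] by blast
  have "level a < level b" "level b < k"
    using level_less_iff[OF a assms(1)] level_less_iff[of b i] level_bounds[of b] assms by auto
  then have "card (X (Suc (level b)) - X (level b)) < card (X (Suc (level a)) - X (level a))"
    "0 < card (X (Suc (level b)) - X (level b))"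
    using card_block_less card_block_ge_3[of "level b"] by auto
  then show ?thesis using a assms(3) unfolding weight_def by (simp add: divide_strict_left_mono)
qed

lemma weight_bounds:
  assumes "a \<in> X k"
  shows "0 < weight a" "weight a \<le> 1"
  using card_block_ge_3[OF level_bounds(1)[OF assms]] assms unfolding weight_def by auto

lemma sum_weight_block:
  assumes i: "i < k" and T: "T \<subseteq> X (Suc i) - X i"
  shows "sum weight (X i \<union> T) = sum weight (X i) + 3 * real (card T) / real (card (X (Suc i) - X i))"
proof -
  have fin: "finite (X i)" "finite T" using finite_X[of i] finite_X[of "Suc i"] i T finite_subset by auto
  have "sum weight (X i \<union> T) = sum weight (X i) + sum weight T"
    using fin T by (intro sum.union_disjoint) auto
  also have "sum weight T = (\<Sum>a\<in>T. 3 / real (card (X (Suc i) - X i)))"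
    using weight_block[OF i] T by (intro sum.cong) auto
  finally show ?thesis by simp
qed

lemma sum_weight_X: "i \<le> k \<Longrightarrow> sum weight (X i) = 3 * real i"
proof (induction i)
  case 0
  then show ?case using X_0 by simp
next
  case (Suc i)
  then have i: "i < k" by simp
  have "X i \<union> (X (Suc i) - X i) = X (Suc i)" using X_Suc[OF i] by blast
  then show ?case
    using sum_weight_block[OF i order_refl] Suc card_block_ge_3[OF i] by simp
qed

lemma rank_polytope_tower: "rank_polytope (X k) r = line_polytope k X L"
proof
  have sub: "X i \<subseteq> X k" if "i \<le> k" for i using X_mono[OF that order_refl] .
  show "rank_polytope (X k) r \<subseteq> line_polytope k X L"
  proof
    fix x assume x: "x \<in> rank_polytope (X k) r"
    have "sum x (X i \<union> l) \<le> 3 * real i + 2" if i: "i < k" and l: "l \<in> L i" for i l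
    proof -
      have "X i \<union> l \<subseteq> X k" using line_sub[OF i l] sub[of i] sub[of "Suc i"] i by auto
      then show ?thesis using rank_polytopeD(3)[OF x, of "X i \<union> l"] rank_line[OF i l] by simp
    qed
    moreover have "sum x (X (Suc i)) \<le> 3 * real (Suc i)" if "i < k" for i
      using rank_polytopeD(3)[OF x sub] rank_X[of "Suc i"] that by (metis Suc_leI of_nat_mult of_nat_numeral)
    ultimately show "x \<in> line_polytope k X L"
      unfolding line_polytope_def chain_region_def
      using rank_polytopeD(1,2,4)[OF x] rank_polytope_le_1[OF rank x] rank_X[of k] by simp
  qed
  show "line_polytope k X L \<subseteq> rank_polytope (X k) r"
  proof
    fix x assume x: "x \<in> line_polytope k X L"
    then have "sum x A \<le> real (r A)" if "A \<subseteq> X k" for A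
      using that unfolding line_polytope_def chain_region_def by (intro polytope) auto
    then show "x \<in> rank_polytope (X k) r"
      using x rank_X[of k] unfolding rank_polytope_def line_polytope_def chain_region_def by auto
  qed
qed

lemma weight_in_polytope: "weight \<in> rank_polytope (X k) r"
proof -
  have "sum weight (X i \<union> l) \<le> 3 * real i + 2" if i: "i < k" and l: "l \<in> L i" for i l
  proof -
    have "card l = s i" using lines[OF i] l unfolding linear_space_def by blast
    moreover have "3 * real (s i) \<le> 2 * real (card (X (Suc i) - X i))"
      using line_short[OF i] by linarith
    then have "3 * real (s i) / real (card (X (Suc i) - X i)) \<le> 2"
      using card_block_ge_3[OF i] by (simp add: divide_le_eq)
    ultimately show ?thesis
      using sum_weight_block[OF i line_sub[OF i l]] sum_weight_X[of i] i by simp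
  qed
  moreover have "weight e = 0" if "e \<notin> X k" for e using that unfolding weight_def by simp
  ultimately show ?thesis
    unfolding rank_polytope_tower line_polytope_def chain_region_def
    using sum_weight_X weight_bounds by (auto simp: less_imp_le)
qed

lemma weight_chain_unique:
  assumes "i \<le> k" "T \<subseteq> X k" "card T = card (X i)" "sum weight T \<le> 3 * real i"
  shows "T = X i"
proof (rule lowest_sum(2)[of "X k" "X i" T weight])
  show "finite (X k)" using finite_X by simp
  show "weight a \<le> weight b" "weight a < weight b" if "a \<in> X i" "b \<in> X k - X i" for a b
    using weight_less[OF assms(1) that] by simp_all
  show "sum weight T \<le> sum weight (X i)" using assms(4) sum_weight_X[OF assms(1)] by simp
qed (use assms X_mono[of i k] in auto)

end

lemma tight_Inter:
  assumes rf: "rank_function E r" and x: "x \<in> rank_polytope E r"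
    and "finite \<A>" "\<And>A. A \<in> \<A> \<Longrightarrow> A \<subseteq> E \<and> sum x A = real (r A)"
  shows "E \<inter> \<Inter>\<A> \<subseteq> E \<and> sum x (E \<inter> \<Inter>\<A>) = real (r (E \<inter> \<Inter>\<A>))"
  using assms(3,4)
proof (induction \<A> rule: finite_induct)
  case empty
  then show ?case using rank_polytopeD(4)[OF x] by simp
next
  case (insert A \<A>)
  have "E \<inter> \<Inter>(insert A \<A>) = A \<inter> (E \<inter> \<Inter>\<A>)" by blast
  then show ?case using tight_Un_Int(2)[OF rf x, of A "E \<inter> \<Inter>\<A>"] insert by auto
qed

text \<open>
  Tight sets form a lattice, so \<open>Y\<close> is tight as an intersection over \<open>b\<close> of unions over \<open>a\<close> of the
  separating sets.
\<close>

lemma tight_by_separation: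
  assumes rf: "rank_function E r" and x: "x \<in> rank_polytope E r" and Y: "Y \<subseteq> E"
    and sep: "\<And>a b. a \<in> Y \<Longrightarrow> b \<in> E - Y \<Longrightarrow> \<exists>A\<subseteq>E. sum x A = real (r A) \<and> a \<in> A \<and> b \<notin> A"
  shows "sum x Y = real (r Y)"
proof -
  have finE: "finite E" using rank_functionD(1)[OF rf] .
  have "\<exists>U\<subseteq>E. sum x U = real (r U) \<and> Y \<subseteq> U \<and> b \<notin> U" if b: "b \<in> E - Y" for b
  proof -
    let ?\<A> = "{A. A \<subseteq> E \<and> sum x A = real (r A) \<and> b \<notin> A}"
    have "\<Union>?\<A> \<subseteq> E \<and> sum x (\<Union>?\<A>) = real (r (\<Union>?\<A>))"
      using finE by (intro tight_Union[OF rf x]) auto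
    moreover have "Y \<subseteq> \<Union>?\<A>" using sep[OF _ b] by blast
    moreover have "b \<notin> \<Union>?\<A>" by simp
    ultimately show ?thesis by metis
  qed
  then have "\<forall>b\<in>E - Y. \<exists>U. U \<subseteq> E \<and> sum x U = real (r U) \<and> Y \<subseteq> U \<and> b \<notin> U" by simp
  from bchoice[OF this] obtain U where
    U: "\<forall>b\<in>E - Y. U b \<subseteq> E \<and> sum x (U b) = real (r (U b)) \<and> Y \<subseteq> U b \<and> b \<notin> U b" by (rule exE)
  have "E \<inter> \<Inter>(U ` (E - Y)) \<subseteq> E \<and> sum x (E \<inter> \<Inter>(U ` (E - Y))) = real (r (E \<inter> \<Inter>(U ` (E - Y))))"
    using finE U by (intro tight_Inter[OF rf x]) auto
  moreover have "E \<inter> \<Inter>(U ` (E - Y)) = Y" using U Y by blast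
  ultimately show ?thesis by simp
qed

locale labelled_plane_tower = plane_tower k X L s r
  for k and X :: "nat \<Rightarrow> nat set" and L s r +
  fixes n :: nat
  assumes ground: "X k = {1..n}"
begin

text \<open>
  At the weight vector the tower has no room for raising the total weight of \<open>X i\<close>, in any
  arrangement: \<open>X i\<close> consists of the smallest weights. If the same holds for another matroid that
  contains the weight vector, then its tight sets must separate \<open>X i\<close> from the other elements.
\<close>

lemma chain_forced:
  assumes rf: "rank_function {1..n} r'" and w: "weight \<in> rank_polytope {1..n} r'"
    and vanish: "\<And>z. sym_count n r z = 0 \<Longrightarrow> sym_count n r' z = 0"
    and i: "i \<le> k"
  shows "r' (X i) = 3 * i"
proof -
  let ?E = "{1..n}"
  have XE: "X i \<subseteq> ?E" using X_mono[OF i order_refl] ground by simp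
  have finE: "finite ?E" by simp
  have "sum weight (X i) = real (r' (X i))"
  proof (rule tight_by_separation[OF rf w XE])
    fix a b assume a: "a \<in> X i" and b: "b \<in> ?E - X i"
    have ab: "a \<noteq> b" using a b by blast
    obtain \<delta> where \<delta>: "\<delta> > 0"
      "\<And>A t. A \<subseteq> ?E \<Longrightarrow> t \<le> card ?E \<Longrightarrow> sum weight A \<noteq> real t \<Longrightarrow> \<delta> \<le> \<bar>sum weight A - real t\<bar>"
      using integral_gap[OF finE] by blast
    \<comment> \<open>A shift that is small against the gap between ranks, the weight of \<open>b\<close> and all differences between the weights inside and outside of \<open>X i\<close>.\<close>
    define gaps where "gaps = insert \<delta> (insert (weight b) ((\<lambda>(c, d). weight d - weight c) ` (X i \<times> (?E - X i))))"
    have fin: "finite gaps" unfolding gaps_def using finite_X[OF i] by simp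
    have "g > 0" if "g \<in> gaps" for g
      using that \<delta>(1) weight_bounds(1)[of b] b weight_less[OF i] ground unfolding gaps_def by auto
    then have pos: "Min gaps > 0" using fin unfolding gaps_def by (subst Min_gr_iff) auto
    define \<eta> where "\<eta> = Min gaps / 2"
    have \<eta>0: "\<eta> > 0" using pos unfolding \<eta>_def by simp
    have small: "2 * \<eta> \<le> g" if "g \<in> gaps" for g using Min_le[OF fin that] unfolding \<eta>_def by simp
    define z where "z = weight(a := weight a + \<eta>, b := weight b - \<eta>)"
    have sz: "sum z A = sum weight A + (if a \<in> A then \<eta> else 0) - (if b \<in> A then \<eta> else 0)"
      if "A \<subseteq> ?E" for A
      unfolding z_def using sum_transfer[OF finite_subset[OF that finE] ab] .
    have szX: "sum z (X i) = 3 * real i + \<eta>" using sz[OF XE] a b sum_weight_X[OF i] by simp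
    \<comment> \<open>In any arrangement \<open>X i\<close> receives at least the sum of its smallest possible values, which now exceeds its rank.\<close>
    have "z \<circ> \<pi> \<notin> rank_polytope ?E r" if p: "\<pi> permutes ?E" for \<pi>
    proof
      assume "z \<circ> \<pi> \<in> rank_polytope ?E r"
      then have "sum (z \<circ> \<pi>) (X i) \<le> 3 * real i"
        using rank_polytopeD(3)[OF _ XE] rank_X[OF i] by fastforce
      moreover have "sum (z \<circ> \<pi>) (X i) = sum z (\<pi> ` X i)"
        using permutes_inj_on[OF p] by (simp add: sum.reindex)
      moreover have "sum z (X i) \<le> sum z (\<pi> ` X i)"
      proof (rule lowest_sum(1)[OF finE XE])
        show "\<pi> ` X i \<subseteq> ?E" using XE permutes_image[OF p] by blast
        show "card (\<pi> ` X i) = card (X i)" using permutes_inj_on[OF p] by (simp add: card_image)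
        fix c d assume c: "c \<in> X i" and d: "d \<in> ?E - X i"
        have "weight d - weight c \<in> gaps" 
        proof -
          have "(c, d) \<in> X i \<times> (?E - X i)" using c d by blast
          from imageI[OF this, of "\<lambda>(c, d). weight d - weight c"] show ?thesis
            unfolding gaps_def prod.case by (intro insertI2)
        qed
        then have "weight c + \<eta> \<le> weight d - \<eta>" using small by fastforce
        moreover have "z c \<le> weight c + \<eta>" "weight d - \<eta> \<le> z d"
          using c d a b \<eta>0 unfolding z_def by auto
        ultimately show "z c \<le> z d" by linarith
      qed
      ultimately show False using szX \<eta>0 by linarith
    qed
    then have "sym_count n r z = 0" unfolding sym_count_def by (simp add: finite_permutations)
    then have "sym_count n r' z = 0" by (rule vanish)
    then have "\<forall>\<pi>. \<pi> permutes ?E \<longrightarrow> z \<circ> \<pi> \<notin> rank_polytope ?E r'"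
      unfolding sym_count_def by (simp add: finite_permutations)
    then have "z \<circ> id \<notin> rank_polytope ?E r'" using permutes_id by blast
    then have z': "z \<notin> rank_polytope ?E r'" by simp
    show "\<exists>A\<subseteq>?E. sum weight A = real (r' A) \<and> a \<in> A \<and> b \<notin> A"
    proof (rule ccontr)
      assume no: "\<not> ?thesis"
      have "z \<in> rank_polytope ?E r'"
        unfolding rank_polytope_def mem_Collect_eq
      proof (intro conjI allI impI ballI)
        fix e assume "e \<notin> ?E" then show "z e = 0"
          using rank_polytopeD(1)[OF w, of e] a b XE unfolding z_def by auto
      next
        fix e assume e: "e \<in> ?E"
        have "weight b \<in> gaps" unfolding gaps_def by blast
        then show "0 \<le> z e"
          using small[of "weight b"] rank_polytopeD(2)[OF w, of e] rank_polytopeD(2)[OF w, of a] \<eta>0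
          unfolding z_def by auto
      next
        fix A assume A: "A \<subseteq> ?E"
        have le: "sum weight A \<le> real (r' A)" using rank_polytopeD(3)[OF w A] .
        show "sum z A \<le> real (r' A)"
        proof (cases "a \<in> A \<and> b \<notin> A")
          case True
          then have "sum weight A \<noteq> real (r' A)" using no A by blast
          moreover have "r' A \<le> card ?E"
            using rank_functionD(2)[OF rf A] card_mono[OF finE A] by linarith
          ultimately have "\<delta> \<le> \<bar>sum weight A - real (r' A)\<bar>" using \<delta>(2)[OF A] by blast
          moreover have "2 * \<eta> \<le> \<delta>" using small[of \<delta>] unfolding gaps_def by blast
          ultimately show ?thesis using le \<eta>0 True unfolding sz[OF A] by simp
        next
          case False
          then show ?thesis using le \<eta>0 unfolding sz[OF A] by auto
        qed
      next
        show "sum z ?E = real (r' ?E)"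
          unfolding sz[OF order_refl] using rank_polytopeD(4)[OF w] a b XE by auto
      qed
      then show False using z' by blast
    qed
  qed
  then show ?thesis using sum_weight_X[OF i] by simp
qed

text \<open>
  All arrangements of the weight vector in the other polytope put the same weights on the same
  chain, so there are at most as many as symmetries of the weight vector, all of which occur in the
  tower.
\<close>

lemma weight_count:
  assumes rf: "rank_function {1..n} r'"
    and vanish: "\<And>z. sym_count n r z = 0 \<Longrightarrow> sym_count n r' z = 0"
  shows "sym_count n r' weight \<le> sym_count n r weight"
proof -
  let ?E = "{1..n}"
  let ?S = "{\<sigma>. \<sigma> permutes ?E \<and> weight \<circ> \<sigma> \<in> rank_polytope ?E r'}"
  define H where "H = {\<sigma>. \<sigma> permutes ?E \<and> (\<forall>i\<le>k. \<sigma> ` X i = X i)}"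
  have XE: "X i \<subseteq> ?E" if "i \<le> k" for i using X_mono[OF that order_refl] ground by simp
  have finH: "finite H" unfolding H_def by (simp add: finite_permutations)
  have "H \<subseteq> {\<sigma>. \<sigma> permutes ?E \<and> weight \<circ> \<sigma> \<in> rank_polytope ?E r}"
  proof
    fix h assume h: "h \<in> H"
    then have p: "h permutes ?E" and hX: "\<And>i. i \<le> k \<Longrightarrow> h ` X i = X i" unfolding H_def by auto
    have "weight (h e) = weight e" for e
    proof (cases "e \<in> ?E")
      case True
      then have e: "e \<in> X k" using ground by simp
      let ?i = "level e"
      have i: "?i < k" "e \<in> X (Suc ?i) - X ?i" using level_bounds[OF e] by auto
      have "h e \<in> h ` X (Suc ?i) - h ` X ?i"
        using i(2) permutes_inj[OF p] by (auto simp: inj_image_mem_iff)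
      then have "h e \<in> X (Suc ?i) - X ?i" using hX[of ?i] hX[of "Suc ?i"] i(1) by simp
      then show ?thesis using weight_block[OF i(1)] i(2) by simp
    qed (simp add: permutes_not_in[OF p])
    then have "weight \<circ> h = weight" by auto
    then show "h \<in> {\<sigma>. \<sigma> permutes ?E \<and> weight \<circ> \<sigma> \<in> rank_polytope ?E r}"
      using p weight_in_polytope ground by simp
  qed
  then have HK: "card H \<le> sym_count n r weight"
    unfolding sym_count_def by (intro card_mono) (simp_all add: finite_permutations)
  have "card ?S \<le> card H"
  proof (cases "?S = {}")
    case False
    then obtain \<sigma>0 where \<sigma>0: "\<sigma>0 permutes ?E" "weight \<circ> \<sigma>0 \<in> rank_polytope ?E r'" by blast
    have forced: "r' (inv \<sigma> ` X i) = 3 * i" if \<sigma>: "\<sigma> \<in> ?S" and i: "i \<le> k" for \<sigma> i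
    proof -
      have p: "\<sigma> permutes ?E" and wm: "weight \<in> rank_polytope ?E (\<lambda>A. r' (inv \<sigma> ` A))"
        using \<sigma> rank_polytope_permute[of \<sigma> ?E weight r'] by auto
      have "sym_count n (\<lambda>A. r' (inv \<sigma> ` A)) z = sym_count n r' z" for z
        by (rule sym_count_permute[OF permutes_inv[OF p]])
      then show ?thesis
        using chain_forced[OF rank_function_permute[OF rf permutes_inv[OF p]] wm _ i] vanish by simp
    qed
    have same: "\<sigma> ` inv \<sigma>0 ` X i = X i" if \<sigma>: "\<sigma> \<in> ?S" and i: "i \<le> k" for \<sigma> i
    proof -
      have p: "\<sigma> permutes ?E" and wm: "weight \<in> rank_polytope ?E (\<lambda>A. r' (inv \<sigma> ` A))"
        using \<sigma> rank_polytope_permute[of \<sigma> ?E weight r'] by auto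
      have inv: "inv \<sigma> ` \<sigma> ` A = A" for A using permutes_inverses(2)[OF p] by (auto simp: image_image)
      have "r' (inv \<sigma>0 ` X i) = 3 * i" using forced[OF _ i, of \<sigma>0] \<sigma>0 by simp
      moreover have sub: "\<sigma> ` inv \<sigma>0 ` X i \<subseteq> ?E"
        using XE[OF i] permutes_image[OF p] permutes_image[OF permutes_inv[OF \<sigma>0(1)]] by blast
      ultimately have "sum weight (\<sigma> ` inv \<sigma>0 ` X i) \<le> 3 * real i"
        using rank_polytopeD(3)[OF wm sub] inv by simp
      moreover have "card (\<sigma> ` inv \<sigma>0 ` X i) = card (X i)"
        using permutes_inj_on[OF p] permutes_inj_on[OF permutes_inv[OF \<sigma>0(1)]]
        by (simp add: card_image)
      ultimately show ?thesis using weight_chain_unique[OF i] sub ground by simp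
    qed
    have "(\<lambda>\<sigma>. \<sigma> \<circ> inv \<sigma>0) ` ?S \<subseteq> H"
    proof
      fix \<tau> assume "\<tau> \<in> (\<lambda>\<sigma>. \<sigma> \<circ> inv \<sigma>0) ` ?S"
      then obtain \<sigma> where \<sigma>: "\<sigma> \<in> ?S" "\<tau> = \<sigma> \<circ> inv \<sigma>0" by blast
      then have "\<tau> permutes ?E" using permutes_compose[OF permutes_inv[OF \<sigma>0(1)]] by simp
      moreover have "\<tau> ` X i = X i" if "i \<le> k" for i
        using same[OF \<sigma>(1) that] \<sigma>(2) by (simp add: image_comp)
      ultimately show "\<tau> \<in> H" unfolding H_def by blast
    qed
    moreover have "inj_on (\<lambda>\<sigma>. \<sigma> \<circ> inv \<sigma>0) ?S"
    proof (rule inj_onI)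
      fix \<sigma> \<tau> assume "\<sigma> \<circ> inv \<sigma>0 = \<tau> \<circ> inv \<sigma>0"
      then have "\<sigma> \<circ> (inv \<sigma>0 \<circ> \<sigma>0) = \<tau> \<circ> (inv \<sigma>0 \<circ> \<sigma>0)" by (simp add: comp_assoc[symmetric])
      then show "\<sigma> = \<tau>" using permutes_inv_o(2)[OF \<sigma>0(1)] by simp
    qed
    ultimately show ?thesis using finH by (meson card_inj_on_le)
  next
    case True
    show ?thesis unfolding True by simp
  qed
  then show ?thesis using HK unfolding sym_count_def by linarith
qed

end

section \<open>Point-line flags in the blocks\<close>

text \<open>
  Point-line pairs in the minor \<open>M|(X \<union> B) / X\<close>, where \<open>m\<close> is the rank of \<open>X\<close>: the set \<open>l\<close> is a flat of rank
  2 with \<open>s\<close> elements, and \<open>a\<close> is not parallel to any other element of \<open>l\<close>.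
\<close>

definition block_flags ::
    "('a set \<Rightarrow> nat) \<Rightarrow> 'a set \<Rightarrow> 'a set \<Rightarrow> nat \<Rightarrow> nat \<Rightarrow> ('a \<times> 'a set) set" where
  "block_flags r X B s m = {(a, l). a \<in> l \<and> l \<subseteq> B \<and> card l = s \<and> r (X \<union> l) = m + 2 \<and>
     (\<forall>b\<in>l - {a}. m + 1 < r (X \<union> {a, b})) \<and> (\<forall>c\<in>B - l. m + 2 < r (X \<union> insert c l))}"

text \<open>
  Both lines are flats of rank 2 that contain the independent pair \<open>a\<close>, \<open>b\<close>.
\<close>

lemma block_flags_same_line:
  assumes rf: "rank_function E r" and E: "X \<subseteq> E" "B \<subseteq> E"
    and l: "(a, l) \<in> block_flags r X B s m" and l': "(a, l') \<in> block_flags r X B s m"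
    and b: "b \<in> l" "b \<in> l'" "b \<noteq> a"
  shows "l = l'"
proof -
  have sub: "l' \<subseteq> l"
    if l: "(a, l) \<in> block_flags r X B s m" and l': "(a, l') \<in> block_flags r X B s m"
      and b: "b \<in> l" "b \<in> l'" for l l'
  proof
    fix c assume c: "c \<in> l'"
    show "c \<in> l"
    proof (rule ccontr)
      assume "c \<notin> l"
      have m: "a \<in> l" "l \<subseteq> B" "r (X \<union> l) = m + 2" "m + 1 < r (X \<union> {a, b})" "a \<in> l'" "l' \<subseteq> B" "r (X \<union> l') = m + 2"
        using l l' b \<open>b \<noteq> a\<close> unfolding block_flags_def by auto
      have "m + 2 < r (X \<union> insert c l)" using l c m(6) \<open>c \<notin> l\<close> unfolding block_flags_def by auto
      also have "\<dots> \<le> r ((X \<union> l) \<union> (X \<union> l'))"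
        using c m E by (intro rank_functionD(3)[OF rf]) auto
      finally have "m + 2 < r ((X \<union> l) \<union> (X \<union> l'))" .
      moreover have "r (X \<union> {a, b}) \<le> r ((X \<union> l) \<inter> (X \<union> l'))"
        using m b E by (intro rank_functionD(3)[OF rf]) auto
      moreover have "r ((X \<union> l) \<union> (X \<union> l')) + r ((X \<union> l) \<inter> (X \<union> l')) \<le> r (X \<union> l) + r (X \<union> l')"
        using m E by (intro rank_functionD(4)[OF rf]) auto
      ultimately show False using m by linarith
    qed
  qed
  show ?thesis using sub[OF l l' b(1,2)] sub[OF l' l b(2,1)] by blast
qed

text \<open>
  The lines through a point \<open>a\<close> that occur in flags meet only in \<open>a\<close>, so there are at most as many
  as in a linear space with the same parameters. If there are as many, they cover the block.
\<close>

lemma block_flags_through_point: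
  assumes rf: "rank_function E r" and E: "X \<subseteq> E" "B \<subseteq> E" and S: "linear_space B L s" and a: "a \<in> B"
  shows "card {l. (a, l) \<in> block_flags r X B s m} \<le> card {l\<in>L. a \<in> l}"
    and "card {l. (a, l) \<in> block_flags r X B s m} = card {l\<in>L. a \<in> l} \<Longrightarrow> b \<in> B \<Longrightarrow> b \<noteq> a \<Longrightarrow>
      \<exists>l. (a, l) \<in> block_flags r X B s m \<and> b \<in> l"
proof -
  let ?F = "{l. (a, l) \<in> block_flags r X B s m}"
  have finB: "finite B" and s2: "2 \<le> s" using S unfolding linear_space_def by auto
  have FB: "l \<subseteq> B" "card l = s" "a \<in> l" if "l \<in> ?F" for l using that unfolding block_flags_def by auto
  have "?F \<subseteq> Pow B" using FB(1) by blast
  then have finF: "finite ?F" using finB by (meson finite_Pow_iff finite_subset)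
  have "card (\<Union>l\<in>?F. l - {a}) = (\<Sum>l\<in>?F. card (l - {a}))"
  proof (rule card_UN_disjoint[OF finF])
    show "\<forall>l\<in>?F. finite (l - {a})" using FB(1) finB finite_subset by blast
    show "\<forall>l\<in>?F. \<forall>l'\<in>?F. l \<noteq> l' \<longrightarrow> (l - {a}) \<inter> (l' - {a}) = {}"
      using block_flags_same_line[OF rf E] by blast
  qed
  also have "\<dots> = card ?F * (s - 1)" using FB by simp
  finally have cU: "card (\<Union>l\<in>?F. l - {a}) = card ?F * (s - 1)" .
  have sub: "(\<Union>l\<in>?F. l - {a}) \<subseteq> B - {a}" using FB(1) by blast
  have cB: "card (B - {a}) = card {l\<in>L. a \<in> l} * (s - 1)"
    using linear_space_size[OF S a] a finB by simp
  have "card ?F * (s - 1) \<le> card {l\<in>L. a \<in> l} * (s - 1)"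
    using card_mono[OF _ sub] finB cU cB by simp
  then show "card ?F \<le> card {l\<in>L. a \<in> l}" using s2 by simp
  assume eq: "card ?F = card {l\<in>L. a \<in> l}" and b: "b \<in> B" "b \<noteq> a"
  have "(\<Union>l\<in>?F. l - {a}) = B - {a}"
    using finB cU cB eq by (intro card_subset_eq sub) auto
  then have "b \<in> (\<Union>l\<in>?F. l - {a})" using b by simp
  then show "\<exists>l. (a, l) \<in> block_flags r X B s m \<and> b \<in> l" by blast
qed

lemma card_incidences:
  assumes "finite P" "finite {l. \<exists>a\<in>P. (a, l) \<in> F}" "F \<subseteq> P \<times> UNIV"
  shows "card F = (\<Sum>a\<in>P. card {l. (a, l) \<in> F})"
proof -
  have "F = (SIGMA a:P. {l. (a, l) \<in> F})" using assms(3) by auto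
  moreover have "card (SIGMA a:P. {l. (a, l) \<in> F}) = (\<Sum>a\<in>P. card {l. (a, l) \<in> F})"
    using assms(1,2) by (intro card_SigmaI) (auto intro: finite_subset)
  ultimately show ?thesis by simp
qed

text \<open>
  In the case of equality every point has its full number of lines, so these cover the block. Then no
  point is parallel to another one, every line forms a flag with each of its points, and any two
  points lie on exactly one of the lines.
\<close>

lemma block_flags_bound:
  fixes m :: nat
  assumes rf: "rank_function E r" and E: "X \<subseteq> E" "B \<subseteq> E" and S: "linear_space B L s"
  defines "F \<equiv> block_flags r X B s m" and "I \<equiv> {(a, l). l \<in> L \<and> a \<in> l}"
  shows "card F \<le> card I" and "card F = card I \<Longrightarrow> linear_space B (snd ` F) s"
proof -
  have finB: "finite B" and LB: "L \<subseteq> Pow B" using S unfolding linear_space_def by auto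
  have FB: "l \<subseteq> B" "card l = s" "a \<in> l" if "(a, l) \<in> F" for a l
    using that unfolding F_def block_flags_def by auto
  have fin: "finite {l. \<exists>a\<in>B. (a, l) \<in> F}" "finite {l. \<exists>a\<in>B. (a, l) \<in> I}"
  proof -
    have "{l. \<exists>a\<in>B. (a, l) \<in> F} \<subseteq> Pow B" using FB(1) by blast
    then show "finite {l. \<exists>a\<in>B. (a, l) \<in> F}" using finB by (meson finite_Pow_iff finite_subset)
    have "{l. \<exists>a\<in>B. (a, l) \<in> I} \<subseteq> Pow B" using LB unfolding I_def by blast
    then show "finite {l. \<exists>a\<in>B. (a, l) \<in> I}" using finB by (meson finite_Pow_iff finite_subset)
  qed
  have "F \<subseteq> B \<times> UNIV" using subsetD[OF FB(1) FB(3)] by auto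
  moreover have "I \<subseteq> B \<times> UNIV" using LB unfolding I_def by auto
  ultimately have cF: "card F = (\<Sum>a\<in>B. card {l. (a, l) \<in> F})" and cI: "card I = (\<Sum>a\<in>B. card {l. (a, l) \<in> I})"
    using card_incidences[OF finB fin(1)] card_incidences[OF finB fin(2)] by blast+
  have I: "{l. (a, l) \<in> I} = {l\<in>L. a \<in> l}" for a unfolding I_def by auto
  have le: "card {l. (a, l) \<in> F} \<le> card {l. (a, l) \<in> I}" if "a \<in> B" for a
    unfolding I F_def using block_flags_through_point(1)[OF rf E S that] .
  show "card F \<le> card I" unfolding cF cI using le by (rule sum_mono)
  assume "card F = card I"
  then have eq: "card {l. (a, l) \<in> F} = card {l. (a, l) \<in> I}" if "a \<in> B" for a
    unfolding cF cI using le finB that by (intro sum_mono_inv[of "\<lambda>a. card {l. (a, l) \<in> F}" B]) auto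
  have cover: "\<exists>l. (a, l) \<in> F \<and> b \<in> l" if "a \<in> B" "b \<in> B" "b \<noteq> a" for a b
    unfolding F_def using block_flags_through_point(2)[OF rf E S that(1) _ that(2,3)] eq[OF that(1)]
    unfolding I F_def by blast
  \<comment> \<open>By covering, \<open>a\<close> is not parallel to any other point, so every line forms a flag with each of its points.\<close>
  have any: "(a, l) \<in> F" if l: "l \<in> snd ` F" and a: "a \<in> l" for a l
  proof -
    obtain a' where a': "(a', l) \<in> F" using l by auto
    have "m + 1 < r (X \<union> {a, b})" if b: "b \<in> l - {a}" for b
    proof -
      obtain l' where l': "(a, l') \<in> F" "b \<in> l'" using cover[of a b] FB(1)[OF a'] a b by blast
      then show ?thesis using b unfolding F_def block_flags_def by auto
    qed
    then show ?thesis using a' a unfolding F_def block_flags_def by auto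
  qed
  show "linear_space B (snd ` F) s"
    unfolding linear_space_def
  proof (intro conjI ballI impI)
    show "finite B" by (rule finB)
    show "snd ` F \<subseteq> Pow B"
    proof (rule image_subsetI)
      fix p assume "p \<in> F"
      then show "snd p \<in> Pow B" using FB(1)[of "fst p" "snd p"] by simp
    qed
    show "card l = s" if "l \<in> snd ` F" for l using that FB by auto
    show "2 \<le> s" using S unfolding linear_space_def by blast
    fix a b assume ab: "a \<in> B" "b \<in> B" "a \<noteq> b"
    then obtain l where l: "(a, l) \<in> F" "b \<in> l" using cover[of a b] by blast
    show "\<exists>!l. l \<in> snd ` F \<and> a \<in> l \<and> b \<in> l"
    proof (rule ex1I[of _ l])
      show "l \<in> snd ` F \<and> a \<in> l \<and> b \<in> l" using l FB(3)[OF l(1)] by force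
      fix l' assume l': "l' \<in> snd ` F \<and> a \<in> l' \<and> b \<in> l'"
      then have "(a, l') \<in> F" using any by blast
      then show "l' = l"
        using block_flags_same_line[OF rf E, of a l' s m l b] l l' ab unfolding F_def by blast
    qed
  qed
qed

text \<open>
  A point-line pair \<open>f i\<close> in each block refines the chain \<open>X\<close> to one with three steps per block.
\<close>

definition flag_chain :: "(nat \<Rightarrow> 'a set) \<Rightarrow> (nat \<Rightarrow> 'a \<times> 'a set) \<Rightarrow> nat \<Rightarrow> 'a set" where
  "flag_chain X f t = (if t mod 3 = 0 then X (t div 3)
     else if t mod 3 = 1 then X (t div 3) \<union> {fst (f (t div 3))} else X (t div 3) \<union> snd (f (t div 3)))"

lemma flag_chain_simps:
  "flag_chain X f (3 * i) = X i" "flag_chain X f (Suc (3 * i)) = X i \<union> {fst (f i)}"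
  "flag_chain X f (Suc (Suc (3 * i))) = X i \<union> snd (f i)"
  "flag_chain X f (Suc (Suc (Suc (3 * i)))) = X (Suc i)"
proof -
  have "Suc (3 * i) div 3 = i" "Suc (3 * i) mod 3 = 1" "Suc (Suc (3 * i)) div 3 = i"
    "Suc (Suc (3 * i)) mod 3 = 2" "Suc (Suc (Suc (3 * i))) div 3 = Suc i" "Suc (Suc (Suc (3 * i))) mod 3 = 0"
    by presburger+
  then show "flag_chain X f (3 * i) = X i" "flag_chain X f (Suc (3 * i)) = X i \<union> {fst (f i)}"
    "flag_chain X f (Suc (Suc (3 * i))) = X i \<union> snd (f i)"
    "flag_chain X f (Suc (Suc (Suc (3 * i)))) = X (Suc i)"
    unfolding flag_chain_def by simp_all
qed

lemma less_3_times_cases: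
  fixes t k :: nat
  assumes "t < 3 * k"
  obtains i where "i < k" "t = 3 * i" | i where "i < k" "t = Suc (3 * i)" | i where "i < k" "t = Suc (Suc (3 * i))"
proof -
  have "t div 3 < k" "t = 3 * (t div 3) \<or> t = Suc (3 * (t div 3)) \<or> t = Suc (Suc (3 * (t div 3)))"
    using assms by presburger+
  then show thesis using that by blast
qed

context plane_tower
begin

definition incidences :: "nat \<Rightarrow> ('a \<times> 'a set) set" where
  "incidences i = {(a, l). l \<in> L i \<and> a \<in> l}"

lemma incidence_props:
  assumes "i < k" "p \<in> incidences i"
  shows "snd p \<in> L i" "fst p \<in> snd p" "snd p \<subseteq> X (Suc i) - X i" "card (snd p) = s i"
    "snd p \<subset> X (Suc i) - X i" "{fst p} \<subset> snd p"
proof -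
  show l: "snd p \<in> L i" "fst p \<in> snd p" using assms(2) unfolding incidences_def by auto
  show sub: "snd p \<subseteq> X (Suc i) - X i" using line_sub[OF assms(1) l(1)] .
  show c: "card (snd p) = s i" using lines[OF assms(1)] l(1) unfolding linear_space_def by blast
  have s2: "2 \<le> s i" using lines[OF assms(1)] unfolding linear_space_def by blast
  then show "{fst p} \<subset> snd p" using l(2) c by (metis card_1_singleton_iff empty_subsetI insert_subset
        numeral_le_one_iff One_nat_def psubsetI semiring_norm(69))
  have "s i < card (X (Suc i) - X i)" using line_short[OF assms(1)] s2 by linarith
  then show "snd p \<subset> X (Suc i) - X i" using sub c by auto
qed

lemma finite_incidences: "i < k \<Longrightarrow> finite (incidences i)"
proof -
  assume i: "i < k"
  have "incidences i \<subseteq> (X (Suc i) - X i) \<times> Pow (X (Suc i) - X i)"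
    using line_sub[OF i] unfolding incidences_def by blast
  moreover have "finite ((X (Suc i) - X i) \<times> Pow (X (Suc i) - X i))" using finite_X[of "Suc i"] i by simp
  ultimately show ?thesis by (rule finite_subset)
qed

lemma incidences_nonempty: "i < k \<Longrightarrow> incidences i \<noteq> {}"
proof -
  assume i: "i < k"
  have "2 \<le> card (X (Suc i) - X i)" using card_block_ge_3[OF i] by simp
  from obtain_subset_with_card_n[OF this] obtain T where "T \<subseteq> X (Suc i) - X i" "card T = 2" by metis
  then obtain a b where "a \<in> X (Suc i) - X i" "b \<in> X (Suc i) - X i" "a \<noteq> b"
    unfolding card_2_iff by auto
  then obtain l where "l \<in> L i" "a \<in> l" using linear_space_line[OF lines[OF i], of a b] by metis
  then show ?thesis unfolding incidences_def by blast
qed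

lemma flag_chain_psubset:
  assumes f: "\<And>i. i < k \<Longrightarrow> f i \<in> incidences i" and t: "t < 3 * k"
  shows "flag_chain X f t \<subset> flag_chain X f (Suc t)"
  using t
proof (cases rule: less_3_times_cases)
  case (1 i)
  then have "fst (f i) \<notin> X i" using incidence_props(2,3)[OF 1(1) f[OF 1(1)]] by blast
  then show ?thesis using 1 by (auto simp: flag_chain_simps)
next
  case (2 i)
  note p = incidence_props[OF 2(1) f[OF 2(1)]]
  obtain b where "b \<in> snd (f i)" "b \<noteq> fst (f i)" using p(6) by blast
  then show ?thesis using 2 p(2,3) by (auto simp: flag_chain_simps)
next
  case (3 i)
  note p = incidence_props[OF 3(1) f[OF 3(1)]]
  obtain b where "b \<in> X (Suc i) - X i" "b \<notin> snd (f i)" using p(5) by blast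
  then show ?thesis using 3 p(3) X_Suc[OF 3(1)] by (auto simp: flag_chain_simps)
qed

lemma card_flag_chain:
  assumes f: "\<And>i. i < k \<Longrightarrow> f i \<in> incidences i" and g: "\<And>i. i < k \<Longrightarrow> g i \<in> incidences i"
    and t: "t \<le> 3 * k"
  shows "card (flag_chain X f t) = card (flag_chain X g t)"
proof (cases "t = 3 * k")
  case True
  then show ?thesis by (simp add: flag_chain_simps)
next
  case False
  then have "t < 3 * k" using t by simp
  then show ?thesis
  proof (cases rule: less_3_times_cases)
    case (1 i)
    then show ?thesis by (simp add: flag_chain_simps)
  next
    case (2 i)
    have "fst (f i) \<notin> X i" "fst (g i) \<notin> X i"
      using incidence_props(2,3)[OF 2(1) f[OF 2(1)]] incidence_props(2,3)[OF 2(1) g[OF 2(1)]] by blast+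
    then show ?thesis using 2 finite_X[of i] by (simp add: flag_chain_simps)
  next
    case (3 i)
    note pf = incidence_props[OF 3(1) f[OF 3(1)]] and pg = incidence_props[OF 3(1) g[OF 3(1)]]
    have fin: "finite (X i)" "finite (X (Suc i) - X i)" using finite_X[of i] finite_X[of "Suc i"] 3(1) by auto
    then have "card (X i \<union> snd (f i)) = card (X i) + card (snd (f i))"
      "card (X i \<union> snd (g i)) = card (X i) + card (snd (g i))"
      using pf(3) pg(3) finite_subset[OF pf(3)] finite_subset[OF pg(3)]
      by (intro card_Un_disjoint; auto)+
    then show ?thesis using 3 pf(4) pg(4) by (simp add: flag_chain_simps)
  qed
qed

lemma flag_chain_flats:
  assumes f: "\<And>i. i < k \<Longrightarrow> f i \<in> incidences i"
  shows "flag_of_flats r (flag_chain X f) (3 * k)"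
  unfolding flag_of_flats_def
proof (intro conjI allI impI ballI)
  fix t assume t: "t \<le> 3 * k"
  show "r (flag_chain X f t) = t"
  proof (cases "t = 3 * k")
    case True
    then show ?thesis using rank_X[of k] by (simp add: flag_chain_simps)
  next
    case False
    then have "t < 3 * k" using t by simp
    then show ?thesis
    proof (cases rule: less_3_times_cases)
      case (1 i)
      then show ?thesis using rank_X[of i] by (simp add: flag_chain_simps)
    next
      case (2 i)
      note p = incidence_props[OF 2(1) f[OF 2(1)]]
      then have "fst (f i) \<in> X (Suc i) - X i" by blast
      from rank_point[OF 2(1) this] show ?thesis using 2 by (simp add: flag_chain_simps)
    next
      case (3 i)
      from rank_line[OF 3(1) incidence_props(1)[OF 3(1) f[OF 3(1)]]] show ?thesis
        using 3 by (simp add: flag_chain_simps)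
    qed
  qed
next
  fix t b assume t: "t < 3 * k" and b: "b \<in> flag_chain X f (Suc t) - flag_chain X f t"
  show "t < r (insert b (flag_chain X f t))"
    using t
  proof (cases rule: less_3_times_cases)
    case (1 i)
    note p = incidence_props[OF 1(1) f[OF 1(1)]]
    have "b \<in> X (Suc i) - X i" using b 1 p by (auto simp: flag_chain_simps)
    from rank_point[OF 1(1) this] show ?thesis using 1 by (simp add: flag_chain_simps)
  next
    case (2 i)
    note p = incidence_props[OF 2(1) f[OF 2(1)]]
    have "fst (f i) \<in> X (Suc i) - X i" "b \<in> X (Suc i) - X i" "fst (f i) \<noteq> b"
      using b 2 p(2,3) by (auto simp: flag_chain_simps)
    from rank_pair[OF 2(1) this] show ?thesis using 2 by (simp add: flag_chain_simps insert_commute)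
  next
    case (3 i)
    note p = incidence_props[OF 3(1) f[OF 3(1)]]
    have "b \<in> X (Suc i) - X i - snd (f i)" using b 3 by (auto simp: flag_chain_simps)
    from rank_plane[OF 3(1) p(1) this] show ?thesis using 3 by (simp add: flag_chain_simps)
  qed
qed

end

context labelled_plane_tower
begin

definition flag_arrangements :: "(nat \<Rightarrow> nat \<times> nat set) \<Rightarrow> (nat set \<Rightarrow> nat) \<Rightarrow> (nat \<Rightarrow> nat) set" where
  "flag_arrangements f r' = {\<pi>. \<pi> permutes {1..n} \<and> flag_of_flats (\<lambda>A. r' (\<pi> ` A)) (flag_chain X f) (3 * k)}"

definition flag_stabilizer :: "(nat \<Rightarrow> nat \<times> nat set) \<Rightarrow> (nat \<Rightarrow> nat) set" where
  "flag_stabilizer f = {\<tau>. \<tau> permutes {1..n} \<and> (\<forall>t\<le>3 * k. \<tau> ` flag_chain X f t = flag_chain X f t)}"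

definition flag_images :: "(nat \<Rightarrow> nat \<times> nat set) \<Rightarrow> (nat \<Rightarrow> nat) \<Rightarrow> nat \<Rightarrow> nat \<times> nat set" where
  "flag_images f \<pi> = restrict (\<lambda>i. (\<pi> (fst (f i)), \<pi> ` snd (f i))) {..<k}"

lemma finite_flag_arrangements: "finite (flag_arrangements f r')" "finite (flag_stabilizer f)"
  unfolding flag_arrangements_def flag_stabilizer_def by (simp_all add: finite_permutations)

text \<open>
  Arrangements of the reference flag are grouped by its image. All groups have the size of the
  stabilizer, so the arrangements are counted by the flags of the blocks, one block at a time.
\<close>

lemma flag_arrangements_le:
  assumes f: "\<And>i. i < k \<Longrightarrow> f i \<in> incidences i" and rf: "rank_function {1..n} r'"
    and uniq: "\<And>T i. i \<le> k \<Longrightarrow> T \<subseteq> {1..n} \<Longrightarrow> card T = card (X i) \<Longrightarrow> r' T = 3 * i \<Longrightarrow> T = X i"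
  shows "card (flag_arrangements f r') \<le>
    (\<Prod>i<k. card (block_flags r' (X i) (X (Suc i) - X i) (s i) (3 * i))) * card (flag_stabilizer f)"
proof -
  let ?G = "flag_arrangements f r'" and ?Z = "flag_chain X f"
  let ?F = "\<lambda>i. block_flags r' (X i) (X (Suc i) - X i) (s i) (3 * i)"
  have XE: "X i \<subseteq> {1..n}" if "i \<le> k" for i using X_mono[OF that order_refl] ground by simp
  have fixX: "\<pi> ` X i = X i" if \<pi>: "\<pi> \<in> ?G" and i: "i \<le> k" for \<pi> i
  proof (rule uniq[OF i])
    have p: "\<pi> permutes {1..n}" using \<pi> unfolding flag_arrangements_def by blast
    show "\<pi> ` X i \<subseteq> {1..n}" using XE[OF i] permutes_image[OF p] by blast
    show "card (\<pi> ` X i) = card (X i)" using permutes_inj_on[OF p] by (simp add: card_image)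
    have "r' (\<pi> ` ?Z (3 * i)) = 3 * i"
      using \<pi> i unfolding flag_arrangements_def flag_of_flats_def by simp
    then show "r' (\<pi> ` X i) = 3 * i" by (simp add: flag_chain_simps)
  qed
  have finF: "finite (?F i)" if "i < k" for i
  proof -
    have "?F i \<subseteq> (X (Suc i) - X i) \<times> Pow (X (Suc i) - X i)" unfolding block_flags_def by blast
    moreover have "finite ((X (Suc i) - X i) \<times> Pow (X (Suc i) - X i))" using finite_X[of "Suc i"] that by simp
    ultimately show ?thesis by (rule finite_subset)
  qed
  have "flag_images f ` ?G \<subseteq> PiE {..<k} ?F"
  proof clarify
    fix \<pi> assume \<pi>: "\<pi> \<in> ?G"
    then have p: "\<pi> permutes {1..n}" unfolding flag_arrangements_def by blast
    have inj: "inj \<pi>" using permutes_inj[OF p] .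
    have rk: "r' (\<pi> ` ?Z t) = t" if "t \<le> 3 * k" for t
      using \<pi> that unfolding flag_arrangements_def flag_of_flats_def by blast
    have up: "t < r' (\<pi> ` insert b (?Z t))" if "t < 3 * k" "b \<in> ?Z (Suc t) - ?Z t" for t b
      using \<pi> that unfolding flag_arrangements_def flag_of_flats_def by blast
    show "flag_images f \<pi> \<in> PiE {..<k} ?F"
    proof (rule PiE_I)
      fix i assume "i \<in> {..<k}"
      then have i: "i < k" by simp
      note q = incidence_props[OF i f[OF i]]
      have Xi: "\<pi> ` X i = X i" "\<pi> ` X (Suc i) = X (Suc i)" using fixX[OF \<pi>] i by auto
      have B: "\<pi> ` (X (Suc i) - X i) = X (Suc i) - X i" using image_set_diff[OF inj] Xi by metis
      have "(\<pi> (fst (f i)), \<pi> ` snd (f i)) \<in> ?F i"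
        unfolding block_flags_def mem_Collect_eq prod.case
      proof (intro conjI ballI)
        show "\<pi> (fst (f i)) \<in> \<pi> ` snd (f i)" using q(2) by blast
        show "\<pi> ` snd (f i) \<subseteq> X (Suc i) - X i" using image_mono[OF q(3), of \<pi>] B by simp
        show "card (\<pi> ` snd (f i)) = s i" using q(4) inj by (simp add: card_image inj_on_subset)
        show "r' (X i \<union> \<pi> ` snd (f i)) = 3 * i + 2"
          using rk[of "Suc (Suc (3 * i))"] i Xi by (simp add: flag_chain_simps image_Un)
      next
        fix b assume "b \<in> \<pi> ` snd (f i) - {\<pi> (fst (f i))}"
        then obtain b' where b': "b' \<in> snd (f i)" "b' \<noteq> fst (f i)" "b = \<pi> b'" by blast
        then have "b' \<in> ?Z (Suc (Suc (3 * i))) - ?Z (Suc (3 * i))"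
          using q(3) by (auto simp: flag_chain_simps)
        from up[OF _ this] show "3 * i + 1 < r' (X i \<union> {\<pi> (fst (f i)), b})"
          using i Xi b' by (simp add: flag_chain_simps insert_commute)
      next
        fix c assume c: "c \<in> X (Suc i) - X i - \<pi> ` snd (f i)"
        then have "c \<in> \<pi> ` (X (Suc i) - X i)" using B by simp
        then obtain c' where c': "c' \<in> X (Suc i) - X i" "c = \<pi> c'" by blast
        then have "c' \<in> ?Z (Suc (Suc (Suc (3 * i)))) - ?Z (Suc (Suc (3 * i)))"
          using c by (auto simp: flag_chain_simps)
        from up[OF _ this] show "3 * i + 2 < r' (X i \<union> insert c (\<pi> ` snd (f i)))"
          using i Xi c' by (simp add: flag_chain_simps image_Un)
      qed
      then show "flag_images f \<pi> i \<in> ?F i" using i unfolding flag_images_def by simp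
    qed (simp add: flag_images_def)
  qed
  then have "card (flag_images f ` ?G) \<le> card (PiE {..<k} ?F)"
    using finF by (intro card_mono finite_PiE) auto
  also have "\<dots> = (\<Prod>i<k. card (?F i))" by (rule card_PiE) simp
  finally have images: "card (flag_images f ` ?G) \<le> (\<Prod>i<k. card (?F i))" .
  have fibre: "card {\<pi>\<in>?G. flag_images f \<pi> = y} \<le> card (flag_stabilizer f)" if y: "y \<in> flag_images f ` ?G" for y
  proof -
    obtain \<pi>0 where \<pi>0: "\<pi>0 \<in> ?G" "y = flag_images f \<pi>0" using y by blast
    have p0: "\<pi>0 permutes {1..n}" using \<pi>0 unfolding flag_arrangements_def by blast
    have "(\<lambda>\<pi>. inv \<pi>0 \<circ> \<pi>) ` {\<pi>\<in>?G. flag_images f \<pi> = y} \<subseteq> flag_stabilizer f"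
    proof (rule image_subsetI)
      fix \<pi> assume "\<pi> \<in> {\<pi>\<in>?G. flag_images f \<pi> = y}"
      then have \<pi>: "\<pi> \<in> ?G" and im: "flag_images f \<pi> = y" by simp_all
      have p: "\<pi> permutes {1..n}" using \<pi> unfolding flag_arrangements_def by blast
      have same: "(\<pi> (fst (f i)), \<pi> ` snd (f i)) = (\<pi>0 (fst (f i)), \<pi>0 ` snd (f i))" if "i < k" for i
        using fun_cong[OF trans[OF im \<pi>0(2)], of i] that unfolding flag_images_def by simp
      have "\<pi> ` ?Z t = \<pi>0 ` ?Z t" if t: "t \<le> 3 * k" for t
      proof (cases "t = 3 * k")
        case True
        then show ?thesis using fixX[OF \<pi>] fixX[OF \<pi>0(1)] by (simp add: flag_chain_simps)
      next
        case False
        then have "t < 3 * k" using t by simp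
        then show ?thesis
          by (cases rule: less_3_times_cases)
            (use same fixX[OF \<pi>] fixX[OF \<pi>0(1)] in \<open>simp_all add: flag_chain_simps image_Un\<close>)
      qed
      moreover have "inv \<pi>0 ` \<pi>0 ` A = A" for A using permutes_inverses(2)[OF p0] by (simp add: image_image)
      ultimately have "(inv \<pi>0 \<circ> \<pi>) ` ?Z t = ?Z t" if "t \<le> 3 * k" for t
        using that by (metis image_comp)
      then show "inv \<pi>0 \<circ> \<pi> \<in> flag_stabilizer f"
        using permutes_compose[OF p permutes_inv[OF p0]] unfolding flag_stabilizer_def by blast
    qed
    moreover have "inj_on (\<lambda>\<pi>. inv \<pi>0 \<circ> \<pi>) {\<pi>\<in>?G. flag_images f \<pi> = y}"
    proof (rule inj_onI)
      fix \<pi> \<pi>' assume "inv \<pi>0 \<circ> \<pi> = inv \<pi>0 \<circ> \<pi>'"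
      then have "(\<pi>0 \<circ> inv \<pi>0) \<circ> \<pi> = (\<pi>0 \<circ> inv \<pi>0) \<circ> \<pi>'" by (simp add: comp_assoc)
      then show "\<pi> = \<pi>'" using permutes_inv_o(1)[OF p0] by simp
    qed
    ultimately show ?thesis using finite_flag_arrangements(2) by (meson card_inj_on_le)
  qed
  have "card ?G = (\<Sum>y\<in>flag_images f ` ?G. card {\<pi>\<in>?G. flag_images f \<pi> = y})"
    using sum.image_gen[OF finite_flag_arrangements(1), of "\<lambda>_. 1::nat" f r' "flag_images f"] by simp
  also have "\<dots> \<le> (\<Sum>y\<in>flag_images f ` ?G. card (flag_stabilizer f))" using fibre by (intro sum_mono)
  also have "\<dots> = card (flag_images f ` ?G) * card (flag_stabilizer f)" by simp
  also have "\<dots> \<le> (\<Prod>i<k. card (?F i)) * card (flag_stabilizer f)" using images by simp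
  finally show ?thesis .
qed

lemma flag_arrangements_ge:
  assumes f: "\<And>i. i < k \<Longrightarrow> f i \<in> incidences i"
  shows "(\<Prod>i<k. card (incidences i)) * card (flag_stabilizer f) \<le> card (flag_arrangements f r)"
proof -
  let ?G = "flag_arrangements f r" and ?Z = "flag_chain X f"
  have fibre: "card (flag_stabilizer f) \<le> card {\<pi>\<in>?G. flag_images f \<pi> = y} \<and> y \<in> flag_images f ` ?G"
    if y: "y \<in> PiE {..<k} incidences" for y
  proof -
    have yi: "y i \<in> incidences i" if "i < k" for i using PiE_mem[OF y, of i] that by simp
    let ?Y = "flag_chain X y"
    have "\<exists>\<pi>. \<pi> permutes {1..n} \<and> (\<forall>t\<le>3 * k. \<pi> ` ?Z t = ?Y t)"
    proof (rule chain_permutation)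
      show "?Z t \<subseteq> ?Z (Suc t)" "?Y t \<subseteq> ?Y (Suc t)" if "t < 3 * k" for t
        using flag_chain_psubset[of f, OF f that] flag_chain_psubset[of y, OF yi that] by auto
      show "?Z (3 * k) = {1..n}" "?Y (3 * k) = {1..n}" using ground by (simp_all add: flag_chain_simps)
      show "card (?Z t) = card (?Y t)" if "t \<le> 3 * k" for t using card_flag_chain[OF f yi that] by simp
    qed simp
    then obtain \<pi>0 where p0: "\<pi>0 permutes {1..n}" and \<pi>0: "\<And>t. t \<le> 3 * k \<Longrightarrow> \<pi>0 ` ?Z t = ?Y t" by blast
    have inG: "\<pi>0 \<circ> \<tau> \<in> {\<pi>\<in>?G. flag_images f \<pi> = y}" if \<tau>: "\<tau> \<in> flag_stabilizer f" for \<tau>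
    proof -
      let ?\<pi> = "\<pi>0 \<circ> \<tau>"
      have p: "?\<pi> permutes {1..n}"
        using \<tau> permutes_compose[OF _ p0] unfolding flag_stabilizer_def by blast
      have inj: "inj ?\<pi>" using permutes_inj[OF p] .
      have im: "?\<pi> ` ?Z t = ?Y t" if "t \<le> 3 * k" for t
      proof -
        have "\<tau> ` ?Z t = ?Z t" using \<tau> that unfolding flag_stabilizer_def by blast
        then show ?thesis using \<pi>0[OF that] by (metis image_comp)
      qed
      have fl: "flag_of_flats r ?Y (3 * k)" using flag_chain_flats yi by blast
      have "flag_of_flats (\<lambda>A. r (?\<pi> ` A)) ?Z (3 * k)"
        unfolding flag_of_flats_def
      proof (intro conjI allI impI ballI)
        fix t assume "t \<le> 3 * k"
        then show "r (?\<pi> ` ?Z t) = t" unfolding im[OF \<open>t \<le> 3 * k\<close>] using fl unfolding flag_of_flats_def by blast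
      next
        fix t b assume t: "t < 3 * k" and b: "b \<in> ?Z (Suc t) - ?Z t"
        have "?\<pi> b \<in> ?\<pi> ` ?Z (Suc t) - ?\<pi> ` ?Z t"
          using imageI[OF b, of ?\<pi>] unfolding image_set_diff[OF inj] .
        then have "?\<pi> b \<in> ?Y (Suc t) - ?Y t" using im[of t] im[of "Suc t"] t by simp
        then have "t < r (insert (?\<pi> b) (?Y t))" using fl t unfolding flag_of_flats_def by blast
        then show "t < r (?\<pi> ` insert b (?Z t))" using im[of t] t by simp
      qed
      moreover have "flag_images f ?\<pi> = y"
      proof
        fix i
        show "flag_images f ?\<pi> i = y i"
        proof (cases "i < k")
          case True
          note qf = incidence_props[OF True f[OF True]] and qy = incidence_props[OF True yi[OF True]]
          have e: "?\<pi> ` X i = X i" "?\<pi> ` (X i \<union> {fst (f i)}) = X i \<union> {fst (y i)}"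
            "?\<pi> ` (X i \<union> snd (f i)) = X i \<union> snd (y i)"
            using im[of "3 * i"] im[of "Suc (3 * i)"] im[of "Suc (Suc (3 * i))"] True
            by (simp_all only: flag_chain_simps)
          have "(X i \<union> {fst (f i)}) - X i = {fst (f i)}" "(X i \<union> {fst (y i)}) - X i = {fst (y i)}"
            "(X i \<union> snd (f i)) - X i = snd (f i)" "(X i \<union> snd (y i)) - X i = snd (y i)"
            using qf(2,3) qy(2,3) by blast+
          then have "?\<pi> ` {fst (f i)} = {fst (y i)}" "?\<pi> ` snd (f i) = snd (y i)"
            using image_set_diff[OF inj, of _ "X i"] e by metis+
          then show ?thesis using True unfolding flag_images_def by (simp add: prod_eq_iff)
        next
          case False
          then show ?thesis using PiE_arb[OF y, of i] unfolding flag_images_def by simp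
        qed
      qed
      ultimately show ?thesis using p unfolding flag_arrangements_def by blast
    qed
    have "inj_on (\<lambda>\<tau>. \<pi>0 \<circ> \<tau>) (flag_stabilizer f)"
    proof (rule inj_onI)
      fix \<tau> \<tau>' assume "\<pi>0 \<circ> \<tau> = \<pi>0 \<circ> \<tau>'"
      then have "(inv \<pi>0 \<circ> \<pi>0) \<circ> \<tau> = (inv \<pi>0 \<circ> \<pi>0) \<circ> \<tau>'" by (simp add: comp_assoc)
      then show "\<tau> = \<tau>'" using permutes_inv_o(2)[OF p0] by simp
    qed
    moreover have "finite {\<pi>\<in>?G. flag_images f \<pi> = y}" using finite_flag_arrangements(1) by simp
    moreover have "(\<lambda>\<tau>. \<pi>0 \<circ> \<tau>) ` flag_stabilizer f \<subseteq> {\<pi>\<in>?G. flag_images f \<pi> = y}" using inG by blast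
    ultimately have "card (flag_stabilizer f) \<le> card {\<pi>\<in>?G. flag_images f \<pi> = y}" by (meson card_inj_on_le)
    moreover have "id \<in> flag_stabilizer f" unfolding flag_stabilizer_def by (simp add: permutes_id)
    ultimately show ?thesis using inG by blast
  qed
  have "(\<Prod>i<k. card (incidences i)) * card (flag_stabilizer f) =
      (\<Sum>y\<in>PiE {..<k} incidences. card (flag_stabilizer f))"
    using card_PiE[of "{..<k}" incidences] by simp
  also have "\<dots> \<le> (\<Sum>y\<in>PiE {..<k} incidences. card {\<pi>\<in>?G. flag_images f \<pi> = y})"
    using fibre by (intro sum_mono) blast
  also have "\<dots> \<le> (\<Sum>y\<in>flag_images f ` ?G. card {\<pi>\<in>?G. flag_images f \<pi> = y})"
    using fibre finite_flag_arrangements(1) by (intro sum_mono2) auto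
  also have "\<dots> = card ?G"
    using sum.image_gen[OF finite_flag_arrangements(1), of "\<lambda>_. 1::nat" f r "flag_images f"] by simp
  finally show ?thesis .
qed

end

section \<open>Extremality\<close>

text \<open>
  A value that is an average of values not exceeding it equals all of them. All information about the
  members of a convex combination is obtained in this way.
\<close>

lemma convex_combination_of_maximum:
  fixes h :: "'j \<Rightarrow> real"
  assumes "finite J" "\<And>j. j \<in> J \<Longrightarrow> w j > 0" "sum w J = 1" "c = (\<Sum>j\<in>J. w j * h j)"
    and le: "\<And>j. j \<in> J \<Longrightarrow> h j \<le> c" and j: "j \<in> J"
  shows "h j = c"
proof -
  have "(\<Sum>j\<in>J. w j * (c - h j)) = c * sum w J - (\<Sum>j\<in>J. w j * h j)"
    by (simp add: right_diff_distrib sum_subtractf sum_distrib_left mult.commute)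
  then have "(\<Sum>j\<in>J. w j * (c - h j)) = 0" using assms(3,4) by simp
  moreover have "0 \<le> w j * (c - h j)" if "j \<in> J" for j using assms(2)[OF that] le[OF that] by simp
  ultimately have "\<forall>j\<in>J. w j * (c - h j) = 0"
    using sum_nonneg_eq_0_iff[OF assms(1), of "\<lambda>j. w j * (c - h j)"] by blast
  then have "w j * (c - h j) = 0" using j by blast
  then show ?thesis using assms(2)[OF j] by simp
qed

lemma positive_combination_zero:
  fixes h :: "'j \<Rightarrow> nat"
  assumes J: "finite J" and w: "\<And>j. j \<in> J \<Longrightarrow> w j > (0::real)"
    and zero: "(\<Sum>j\<in>J. w j * real (h j)) = 0" and j: "j \<in> J"
  shows "h j = 0"
proof -
  have "w j * real (h j) = 0"
    using zero sum_nonneg_eq_0_iff[OF J, of "\<lambda>j. w j * real (h j)"] w j by (simp add: less_imp_le)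
  then show ?thesis using w[OF j] by simp
qed

lemma prod_eq_imp_factors_eq:
  fixes f g :: "'i \<Rightarrow> nat"
  assumes "finite I" and le: "\<And>i. i \<in> I \<Longrightarrow> f i \<le> g i" and pos: "\<And>i. i \<in> I \<Longrightarrow> 0 < g i"
    and ge: "prod g I \<le> prod f I" and i: "i \<in> I"
  shows "f i = g i"
proof (rule ccontr)
  assume "f i \<noteq> g i"
  then have lt: "f i < g i" using le[OF i] by simp
  have "prod f I = f i * prod f (I - {i})" using assms(1) i by (simp add: prod.remove)
  also have "\<dots> \<le> f i * prod g (I - {i})" using le by (intro mult_left_mono prod_mono) auto
  also have "\<dots> < g i * prod g (I - {i})" using lt pos by (intro mult_strict_right_mono prod_pos) auto
  also have "\<dots> = prod g I" using assms(1) i by (simp add: prod.remove)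
  finally show False using ge by simp
qed

lemma card_permutations_inv: "card {\<sigma>. \<sigma> permutes E \<and> Q (inv \<sigma>)} = card {\<pi>. \<pi> permutes E \<and> Q \<pi>}"
proof (rule bij_betw_same_card[of inv], rule bij_betwI[where g = inv])
  show "inv \<in> {\<sigma>. \<sigma> permutes E \<and> Q (inv \<sigma>)} \<rightarrow> {\<pi>. \<pi> permutes E \<and> Q \<pi>}"
    by (auto intro: permutes_inv)
  show "inv \<in> {\<pi>. \<pi> permutes E \<and> Q \<pi>} \<rightarrow> {\<sigma>. \<sigma> permutes E \<and> Q (inv \<sigma>)}"
    by (auto intro: permutes_inv simp: permutes_inv_inv)
qed (auto simp: permutes_inv_inv)

context labelled_plane_tower
begin

lemma flag_arrangements_relation:
  assumes J: "finite J" and rf: "\<And>j. j \<in> J \<Longrightarrow> rank_function {1..n} (r' j)"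
    and comb: "\<And>x. real (sym_count n r x) = (\<Sum>j\<in>J. w j * real (sym_count n (r' j) x))"
    and f: "\<And>i. i < k \<Longrightarrow> f i \<in> incidences i"
  shows "real (card (flag_arrangements f r)) = (\<Sum>j\<in>J. w j * real (card (flag_arrangements f (r' j))))"
proof -
  let ?J = "insert None (Some ` J)"
  \<comment> \<open>The tower itself takes part in the relation, with coefficient \<open>- 1\<close>.\<close>
  define v where "v o' = (case o' of None \<Rightarrow> - 1 | Some j \<Rightarrow> w j)" for o'
  define R where "R o' = (case o' of None \<Rightarrow> r | Some j \<Rightarrow> r' j)" for o'
  have split: "(\<Sum>o'\<in>?J. v o' * h (R o')) = (\<Sum>j\<in>J. w j * h (r' j)) - h r" for h :: "(nat set \<Rightarrow> nat) \<Rightarrow> real"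
    using J by (simp add: v_def R_def sum.reindex)
  have "(\<Sum>o'\<in>?J. v o' * real (card {\<sigma>. \<sigma> permutes {1..n} \<and>
      flag_of_flats (\<lambda>A. R o' (inv \<sigma> ` A)) (flag_chain X f) (3 * k)})) = 0"
  proof (rule sum_sym_count_relation)
    show "rank_function {1..n} (R o')" if "o' \<in> ?J" for o'
      using that rf rank ground unfolding R_def by auto
    show "flag_chain X f (3 * k) = {1..n}" using ground by (simp add: flag_chain_simps)
    show "flag_chain X f i \<subset> flag_chain X f (Suc i)" if "i < 3 * k" for i
      using flag_chain_psubset[of f, OF f that] .
    show "(\<Sum>o'\<in>?J. v o' * real (sym_count n (R o') x)) = 0" for x
      using split[of "\<lambda>\<rho>. real (sym_count n \<rho> x)"] comb[of x] by simp
  qed (use J in simp)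
  moreover have "card {\<sigma>. \<sigma> permutes {1..n} \<and> flag_of_flats (\<lambda>A. \<rho> (inv \<sigma> ` A)) (flag_chain X f) (3 * k)} =
      card (flag_arrangements f \<rho>)" for \<rho>
    unfolding flag_arrangements_def
    using card_permutations_inv[of "{1..n}" "\<lambda>\<pi>. flag_of_flats (\<lambda>A. \<rho> (\<pi> ` A)) (flag_chain X f) (3 * k)"] .
  ultimately show ?thesis using split[of "\<lambda>\<rho>. real (card (flag_arrangements f \<rho>))"] by simp
qed

text \<open>
  Once the weight vector itself lies in all the polytopes, all matroids share the chain \<open>X\<close>. The flag
  counts then give linear spaces on the blocks, and these give the comparison of the polytopes.
\<close>

lemma rigid_at_weight:
  assumes J: "finite J" and w: "\<And>j. j \<in> J \<Longrightarrow> w j > 0" "sum w J = 1"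
    and rf: "\<And>j. j \<in> J \<Longrightarrow> rank_function {1..n} (r' j)"
    and comb: "\<And>x. real (sym_count n r x) = (\<Sum>j\<in>J. w j * real (sym_count n (r' j) x))"
    and wt: "\<And>j. j \<in> J \<Longrightarrow> weight \<in> rank_polytope {1..n} (r' j)"
    and j: "j \<in> J"
  shows "sym_count n (r' j) x = sym_count n r x"
proof -
  let ?E = "{1..n}"
  let ?B = "\<lambda>i. X (Suc i) - X i"
  let ?F = "\<lambda>j i. block_flags (r' j) (X i) (?B i) (s i) (3 * i)"
  have XE: "X i \<subseteq> ?E" if "i \<le> k" for i using X_mono[OF that order_refl] ground by simp
  have vanish: "sym_count n (r' j) z = 0" if "j \<in> J" "sym_count n r z = 0" for j z
    using positive_combination_zero[OF J w(1), where h = "\<lambda>j. sym_count n (r' j) z" and j = j] comb[of z] that by simp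
  have chain: "r' j (X i) = 3 * i" if "j \<in> J" "i \<le> k" for i j
    using chain_forced[OF rf[OF that(1)] wt[OF that(1)] vanish[OF that(1)] that(2)] .
  have uniq: "T = X i" if "j \<in> J" "i \<le> k" "T \<subseteq> ?E" "card T = card (X i)" "r' j T = 3 * i" for T i j
    using weight_chain_unique[OF that(2), of T] rank_polytopeD(3)[OF wt[OF that(1)] that(3)] that ground by simp
  have "\<forall>i\<in>{..<k}. \<exists>p. p \<in> incidences i" using incidences_nonempty by blast
  from bchoice[OF this] obtain f where f: "\<And>i. i < k \<Longrightarrow> f i \<in> incidences i" by auto
  have bound: "card (?F j i) \<le> card (incidences i)" if "j \<in> J" "i < k" for i j
    unfolding incidences_def using XE[of i] XE[of "Suc i"] that
    by (intro block_flags_bound(1)[OF rf _ _ lines]) auto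
  have "(\<Prod>i<k. card (?F j i)) \<le> (\<Prod>i<k. card (incidences i))" if "j \<in> J" for j
    using bound[OF that] by (intro prod_mono) auto
  moreover have upper: "card (flag_arrangements f (r' j)) \<le>
      (\<Prod>i<k. card (?F j i)) * card (flag_stabilizer f)" if "j \<in> J" for j
    by (rule flag_arrangements_le[OF _ rf[OF that]]) (use f uniq[OF that] in auto)
  moreover have lower: "(\<Prod>i<k. card (incidences i)) * card (flag_stabilizer f) \<le> card (flag_arrangements f r)"
    by (rule flag_arrangements_ge) (rule f)
  ultimately have le: "card (flag_arrangements f (r' j)) \<le> card (flag_arrangements f r)" if "j \<in> J" for j
    by (meson le_trans mult_le_mono1 that)
  have "real (card (flag_arrangements f (r' j))) = real (card (flag_arrangements f r))" if "j \<in> J" for j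
    using le by (intro convex_combination_of_maximum[OF J w flag_arrangements_relation[OF J rf comb f] _ that]) simp_all
  then have eq: "card (flag_arrangements f (r' j)) = card (flag_arrangements f r)" if "j \<in> J" for j
    using that by simp
  have "id \<in> flag_stabilizer f" unfolding flag_stabilizer_def by (simp add: permutes_id)
  then have stab: "0 < card (flag_stabilizer f)" using finite_flag_arrangements(2) by (auto simp: card_gt_0_iff)
  have prods: "(\<Prod>i<k. card (incidences i)) \<le> (\<Prod>i<k. card (?F j i))" if "j \<in> J" for j
  proof -
    have "(\<Prod>i<k. card (incidences i)) * card (flag_stabilizer f) \<le> (\<Prod>i<k. card (?F j i)) * card (flag_stabilizer f)"
      using lower upper[OF that] unfolding eq[OF that] by (rule order_trans)
    then show ?thesis using stab by simp
  qed
  have full: "card (?F j i) = card (incidences i)" if "j \<in> J" "i < k" for i j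
    using bound[OF that(1)] incidences_nonempty finite_incidences that prods[OF that(1)]
    by (intro prod_eq_imp_factors_eq[of "{..<k}"]) (auto simp: card_gt_0_iff)
  have space: "linear_space (?B i) (snd ` ?F j i) (s i)" if "j \<in> J" "i < k" for i j
    using full[OF that] XE[of i] XE[of "Suc i"] that(2) unfolding incidences_def
    by (intro block_flags_bound(2)[OF rf[OF that(1)] _ _ lines[OF that(2)]]) auto
  have count: "sym_count n (r' j) x \<le> sym_count n r x" if j: "j \<in> J" for j x
  proof -
    have "rank_polytope ?E (r' j) \<subseteq> line_polytope k X (\<lambda>i. snd ` ?F j i)"
    proof
      fix y assume y: "y \<in> rank_polytope ?E (r' j)"
      have "sum y (X i \<union> l) \<le> 3 * real i + 2" if i: "i < k" and l: "l \<in> snd ` ?F j i" for i l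
      proof -
        have "r' j (X i \<union> l) = 3 * i + 2" "l \<subseteq> ?B i" using l unfolding block_flags_def by auto
        moreover from this have "X i \<union> l \<subseteq> ?E" using XE[of i] XE[of "Suc i"] i by auto
        ultimately show ?thesis using rank_polytopeD(3)[OF y, of "X i \<union> l"] by simp
      qed
      moreover have "sum y (X (Suc i)) \<le> 3 * real (Suc i)" if "i < k" for i
        using rank_polytopeD(3)[OF y XE[of "Suc i"]] chain[OF j, of "Suc i"] that by simp
      ultimately show "y \<in> line_polytope k X (\<lambda>i. snd ` ?F j i)"
        unfolding line_polytope_def chain_region_def
        using rank_polytopeD(1,2,4)[OF y] rank_polytope_le_1[OF rf[OF j] y] chain[OF j, of k] ground by simp
    qed
    then have "sym_count n (r' j) x \<le> card {\<sigma>. \<sigma> permutes X k \<and> x \<circ> \<sigma> \<in> line_polytope k X (\<lambda>i. snd ` ?F j i)}"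
      unfolding sym_count_def ground by (intro card_mono) (auto simp: finite_permutations)
    also have "\<dots> = card {\<sigma>. \<sigma> permutes X k \<and> x \<circ> \<sigma> \<in> line_polytope k X L}"
      using X_0 finite_X[of k] X_Suc space[OF j] lines by (intro line_polytope_count) auto
    also have "\<dots> = sym_count n r x"
      using rank_polytope_tower unfolding sym_count_def ground by simp
    finally show ?thesis .
  qed
  have "real (sym_count n (r' j) x) = real (sym_count n r x)"
    using count by (intro convex_combination_of_maximum[OF J w comb[of x] _ j]) auto
  then show ?thesis by simp
qed

text \<open>
  Some arrangement of the weight vector lies in each of the polytopes. Relabelling the matroids by
  these arrangements does not change the counts and puts the weight vector itself into all polytopes.
\<close>

theorem rigid:
  assumes J: "finite J" and w: "\<And>j. j \<in> J \<Longrightarrow> w j > 0" "sum w J = 1"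
    and rf: "\<And>j. j \<in> J \<Longrightarrow> rank_function {1..n} (r' j)"
    and comb: "\<And>x. real (sym_count n r x) = (\<Sum>j\<in>J. w j * real (sym_count n (r' j) x))"
    and j: "j \<in> J"
  shows "sym_count n (r' j) x = sym_count n r x"
proof -
  have vanish: "sym_count n (r' j) z = 0" if "j \<in> J" "sym_count n r z = 0" for j z
    using positive_combination_zero[OF J w(1), where h = "\<lambda>j. sym_count n (r' j) z" and j = j] comb[of z] that by simp
  have "real (sym_count n (r' j) weight) = real (sym_count n r weight)" if "j \<in> J" for j
    using weight_count[OF rf vanish] by (intro convex_combination_of_maximum[OF J w comb _ that]) auto
  moreover have "weight \<circ> id \<in> rank_polytope {1..n} r" using weight_in_polytope ground by simp
  then have "sym_count n r weight > 0"
    unfolding sym_count_def by (auto simp: card_gt_0_iff finite_permutations intro: exI[of _ id] permutes_id)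
  ultimately have "sym_count n (r' j) weight > 0" if "j \<in> J" for j using that by simp
  then have "\<forall>j\<in>J. \<exists>\<sigma>. \<sigma> permutes {1..n} \<and> weight \<circ> \<sigma> \<in> rank_polytope {1..n} (r' j)"
    unfolding sym_count_def by (force simp: card_gt_0_iff)
  from bchoice[OF this] obtain \<sigma> where
    \<sigma>: "\<forall>j\<in>J. \<sigma> j permutes {1..n} \<and> weight \<circ> \<sigma> j \<in> rank_polytope {1..n} (r' j)" by (rule exE)
  define r'' where "r'' j A = r' j (inv (\<sigma> j) ` A)" for j A
  have p: "inv (\<sigma> j) permutes {1..n}" if "j \<in> J" for j using \<sigma> permutes_inv that by blast
  have same: "sym_count n (r'' j) x = sym_count n (r' j) x" if "j \<in> J" for j x
    unfolding r''_def using sym_count_permute[OF p[OF that]] .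
  have "sym_count n (r'' j) x = sym_count n r x"
  proof (rule rigid_at_weight[OF J w _ _ _ j])
    show "rank_function {1..n} (r'' j)" if "j \<in> J" for j
      unfolding r''_def by (rule rank_function_permute[OF rf[OF that] p[OF that]])
    show "real (sym_count n r x) = (\<Sum>j\<in>J. w j * real (sym_count n (r'' j) x))" for x
      using comb[of x] same by simp
    show "weight \<in> rank_polytope {1..n} (r'' j)" if "j \<in> J" for j
      unfolding r''_def using \<sigma> rank_polytope_permute[of "\<sigma> j" "{1..n}" weight "r' j"] that by blast
  qed
  then show ?thesis using same[OF j] by simp
qed

end

theorem corollary4p8:
  fixes M :: "nat \<Rightarrow> 'a matroid" and q :: "nat \<Rightarrow> nat" and n :: nat
    and N :: "nat \<Rightarrow> nat matroid"
  assumes "1 \<le> n"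
    and "\<And>i. i \<in> {1..n} \<Longrightarrow> projective_plane_matroid (q i) (M i) \<or> affine_plane_matroid (q i) (M i)"
    and "disjoint_family_on (\<lambda>i. ground (M i)) {1..n}"
    and "\<And>i j. 1 \<le> i \<Longrightarrow> i < j \<Longrightarrow> j \<le> n \<Longrightarrow> q i > q j"
    and "nested_enumeration (matroid_rank (iterated_free_product M n))
           (card (ground (iterated_free_product M n))) N"
  shows "extremal N (iterated_free_product M n)"
proof -
  let ?P = "iterated_free_product M n"
  let ?X = "\<lambda>i. \<Union>j\<in>{1..i}. ground (M j)"
  let ?E = "{1..card (ground ?P)}"
  note tower = plane_tower_iterated_free_product[OF assms(1-4)]
  obtain s where T: "plane_tower n ?X (\<lambda>i. matroid_lines (M (Suc i))) s (rank_in ?P)"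
    using tower(3) by blast
  obtain K :: "nat matroid" where K: "matroid K" "ground K = ?E" "isomorphic ?P K"
    using standard_copy_exists[OF tower(1)] by blast
  then obtain f where f: "bij_betw f (ground ?P) (ground K)"
    "\<And>I. I \<subseteq> ground ?P \<Longrightarrow> indep ?P I \<longleftrightarrow> indep K (f ` I)"
    unfolding isomorphic_def by blast
  have fX: "f ` ?X n = ?E" using f(1) K(2) tower(2) by (simp add: bij_betw_def)
  have "plane_tower n (\<lambda>i. f ` ?X i) (\<lambda>i. image f ` matroid_lines (M (Suc i))) s (rank_in K)"
  proof (rule plane_tower_image[OF T])
    show "inj_on f (?X n)" using f(1) tower(2) by (simp add: bij_betw_def)
    show "rank_in K (f ` A) = rank_in ?P A" if "A \<subseteq> ?X n" for A
      using rank_image_isomorphism[OF f] that tower(2) by simp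
    show "rank_function (f ` ?X n) (rank_in K)" using rank_function_rank_in[OF K(1)] fX K(2) by simp
  qed
  then interpret labelled_plane_tower n "\<lambda>i. f ` ?X i" "\<lambda>i. image f ` matroid_lines (M (Suc i))" s
      "rank_in K" "card (ground ?P)"
    unfolding labelled_plane_tower_def labelled_plane_tower_axioms_def using fX by blast
  show ?thesis
  proof (rule extremal_if_indicator_extreme[OF tower(1) assms(5) _ K(3)])
    show "K \<in> matroids_on (matroid_rank ?P) (card (ground ?P))"
      using K isomorphic_card_rank(2)[OF K(3)] unfolding matroids_on_def by simp
    fix J :: "(nat \<Rightarrow> real) set" and w K' j x
    assume J: "finite J" "\<And>j. j \<in> J \<Longrightarrow> K' j \<in> matroids_on (matroid_rank ?P) (card (ground ?P))"
      "\<And>j. j \<in> J \<Longrightarrow> w j > 0" "sum w J = 1"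
      "\<And>x. real (sym_count (card (ground ?P)) (rank_in K) x) =
        (\<Sum>j\<in>J. w j * real (sym_count (card (ground ?P)) (rank_in (K' j)) x))" "j \<in> J"
    have "rank_function ?E (rank_in (K' j))" if "j \<in> J" for j
      using J(2)[OF that] rank_function_rank_in[of "K' j"] unfolding matroids_on_def by auto
    then show "sym_count (card (ground ?P)) (rank_in (K' j)) x = sym_count (card (ground ?P)) (rank_in K) x"
      using rigid[OF J(1,3,4) _ J(5,6)] by blast
  qed
qed

end
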